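(* For any symmetric monoidal category $\mathcal A$, one has $S_{\mathcal A,\mathcal I}\circ R'_{\mathcal A}=L'_{\mathcal A}:\mathcal A\to\mathcal I\otimes\mathcal A$ in $\mathrm{SMC}$.
   Context: **Basics.** All symmetric monoidal categories are small, with tensor $\otimes$, unit $I$ and natural isomorphisms $ass_{a,b,c}:a\otimes(b\otimes c)\to(a\otimes b)\otimes c$, $r_a:a\otimes I\to a$, $l_a:I\otimes a\to a$, $s_{a,b}:a\otimes b\to b\otimes a$ satisfying the usual coherence axioms. A symmetric monoidal functor $F:\mathcal A\to\mathcal B$ is a lax one: a functor with an arrow $F^0:I\to F(I)$ and a natural family $F^2_{x,y}:Fx\otimes Fy\to F(x\otimes y)$ satisfying the usual associativity, unit and symmetry axioms; it is strict if $F^0$ and all $F^2_{x,y}$ are identities. $\mathrm{SMC}$ is the 2-category of symmetric monoidal categories, symmetric monoidal functors and monoidal natural transformations. **Internal hom.** $[\mathcal A,\mathcal B]$ is the category $\mathrm{SMC}(\mathcal A,\mathcal B)$ with the pointwise symmetric monoidal structure: $(F\Box G)(a)=Fa\otimes Ga$, $(F\Box G)^0$ is $I\cong I\otimes I\xrightarrow{F^0\otimes G^0}F(I)\otimes G(I)$, $(F\Box G)^2_{a,b}$ is the canonical interchange $(Fa\otimes Ga)\otimes(Fb\otimes Gb)\cong(Fa\otimes Fb)\otimes(Ga\otimes Gb)$ followed by $F^2_{a,b}\otimes G^2_{a,b}$; $(\sigma\Box\tau)_a=\sigma_a\otimes\tau_a$; the unit is the constant functor at $I_{\mathcal B}$ (with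 $I\to I$ the identity and $I\otimes I\to I$ the canonical arrow); $ass,r,l,s$ are pointwise. For an object $a$ of $\mathcal A$, $ev_a:[\mathcal A,\mathcal B]\to\mathcal B$ is the strict symmetric monoidal functor $F\mapsto Fa$, $\sigma\mapsto\sigma_a$. **Duality.** For $F:\mathcal A\to[\mathcal B,\mathcal C]$ in $\mathrm{SMC}$, its dual $F^*:\mathcal B\to[\mathcal A,\mathcal C]$ is given by $F^*(b)(a)=F(a)(b)$, $F^*(b)(f)=F(f)_b$, $(F^*b)^0=(F^0)_b$, $(F^*b)^2_{a,a'}=(F^2_{a,a'})_b$, $F^*(g)_a=F(a)(g)$, $((F^* )^0)_a=(Fa)^0$, $((F^* )^2_{b,b'})_a=(Fa)^2_{b,b'}$. **Tensor.** $\mathcal A\otimes\mathcal B$ is the following symmetric monoidal category. Its objects are the formal words freely generated from a constant $I$ and symbols $a\otimes b$ ($a$ in $\mathcal A$, $b$ in $\mathcal B$) under a formal binary operation $X\otimes Y$. Its arrows are freely generated, under composition and the operations $p\mapsto X\otimes p$, $p\mapsto p\otimes X$ for objects $X$, by formal arrows $ass,r,l$ (with formal inverses) and $s$ for all objects, and by arrows $\alpha_b:I\to I_{\mathcal A}\otimes b$; $\beta_a:I\to a\otimes I_{\mathcal B}$; $\gamma_{a,a',b}:(a\otimes b)\otimes(a'\otimes b)\to(a\otimes a')\otimes b$; $\delta_{a,b,b'}:(a\otimes b)\otimes(a\otimes b')\to a\otimes(b\otimes b')$; $a\otimes g:a\otimes b\to a\otimes b'$ for $g:b\to b'$ in $\mathcal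 B$; $f\otimes b:a\otimes b\to a'\otimes b$ for $f:a\to a'$ in $\mathcal A$; modulo the smallest congruence, compatible with all $X\otimes-$ and $-\otimes X$, such that: (i) $\otimes$ is a bifunctor and $\otimes,I,ass,r,l,s$ form a symmetric monoidal structure; (ii) for each $a$, $b\mapsto a\otimes b$, $g\mapsto a\otimes g$ with structure $\beta_a$, $\delta_{a,-,-}$ is a symmetric monoidal functor $\eta(a):\mathcal B\to\mathcal A\otimes\mathcal B$; (iii) for each $b$, $a\mapsto a\otimes b$, $f\mapsto f\otimes b$ with structure $\alpha_b$, $\gamma_{-,-,b}$ is a symmetric monoidal functor $\mathcal A\to\mathcal A\otimes\mathcal B$; (iv) for each $f:a\to a'$ the family $(f\otimes b)_b$, and for each $g:b\to b'$ the family $(a\otimes g)_a$, is a monoidal natural transformation between the corresponding functors of (ii), resp. (iii); (v) with $c:I\otimes I\to I$ canonical, $\alpha_{b\otimes b'}\circ c=\delta_{I_{\mathcal A},b,b'}\circ(\alpha_b\otimes\alpha_{b'})$, $\beta_{a\otimes a'}\circ c=\gamma_{a,a',I_{\mathcal B}}\circ(\beta_a\otimes\beta_{a'})$, and $\beta_{I_{\mathcal A}}=\alpha_{I_{\mathcal B}}$; (vi) $\gamma_{a,a',b\otimes b'}\circ(\delta_{a,b,b'}\otimes\delta_{a',b,b'})=\delta_{a\otimes a',b,b'}\circ(\gamma_{a,a',b}\otimes\gamma_{a,a',b'})\circ m$, where $m$ is the canonical isomorphism exchanging the two middle factors $a\otimes b'$ and $a'\otimes b$. The symmetric monoidal functor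 $\eta:\mathcal A\to[\mathcal B,\mathcal A\otimes\mathcal B]$ is $a\mapsto\eta(a)$, $\eta(f)_b=f\otimes b$, $(\eta^0)_b=\alpha_b$, $(\eta^2_{a,a'})_b=\gamma_{a,a',b}$. **$En$ and canonical arrows.** For $F:\mathcal A\to[\mathcal B,\mathcal C]$, $En(F):\mathcal A\otimes\mathcal B\to\mathcal C$ is the strict symmetric monoidal functor with $a\otimes b\mapsto F(a)(b)$, $\alpha_b\mapsto(F^0)_b$, $\beta_a\mapsto(Fa)^0$, $\gamma_{a,a',b}\mapsto(F^2_{a,a'})_b$, $\delta_{a,b,b'}\mapsto(Fa)^2_{b,b'}$, $f\otimes b\mapsto F(f)_b$, $a\otimes g\mapsto F(a)(g)$. $S_{\mathcal A,\mathcal B}=En(\eta^* ):\mathcal A\otimes\mathcal B\to\mathcal B\otimes\mathcal A$, where $\eta^*:\mathcal A\to[\mathcal B,\mathcal B\otimes\mathcal A]$ is the dual of $\eta:\mathcal B\to[\mathcal A,\mathcal B\otimes\mathcal A]$. $\mathcal I$ is the free symmetric monoidal category on one generating object $\star$ (for each symmetric monoidal category $\mathcal X$ and object $x$ there is a unique strict symmetric monoidal functor $\mathcal I\to\mathcal X$ sending $\star$ to $x$; its objects are formal words in $I,\star,\otimes$). $R'_{\mathcal A}$ is $\mathcal A\xrightarrow{\eta}[\mathcal I,\mathcal A\otimes\mathcal I]\xrightarrow{ev_\star}\mathcal A\otimes\mathcal I$, and $L'_{\mathcal A}$ is $\mathcal A\xrightarrow{\eta^*}[\mathcal I,\mathcal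 I\otimes\mathcal A]\xrightarrow{ev_\star}\mathcal I\otimes\mathcal A$, with $\eta^*$ the dual of $\eta:\mathcal I\to[\mathcal A,\mathcal I\otimes\mathcal A]$. *)

theory Defs
  imports Main "HOL-Library.FuncSet"
begin

section \<open>Symmetric monoidal categories\<close>

text \<open>
  Inverses of the structural isomorphisms are carried as data; they are determined by the
  axioms below. Composition is written in applicative order. The associator goes from
  \<open>a \<odot> (b \<odot> c)\<close> to \<open>(a \<odot> b) \<odot> c\<close>.
\<close>

record ('o, 'm) smcat =
  Obj :: "'o set"
  Arr :: "'m set"
  Src :: "'m \<Rightarrow> 'o"
  Tgt :: "'m \<Rightarrow> 'o"
  Ide :: "'o \<Rightarrow> 'm" ("\<one>\<index>")
  Comp :: "'m \<Rightarrow> 'm \<Rightarrow> 'm" (infixl "\<cdot>\<index>" 65)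
  Unit :: "'o" ("\<I>\<index>")
  TenO :: "'o \<Rightarrow> 'o \<Rightarrow> 'o" (infixl "\<odot>\<index>" 70)
  TenA :: "'m \<Rightarrow> 'm \<Rightarrow> 'm" (infixl "\<otimes>\<index>" 70)
  Ass :: "'o \<Rightarrow> 'o \<Rightarrow> 'o \<Rightarrow> 'm" ("ass\<index>")
  AssInv :: "'o \<Rightarrow> 'o \<Rightarrow> 'o \<Rightarrow> 'm" ("ass'_inv\<index>")
  Rho :: "'o \<Rightarrow> 'm" ("\<r>\<index>")
  RhoInv :: "'o \<Rightarrow> 'm" ("\<r>'_inv\<index>")
  Lam :: "'o \<Rightarrow> 'm" ("\<l>\<index>")
  LamInv :: "'o \<Rightarrow> 'm" ("\<l>'_inv\<index>")
  Sym :: "'o \<Rightarrow> 'o \<Rightarrow> 'm" ("\<s>\<index>")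

definition hom :: "('o, 'm) smcat \<Rightarrow> 'o \<Rightarrow> 'o \<Rightarrow> 'm set" where
  "hom C a b = {f \<in> Arr C. Src C f = a \<and> Tgt C f = b}"

locale symmetric_monoidal_category =
  fixes C :: "('o, 'm) smcat" (structure)
  assumes src_obj: "f \<in> Arr C \<Longrightarrow> Src C f \<in> Obj C"
    and tgt_obj: "f \<in> Arr C \<Longrightarrow> Tgt C f \<in> Obj C"
    and ide_hom: "a \<in> Obj C \<Longrightarrow> \<one> a \<in> hom C a a"
    and comp_hom: "\<lbrakk>f \<in> hom C a b; g \<in> hom C b c\<rbrakk> \<Longrightarrow> g \<cdot> f \<in> hom C a c"
    and comp_ide_right: "f \<in> hom C a b \<Longrightarrow> f \<cdot> \<one> a = f"
    and comp_ide_left: "f \<in> hom C a b \<Longrightarrow> \<one> b \<cdot> f = f"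
    and comp_assoc: "\<lbrakk>f \<in> hom C a b; g \<in> hom C b c; h \<in> hom C c d\<rbrakk> \<Longrightarrow>
          h \<cdot> (g \<cdot> f) = h \<cdot> g \<cdot> f"
    and unit_obj: "\<I> \<in> Obj C"
    and ten_obj: "\<lbrakk>a \<in> Obj C; b \<in> Obj C\<rbrakk> \<Longrightarrow> a \<odot> b \<in> Obj C"
    and ten_hom: "\<lbrakk>f \<in> hom C a b; g \<in> hom C c d\<rbrakk> \<Longrightarrow> f \<otimes> g \<in> hom C (a \<odot> c) (b \<odot> d)"
    and ten_ide: "\<lbrakk>a \<in> Obj C; b \<in> Obj C\<rbrakk> \<Longrightarrow> \<one> a \<otimes> \<one> b = \<one> (a \<odot> b)"
    and ten_comp: "\<lbrakk>f \<in> hom C a b; f' \<in> hom C b c; g \<in> hom C d e; g' \<in> hom C e k\<rbrakk> \<Longrightarrow>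
          (f' \<cdot> f) \<otimes> (g' \<cdot> g) = (f' \<otimes> g') \<cdot> (f \<otimes> g)"
    and ass_hom: "\<lbrakk>a \<in> Obj C; b \<in> Obj C; c \<in> Obj C\<rbrakk> \<Longrightarrow>
          ass a b c \<in> hom C (a \<odot> (b \<odot> c)) ((a \<odot> b) \<odot> c)"
    and ass_inv_hom: "\<lbrakk>a \<in> Obj C; b \<in> Obj C; c \<in> Obj C\<rbrakk> \<Longrightarrow>
          ass_inv a b c \<in> hom C ((a \<odot> b) \<odot> c) (a \<odot> (b \<odot> c))"
    and ass_inv_left: "\<lbrakk>a \<in> Obj C; b \<in> Obj C; c \<in> Obj C\<rbrakk> \<Longrightarrow>
          ass_inv a b c \<cdot> ass a b c = \<one> (a \<odot> (b \<odot> c))"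
    and ass_inv_right: "\<lbrakk>a \<in> Obj C; b \<in> Obj C; c \<in> Obj C\<rbrakk> \<Longrightarrow>
          ass a b c \<cdot> ass_inv a b c = \<one> ((a \<odot> b) \<odot> c)"
    and ass_natural: "\<lbrakk>f \<in> hom C a a'; g \<in> hom C b b'; h \<in> hom C c c'\<rbrakk> \<Longrightarrow>
          ass a' b' c' \<cdot> (f \<otimes> (g \<otimes> h)) = ((f \<otimes> g) \<otimes> h) \<cdot> ass a b c"
    and rho_hom: "a \<in> Obj C \<Longrightarrow> \<r> a \<in> hom C (a \<odot> \<I>) a"
    and rho_inv_hom: "a \<in> Obj C \<Longrightarrow> \<r>_inv a \<in> hom C a (a \<odot> \<I>)"
    and rho_inv_left: "a \<in> Obj C \<Longrightarrow> \<r>_inv a \<cdot> \<r> a = \<one> (a \<odot> \<I>)"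
    and rho_inv_right: "a \<in> Obj C \<Longrightarrow> \<r> a \<cdot> \<r>_inv a = \<one> a"
    and rho_natural: "f \<in> hom C a a' \<Longrightarrow> \<r> a' \<cdot> (f \<otimes> \<one> \<I>) = f \<cdot> \<r> a"
    and lam_hom: "a \<in> Obj C \<Longrightarrow> \<l> a \<in> hom C (\<I> \<odot> a) a"
    and lam_inv_hom: "a \<in> Obj C \<Longrightarrow> \<l>_inv a \<in> hom C a (\<I> \<odot> a)"
    and lam_inv_left: "a \<in> Obj C \<Longrightarrow> \<l>_inv a \<cdot> \<l> a = \<one> (\<I> \<odot> a)"
    and lam_inv_right: "a \<in> Obj C \<Longrightarrow> \<l> a \<cdot> \<l>_inv a = \<one> a"
    and lam_natural: "f \<in> hom C a a' \<Longrightarrow> \<l> a' \<cdot> (\<one> \<I> \<otimes> f) = f \<cdot> \<l> a"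
    and sym_hom: "\<lbrakk>a \<in> Obj C; b \<in> Obj C\<rbrakk> \<Longrightarrow> \<s> a b \<in> hom C (a \<odot> b) (b \<odot> a)"
    and sym_sym: "\<lbrakk>a \<in> Obj C; b \<in> Obj C\<rbrakk> \<Longrightarrow> \<s> b a \<cdot> \<s> a b = \<one> (a \<odot> b)"
    and sym_natural: "\<lbrakk>f \<in> hom C a a'; g \<in> hom C b b'\<rbrakk> \<Longrightarrow>
          \<s> a' b' \<cdot> (f \<otimes> g) = (g \<otimes> f) \<cdot> \<s> a b"
    and pentagon: "\<lbrakk>a \<in> Obj C; b \<in> Obj C; c \<in> Obj C; d \<in> Obj C\<rbrakk> \<Longrightarrow>
          ass (a \<odot> b) c d \<cdot> ass a b (c \<odot> d) =
          (ass a b c \<otimes> \<one> d) \<cdot> ass a (b \<odot> c) d \<cdot> (\<one> a \<otimes> ass b c d)"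
    and triangle: "\<lbrakk>a \<in> Obj C; b \<in> Obj C\<rbrakk> \<Longrightarrow>
          (\<r> a \<otimes> \<one> b) \<cdot> ass a \<I> b = \<one> a \<otimes> \<l> b"
    and hexagon: "\<lbrakk>a \<in> Obj C; b \<in> Obj C; c \<in> Obj C\<rbrakk> \<Longrightarrow>
          ass c a b \<cdot> \<s> (a \<odot> b) c \<cdot> ass a b c =
          (\<s> a c \<otimes> \<one> b) \<cdot> ass a c b \<cdot> (\<one> a \<otimes> \<s> b c)"
    and unit_sym: "a \<in> Obj C \<Longrightarrow> \<l> a \<cdot> \<s> a \<I> = \<r> a"

definition interchange :: "('o, 'm) smcat \<Rightarrow> 'o \<Rightarrow> 'o \<Rightarrow> 'o \<Rightarrow> 'o \<Rightarrow> 'm" where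
  \<comment> \<open>\<open>(a \<odot> b) \<odot> (c \<odot> d) \<rightarrow> (a \<odot> c) \<odot> (b \<odot> d)\<close>\<close>
  "interchange C a b c d =
     ass\<^bsub>C\<^esub> a c (b \<odot>\<^bsub>C\<^esub> d)
     \<cdot>\<^bsub>C\<^esub> (\<one>\<^bsub>C\<^esub> a \<otimes>\<^bsub>C\<^esub> ass_inv\<^bsub>C\<^esub> c b d)
     \<cdot>\<^bsub>C\<^esub> (\<one>\<^bsub>C\<^esub> a \<otimes>\<^bsub>C\<^esub> (\<s>\<^bsub>C\<^esub> b c \<otimes>\<^bsub>C\<^esub> \<one>\<^bsub>C\<^esub> d))
     \<cdot>\<^bsub>C\<^esub> (\<one>\<^bsub>C\<^esub> a \<otimes>\<^bsub>C\<^esub> ass\<^bsub>C\<^esub> b c d)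
     \<cdot>\<^bsub>C\<^esub> ass_inv\<^bsub>C\<^esub> a b (c \<odot>\<^bsub>C\<^esub> d)"


section \<open>The 2-category SMC\<close>

record ('o, 'm, 'p, 'n) smfun =
  FO :: "'o \<Rightarrow> 'p"
  FA :: "'m \<Rightarrow> 'n"
  F0 :: "'n"
  F2 :: "'o \<Rightarrow> 'o \<Rightarrow> 'n"

text \<open>
  All components of functors and transformations are required to be extensional, so that HOL
  equality of these records is equality of functors (resp. transformations).
\<close>

locale symmetric_monoidal_functor =
  A: symmetric_monoidal_category A + B: symmetric_monoidal_category B
  for A :: "('o, 'm) smcat" and B :: "('p, 'n) smcat" (structure) +
  fixes F :: "('o, 'm, 'p, 'n) smfun"
  assumes FO_extensional: "FO F \<in> extensional (Obj A)"
    and FA_extensional: "FA F \<in> extensional (Arr A)"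
    and F2_extensional: "F2 F \<in> extensional (Obj A)"
    and F2_extensional': "a \<in> Obj A \<Longrightarrow> F2 F a \<in> extensional (Obj A)"
    and FO_obj: "a \<in> Obj A \<Longrightarrow> FO F a \<in> Obj B"
    and FA_hom: "f \<in> hom A a b \<Longrightarrow> FA F f \<in> hom B (FO F a) (FO F b)"
    and FA_ide: "a \<in> Obj A \<Longrightarrow> FA F (\<one>\<^bsub>A\<^esub> a) = \<one> (FO F a)"
    and FA_comp: "\<lbrakk>f \<in> hom A a b; g \<in> hom A b c\<rbrakk> \<Longrightarrow> FA F (g \<cdot>\<^bsub>A\<^esub> f) = FA F g \<cdot> FA F f"
    and F0_hom: "F0 F \<in> hom B \<I> (FO F \<I>\<^bsub>A\<^esub>)"
    and F2_hom: "\<lbrakk>a \<in> Obj A; b \<in> Obj A\<rbrakk> \<Longrightarrow>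
          F2 F a b \<in> hom B (FO F a \<odot> FO F b) (FO F (a \<odot>\<^bsub>A\<^esub> b))"
    and F2_natural: "\<lbrakk>f \<in> hom A a a'; g \<in> hom A b b'\<rbrakk> \<Longrightarrow>
          F2 F a' b' \<cdot> (FA F f \<otimes> FA F g) = FA F (f \<otimes>\<^bsub>A\<^esub> g) \<cdot> F2 F a b"
    and F_ass: "\<lbrakk>a \<in> Obj A; b \<in> Obj A; c \<in> Obj A\<rbrakk> \<Longrightarrow>
          FA F (ass\<^bsub>A\<^esub> a b c) \<cdot> F2 F a (b \<odot>\<^bsub>A\<^esub> c) \<cdot> (\<one> (FO F a) \<otimes> F2 F b c) =
          F2 F (a \<odot>\<^bsub>A\<^esub> b) c \<cdot> (F2 F a b \<otimes> \<one> (FO F c)) \<cdot> ass (FO F a) (FO F b) (FO F c)"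
    and F_rho: "a \<in> Obj A \<Longrightarrow>
          FA F (\<r>\<^bsub>A\<^esub> a) \<cdot> F2 F a \<I>\<^bsub>A\<^esub> \<cdot> (\<one> (FO F a) \<otimes> F0 F) = \<r> (FO F a)"
    and F_lam: "a \<in> Obj A \<Longrightarrow>
          FA F (\<l>\<^bsub>A\<^esub> a) \<cdot> F2 F \<I>\<^bsub>A\<^esub> a \<cdot> (F0 F \<otimes> \<one> (FO F a)) = \<l> (FO F a)"
    and F_sym: "\<lbrakk>a \<in> Obj A; b \<in> Obj A\<rbrakk> \<Longrightarrow>
          FA F (\<s>\<^bsub>A\<^esub> a b) \<cdot> F2 F a b = F2 F b a \<cdot> \<s> (FO F a) (FO F b)"

definition SMC :: "('o, 'm) smcat \<Rightarrow> ('p, 'n) smcat \<Rightarrow> ('o, 'm, 'p, 'n) smfun set" where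
  "SMC A B = {F. symmetric_monoidal_functor A B F}"

definition smf_comp ::
  "('o, 'm) smcat \<Rightarrow> ('q, 'k) smcat \<Rightarrow> ('p, 'n, 'q, 'k) smfun \<Rightarrow> ('o, 'm, 'p, 'n) smfun
     \<Rightarrow> ('o, 'm, 'q, 'k) smfun" where
  \<comment> \<open>composite of \<open>F : A \<rightarrow> B\<close> and \<open>G : B \<rightarrow> C\<close>\<close>
  "smf_comp A C G F =
    \<lparr> FO = (\<lambda>a\<in>Obj A. FO G (FO F a)),
      FA = (\<lambda>f\<in>Arr A. FA G (FA F f)),
      F0 = FA G (F0 F) \<cdot>\<^bsub>C\<^esub> F0 G,
      F2 = (\<lambda>a\<in>Obj A. \<lambda>b\<in>Obj A. FA G (F2 F a b) \<cdot>\<^bsub>C\<^esub> F2 G (FO F a) (FO F b)) \<rparr>"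

definition monoidal_transformation ::
  "('o, 'm) smcat \<Rightarrow> ('p, 'n) smcat \<Rightarrow> ('o, 'm, 'p, 'n) smfun \<Rightarrow> ('o, 'm, 'p, 'n) smfun
     \<Rightarrow> ('o \<Rightarrow> 'n) \<Rightarrow> bool" where
  "monoidal_transformation A B F G \<sigma> \<longleftrightarrow>
     F \<in> SMC A B \<and> G \<in> SMC A B \<and> \<sigma> \<in> extensional (Obj A) \<and>
     (\<forall>a\<in>Obj A. \<sigma> a \<in> hom B (FO F a) (FO G a)) \<and>
     (\<forall>a\<in>Obj A. \<forall>b\<in>Obj A. \<forall>f\<in>hom A a b. \<sigma> b \<cdot>\<^bsub>B\<^esub> FA F f = FA G f \<cdot>\<^bsub>B\<^esub> \<sigma> a) \<and>
     \<sigma> \<I>\<^bsub>A\<^esub> \<cdot>\<^bsub>B\<^esub> F0 F = F0 G \<and>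
     (\<forall>a\<in>Obj A. \<forall>b\<in>Obj A. \<sigma> (a \<odot>\<^bsub>A\<^esub> b) \<cdot>\<^bsub>B\<^esub> F2 F a b = F2 G a b \<cdot>\<^bsub>B\<^esub> (\<sigma> a \<otimes>\<^bsub>B\<^esub> \<sigma> b))"


section \<open>Internal hom, evaluation and duality\<close>

text \<open>An arrow of the internal hom is a triple of source, target and family of components.\<close>

type_synonym ('o, 'm, 'p, 'n) smtrans =
  "('o, 'm, 'p, 'n) smfun \<times> ('o, 'm, 'p, 'n) smfun \<times> ('o \<Rightarrow> 'n)"

type_synonym ('o, 'm, 'p, 'n) ihom_cat =
  "(('o, 'm, 'p, 'n) smfun, ('o, 'm, 'p, 'n) smtrans) smcat"

abbreviation component :: "('o, 'm, 'p, 'n) smtrans \<Rightarrow> 'o \<Rightarrow> 'n" where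
  "component \<tau> \<equiv> snd (snd \<tau>)"

definition box ::
  "('o, 'm) smcat \<Rightarrow> ('p, 'n) smcat \<Rightarrow> ('o, 'm, 'p, 'n) smfun \<Rightarrow> ('o, 'm, 'p, 'n) smfun
     \<Rightarrow> ('o, 'm, 'p, 'n) smfun" where
  "box A B F G =
    \<lparr> FO = (\<lambda>a\<in>Obj A. FO F a \<odot>\<^bsub>B\<^esub> FO G a),
      FA = (\<lambda>f\<in>Arr A. FA F f \<otimes>\<^bsub>B\<^esub> FA G f),
      F0 = (F0 F \<otimes>\<^bsub>B\<^esub> F0 G) \<cdot>\<^bsub>B\<^esub> \<r>_inv\<^bsub>B\<^esub> \<I>\<^bsub>B\<^esub>,
      F2 = (\<lambda>a\<in>Obj A. \<lambda>b\<in>Obj A.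
              (F2 F a b \<otimes>\<^bsub>B\<^esub> F2 G a b)
              \<cdot>\<^bsub>B\<^esub> interchange B (FO F a) (FO G a) (FO F b) (FO G b)) \<rparr>"

definition unit_functor :: "('o, 'm) smcat \<Rightarrow> ('p, 'n) smcat \<Rightarrow> ('o, 'm, 'p, 'n) smfun" where
  "unit_functor A B =
    \<lparr> FO = (\<lambda>a\<in>Obj A. \<I>\<^bsub>B\<^esub>),
      FA = (\<lambda>f\<in>Arr A. \<one>\<^bsub>B\<^esub> \<I>\<^bsub>B\<^esub>),
      F0 = \<one>\<^bsub>B\<^esub> \<I>\<^bsub>B\<^esub>,
      F2 = (\<lambda>a\<in>Obj A. \<lambda>b\<in>Obj A. \<r>\<^bsub>B\<^esub> \<I>\<^bsub>B\<^esub>) \<rparr>"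

definition ihom :: "('o, 'm) smcat \<Rightarrow> ('p, 'n) smcat \<Rightarrow> ('o, 'm, 'p, 'n) ihom_cat" where
  "ihom A B =
    \<lparr> Obj = SMC A B,
      Arr = {(F, G, \<sigma>). monoidal_transformation A B F G \<sigma>},
      Src = (\<lambda>\<tau>. fst \<tau>),
      Tgt = (\<lambda>\<tau>. fst (snd \<tau>)),
      Ide = (\<lambda>F. (F, F, \<lambda>a\<in>Obj A. \<one>\<^bsub>B\<^esub> (FO F a))),
      Comp = (\<lambda>\<tau> \<sigma>. (fst \<sigma>, fst (snd \<tau>), \<lambda>a\<in>Obj A. component \<tau> a \<cdot>\<^bsub>B\<^esub> component \<sigma> a)),
      Unit = unit_functor A B,
      TenO = box A B,
      TenA = (\<lambda>\<sigma> \<tau>. (box A B (fst \<sigma>) (fst \<tau>), box A B (fst (snd \<sigma>)) (fst (snd \<tau>)),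
                     \<lambda>a\<in>Obj A. component \<sigma> a \<otimes>\<^bsub>B\<^esub> component \<tau> a)),
      Ass = (\<lambda>F G H. (box A B F (box A B G H), box A B (box A B F G) H,
                     \<lambda>a\<in>Obj A. ass\<^bsub>B\<^esub> (FO F a) (FO G a) (FO H a))),
      AssInv = (\<lambda>F G H. (box A B (box A B F G) H, box A B F (box A B G H),
                     \<lambda>a\<in>Obj A. ass_inv\<^bsub>B\<^esub> (FO F a) (FO G a) (FO H a))),
      Rho = (\<lambda>F. (box A B F (unit_functor A B), F, \<lambda>a\<in>Obj A. \<r>\<^bsub>B\<^esub> (FO F a))),
      RhoInv = (\<lambda>F. (F, box A B F (unit_functor A B), \<lambda>a\<in>Obj A. \<r>_inv\<^bsub>B\<^esub> (FO F a))),
      Lam = (\<lambda>F. (box A B (unit_functor A B) F, F, \<lambda>a\<in>Obj A. \<l>\<^bsub>B\<^esub> (FO F a))),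
      LamInv = (\<lambda>F. (F, box A B (unit_functor A B) F, \<lambda>a\<in>Obj A. \<l>_inv\<^bsub>B\<^esub> (FO F a))),
      Sym = (\<lambda>F G. (box A B F G, box A B G F, \<lambda>a\<in>Obj A. \<s>\<^bsub>B\<^esub> (FO F a) (FO G a))) \<rparr>"

definition ev ::
  "('o, 'm) smcat \<Rightarrow> ('p, 'n) smcat \<Rightarrow> 'o
     \<Rightarrow> (('o, 'm, 'p, 'n) smfun, ('o, 'm, 'p, 'n) smtrans, 'p, 'n) smfun" where
  "ev A B a =
    \<lparr> FO = (\<lambda>F\<in>Obj (ihom A B). FO F a),
      FA = (\<lambda>\<sigma>\<in>Arr (ihom A B). component \<sigma> a),
      F0 = \<one>\<^bsub>B\<^esub> \<I>\<^bsub>B\<^esub>,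
      F2 = (\<lambda>F\<in>Obj (ihom A B). \<lambda>G\<in>Obj (ihom A B). \<one>\<^bsub>B\<^esub> (FO F a \<odot>\<^bsub>B\<^esub> FO G a)) \<rparr>"

definition dual_at ::
  "('a, 'm) smcat \<Rightarrow> ('a, 'm, ('b, 'n, 'c, 'k) smfun, ('b, 'n, 'c, 'k) smtrans) smfun
     \<Rightarrow> 'b \<Rightarrow> ('a, 'm, 'c, 'k) smfun" where
  "dual_at A F b =
    \<lparr> FO = (\<lambda>a\<in>Obj A. FO (FO F a) b),
      FA = (\<lambda>f\<in>Arr A. component (FA F f) b),
      F0 = component (F0 F) b,
      F2 = (\<lambda>a\<in>Obj A. \<lambda>a'\<in>Obj A. component (F2 F a a') b) \<rparr>"

definition dual ::
  "('a, 'm) smcat \<Rightarrow> ('b, 'n) smcat \<Rightarrow> ('c, 'k) smcat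
     \<Rightarrow> ('a, 'm, ('b, 'n, 'c, 'k) smfun, ('b, 'n, 'c, 'k) smtrans) smfun
     \<Rightarrow> ('b, 'n, ('a, 'm, 'c, 'k) smfun, ('a, 'm, 'c, 'k) smtrans) smfun" where
  \<comment> \<open>\<open>F : A \<rightarrow> [B, C]\<close> is sent to \<open>F\<^sup>* : B \<rightarrow> [A, C]\<close>\<close>
  "dual A B C F =
    \<lparr> FO = (\<lambda>b\<in>Obj B. dual_at A F b),
      FA = (\<lambda>g\<in>Arr B. (dual_at A F (Src B g), dual_at A F (Tgt B g),
                        \<lambda>a\<in>Obj A. FA (FO F a) g)),
      F0 = (unit_functor A C, dual_at A F \<I>\<^bsub>B\<^esub>, \<lambda>a\<in>Obj A. F0 (FO F a)),
      F2 = (\<lambda>b\<in>Obj B. \<lambda>b'\<in>Obj B.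
              (box A C (dual_at A F b) (dual_at A F b'), dual_at A F (b \<odot>\<^bsub>B\<^esub> b'),
               \<lambda>a\<in>Obj A. F2 (FO F a) b b')) \<rparr>"


section \<open>Symmetric monoidal categories presented by generators and relations\<close>

datatype 'g word = WUnit | WGen 'g | WTen "'g word" "'g word"

text \<open>\<open>FLeft X p\<close> and \<open>FRight p X\<close> stand for \<open>X \<otimes> p\<close> and \<open>p \<otimes> X\<close>.\<close>

datatype ('g, 'e) fterm =
    FGen 'e
  | FIde "'g word"
  | FComp "('g, 'e) fterm" "('g, 'e) fterm"
  | FLeft "'g word" "('g, 'e) fterm"
  | FRight "('g, 'e) fterm" "'g word"
  | FAss "'g word" "'g word" "'g word"
  | FAssInv "'g word" "'g word" "'g word"
  | FRho "'g word"
  | FRhoInv "'g word"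
  | FLam "'g word"
  | FLamInv "'g word"
  | FSym "'g word" "'g word"

record ('g, 'e) signature =
  GObj :: "'g set"
  GArr :: "'e set"
  GSrc :: "'e \<Rightarrow> 'g word"
  GTgt :: "'e \<Rightarrow> 'g word"

primrec wf_word :: "('g, 'e) signature \<Rightarrow> 'g word \<Rightarrow> bool" where
  "wf_word \<Sigma> WUnit \<longleftrightarrow> True"
| "wf_word \<Sigma> (WGen x) \<longleftrightarrow> x \<in> GObj \<Sigma>"
| "wf_word \<Sigma> (WTen X Y) \<longleftrightarrow> wf_word \<Sigma> X \<and> wf_word \<Sigma> Y"

primrec fsrc :: "('g, 'e) signature \<Rightarrow> ('g, 'e) fterm \<Rightarrow> 'g word" where
  "fsrc \<Sigma> (FGen e) = GSrc \<Sigma> e"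
| "fsrc \<Sigma> (FIde X) = X"
| "fsrc \<Sigma> (FComp u t) = fsrc \<Sigma> t"
| "fsrc \<Sigma> (FLeft X t) = WTen X (fsrc \<Sigma> t)"
| "fsrc \<Sigma> (FRight t X) = WTen (fsrc \<Sigma> t) X"
| "fsrc \<Sigma> (FAss X Y Z) = WTen X (WTen Y Z)"
| "fsrc \<Sigma> (FAssInv X Y Z) = WTen (WTen X Y) Z"
| "fsrc \<Sigma> (FRho X) = WTen X WUnit"
| "fsrc \<Sigma> (FRhoInv X) = X"
| "fsrc \<Sigma> (FLam X) = WTen WUnit X"
| "fsrc \<Sigma> (FLamInv X) = X"
| "fsrc \<Sigma> (FSym X Y) = WTen X Y"

primrec ftgt :: "('g, 'e) signature \<Rightarrow> ('g, 'e) fterm \<Rightarrow> 'g word" where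
  "ftgt \<Sigma> (FGen e) = GTgt \<Sigma> e"
| "ftgt \<Sigma> (FIde X) = X"
| "ftgt \<Sigma> (FComp u t) = ftgt \<Sigma> u"
| "ftgt \<Sigma> (FLeft X t) = WTen X (ftgt \<Sigma> t)"
| "ftgt \<Sigma> (FRight t X) = WTen (ftgt \<Sigma> t) X"
| "ftgt \<Sigma> (FAss X Y Z) = WTen (WTen X Y) Z"
| "ftgt \<Sigma> (FAssInv X Y Z) = WTen X (WTen Y Z)"
| "ftgt \<Sigma> (FRho X) = X"
| "ftgt \<Sigma> (FRhoInv X) = WTen X WUnit"
| "ftgt \<Sigma> (FLam X) = X"
| "ftgt \<Sigma> (FLamInv X) = WTen WUnit X"
| "ftgt \<Sigma> (FSym X Y) = WTen Y X"

primrec wf_term :: "('g, 'e) signature \<Rightarrow> ('g, 'e) fterm \<Rightarrow> bool" where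
  "wf_term \<Sigma> (FGen e) \<longleftrightarrow> e \<in> GArr \<Sigma>"
| "wf_term \<Sigma> (FIde X) \<longleftrightarrow> wf_word \<Sigma> X"
| "wf_term \<Sigma> (FComp u t) \<longleftrightarrow> wf_term \<Sigma> u \<and> wf_term \<Sigma> t \<and> fsrc \<Sigma> u = ftgt \<Sigma> t"
| "wf_term \<Sigma> (FLeft X t) \<longleftrightarrow> wf_word \<Sigma> X \<and> wf_term \<Sigma> t"
| "wf_term \<Sigma> (FRight t X) \<longleftrightarrow> wf_term \<Sigma> t \<and> wf_word \<Sigma> X"
| "wf_term \<Sigma> (FAss X Y Z) \<longleftrightarrow> wf_word \<Sigma> X \<and> wf_word \<Sigma> Y \<and> wf_word \<Sigma> Z"
| "wf_term \<Sigma> (FAssInv X Y Z) \<longleftrightarrow> wf_word \<Sigma> X \<and> wf_word \<Sigma> Y \<and> wf_word \<Sigma> Z"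
| "wf_term \<Sigma> (FRho X) \<longleftrightarrow> wf_word \<Sigma> X"
| "wf_term \<Sigma> (FRhoInv X) \<longleftrightarrow> wf_word \<Sigma> X"
| "wf_term \<Sigma> (FLam X) \<longleftrightarrow> wf_word \<Sigma> X"
| "wf_term \<Sigma> (FLamInv X) \<longleftrightarrow> wf_word \<Sigma> X"
| "wf_term \<Sigma> (FSym X Y) \<longleftrightarrow> wf_word \<Sigma> X \<and> wf_word \<Sigma> Y"

text \<open>
  The unquotiented terms, packaged as a record so that the notation for symmetric monoidal
  categories can be used to write relations between terms. It does not satisfy the axioms of a symmetric monoidal category. The tensor of
  two terms is given by the usual composite of \<open>p \<otimes> Y\<close> after \<open>X \<otimes> q\<close>.
\<close>

definition term_cat :: "('g, 'e) signature \<Rightarrow> ('g word, ('g, 'e) fterm) smcat" where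
  "term_cat \<Sigma> =
    \<lparr> Obj = {X. wf_word \<Sigma> X},
      Arr = {t. wf_term \<Sigma> t},
      Src = fsrc \<Sigma>,
      Tgt = ftgt \<Sigma>,
      Ide = FIde,
      Comp = FComp,
      Unit = WUnit,
      TenO = WTen,
      TenA = (\<lambda>p q. FComp (FRight p (ftgt \<Sigma> q)) (FLeft (fsrc \<Sigma> p) q)),
      Ass = FAss,
      AssInv = FAssInv,
      Rho = FRho,
      RhoInv = FRhoInv,
      Lam = FLam,
      LamInv = FLamInv,
      Sym = FSym \<rparr>"

text \<open>
  The laws of a category with a bifunctor and symmetric monoidal structure. Only those instances
  are used (in the congruence below) for which both sides are well-formed terms.
\<close>

context
  fixes \<Sigma> :: "('g, 'e) signature" and T :: "('g word, ('g, 'e) fterm) smcat" (structure)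
  defines "T \<equiv> term_cat \<Sigma>"
begin

inductive smc_law :: "('g, 'e) fterm \<Rightarrow> ('g, 'e) fterm \<Rightarrow> bool" where
  "smc_law (t \<cdot> \<one> X) t"
| "smc_law (\<one> X \<cdot> t) t"
| "smc_law (v \<cdot> (u \<cdot> t)) (v \<cdot> u \<cdot> t)"
| "smc_law (FLeft X (\<one> Y)) (\<one> (X \<odot> Y))"
| "smc_law (FRight (\<one> X) Y) (\<one> (X \<odot> Y))"
| "smc_law (FLeft X (u \<cdot> t)) (FLeft X u \<cdot> FLeft X t)"
| "smc_law (FRight (u \<cdot> t) X) (FRight u X \<cdot> FRight t X)"
| "smc_law (FRight p (Tgt T q) \<cdot> FLeft (Src T p) q) (FLeft (Tgt T p) q \<cdot> FRight p (Src T q))"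
| "smc_law (ass_inv X Y Z \<cdot> ass X Y Z) (\<one> (X \<odot> (Y \<odot> Z)))"
| "smc_law (ass X Y Z \<cdot> ass_inv X Y Z) (\<one> ((X \<odot> Y) \<odot> Z))"
| "smc_law (ass (Tgt T p) (Tgt T q) (Tgt T t) \<cdot> (p \<otimes> (q \<otimes> t)))
           (((p \<otimes> q) \<otimes> t) \<cdot> ass (Src T p) (Src T q) (Src T t))"
| "smc_law (\<r>_inv X \<cdot> \<r> X) (\<one> (X \<odot> \<I>))"
| "smc_law (\<r> X \<cdot> \<r>_inv X) (\<one> X)"
| "smc_law (\<r> (Tgt T p) \<cdot> FRight p \<I>) (p \<cdot> \<r> (Src T p))"
| "smc_law (\<l>_inv X \<cdot> \<l> X) (\<one> (\<I> \<odot> X))"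
| "smc_law (\<l> X \<cdot> \<l>_inv X) (\<one> X)"
| "smc_law (\<l> (Tgt T p) \<cdot> FLeft \<I> p) (p \<cdot> \<l> (Src T p))"
| "smc_law (\<s> Y X \<cdot> \<s> X Y) (\<one> (X \<odot> Y))"
| "smc_law (\<s> (Tgt T p) (Tgt T q) \<cdot> (p \<otimes> q)) ((q \<otimes> p) \<cdot> \<s> (Src T p) (Src T q))"
| "smc_law (ass (W \<odot> X) Y Z \<cdot> ass W X (Y \<odot> Z))
           (FRight (ass W X Y) Z \<cdot> ass W (X \<odot> Y) Z \<cdot> FLeft W (ass X Y Z))"
| "smc_law (FRight (\<r> X) Y \<cdot> ass X \<I> Y) (FLeft X (\<l> Y))"
| "smc_law (ass Z X Y \<cdot> \<s> (X \<odot> Y) Z \<cdot> ass X Y Z)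
           (FRight (\<s> X Z) Y \<cdot> ass X Z Y \<cdot> FLeft X (\<s> Y Z))"
| "smc_law (\<l> X \<cdot> \<s> X \<I>) (\<r> X)"

end

text \<open>
  The congruence on well-formed terms generated by the symmetric monoidal laws and by the
  (well-formed instances of the) relations \<open>R\<close>.
\<close>

inductive fcong ::
  "('g, 'e) signature \<Rightarrow> (('g, 'e) fterm \<Rightarrow> ('g, 'e) fterm \<Rightarrow> bool)
     \<Rightarrow> ('g, 'e) fterm \<Rightarrow> ('g, 'e) fterm \<Rightarrow> bool"
  for \<Sigma> :: "('g, 'e) signature" and R :: "('g, 'e) fterm \<Rightarrow> ('g, 'e) fterm \<Rightarrow> bool" where
  law: "\<lbrakk>smc_law \<Sigma> t u; wf_term \<Sigma> t; wf_term \<Sigma> u\<rbrakk> \<Longrightarrow> fcong \<Sigma> R t u"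
| rel: "\<lbrakk>R t u; wf_term \<Sigma> t; wf_term \<Sigma> u\<rbrakk> \<Longrightarrow> fcong \<Sigma> R t u"
| refl: "wf_term \<Sigma> t \<Longrightarrow> fcong \<Sigma> R t t"
| sym: "fcong \<Sigma> R t u \<Longrightarrow> fcong \<Sigma> R u t"
| trans: "\<lbrakk>fcong \<Sigma> R t u; fcong \<Sigma> R u v\<rbrakk> \<Longrightarrow> fcong \<Sigma> R t v"
| comp: "\<lbrakk>fcong \<Sigma> R t t'; fcong \<Sigma> R u u'; fsrc \<Sigma> u = ftgt \<Sigma> t\<rbrakk> \<Longrightarrow>
          fcong \<Sigma> R (FComp u t) (FComp u' t')"
| left: "\<lbrakk>fcong \<Sigma> R t t'; wf_word \<Sigma> X\<rbrakk> \<Longrightarrow> fcong \<Sigma> R (FLeft X t) (FLeft X t')"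
| right: "\<lbrakk>fcong \<Sigma> R t t'; wf_word \<Sigma> X\<rbrakk> \<Longrightarrow> fcong \<Sigma> R (FRight t X) (FRight t' X)"

definition fclass ::
  "('g, 'e) signature \<Rightarrow> (('g, 'e) fterm \<Rightarrow> ('g, 'e) fterm \<Rightarrow> bool)
     \<Rightarrow> ('g, 'e) fterm \<Rightarrow> ('g, 'e) fterm set" where
  "fclass \<Sigma> R t = {u. fcong \<Sigma> R t u}"

definition presented ::
  "('g, 'e) signature \<Rightarrow> (('g, 'e) fterm \<Rightarrow> ('g, 'e) fterm \<Rightarrow> bool)
     \<Rightarrow> ('g word, ('g, 'e) fterm set) smcat" where
  "presented \<Sigma> R = (let T = term_cat \<Sigma>; cl = fclass \<Sigma> R in
    \<lparr> Obj = Obj T,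
      Arr = cl ` Arr T,
      Src = (\<lambda>p. the_elem (Src T ` p)),
      Tgt = (\<lambda>p. the_elem (Tgt T ` p)),
      Ide = (\<lambda>X. cl (Ide T X)),
      Comp = (\<lambda>q p. \<Union>u\<in>q. \<Union>t\<in>p. cl (Comp T u t)),
      Unit = Unit T,
      TenO = TenO T,
      TenA = (\<lambda>p q. \<Union>t\<in>p. \<Union>u\<in>q. cl (TenA T t u)),
      Ass = (\<lambda>X Y Z. cl (Ass T X Y Z)),
      AssInv = (\<lambda>X Y Z. cl (AssInv T X Y Z)),
      Rho = (\<lambda>X. cl (Rho T X)),
      RhoInv = (\<lambda>X. cl (RhoInv T X)),
      Lam = (\<lambda>X. cl (Lam T X)),
      LamInv = (\<lambda>X. cl (LamInv T X)),
      Sym = (\<lambda>X Y. cl (Sym T X Y)) \<rparr>)"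

text \<open>
  The strict symmetric monoidal functor from a presented category determined by the images
  \<open>\<phi>\<close>, \<open>\<psi>\<close> of the generators. On an arrow, i.e. a congruence class, it is the common value of
  all representatives (when \<open>\<phi>\<close>, \<open>\<psi>\<close> respect the relations).
\<close>

primrec word_eval :: "('o, 'm) smcat \<Rightarrow> ('g \<Rightarrow> 'o) \<Rightarrow> 'g word \<Rightarrow> 'o" where
  "word_eval C \<phi> WUnit = \<I>\<^bsub>C\<^esub>"
| "word_eval C \<phi> (WGen x) = \<phi> x"
| "word_eval C \<phi> (WTen X Y) = word_eval C \<phi> X \<odot>\<^bsub>C\<^esub> word_eval C \<phi> Y"

primrec term_eval ::
  "('o, 'm) smcat \<Rightarrow> ('g \<Rightarrow> 'o) \<Rightarrow> ('e \<Rightarrow> 'm) \<Rightarrow> ('g, 'e) fterm \<Rightarrow> 'm" where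
  "term_eval C \<phi> \<psi> (FGen e) = \<psi> e"
| "term_eval C \<phi> \<psi> (FIde X) = \<one>\<^bsub>C\<^esub> (word_eval C \<phi> X)"
| "term_eval C \<phi> \<psi> (FComp u t) = term_eval C \<phi> \<psi> u \<cdot>\<^bsub>C\<^esub> term_eval C \<phi> \<psi> t"
| "term_eval C \<phi> \<psi> (FLeft X t) = \<one>\<^bsub>C\<^esub> (word_eval C \<phi> X) \<otimes>\<^bsub>C\<^esub> term_eval C \<phi> \<psi> t"
| "term_eval C \<phi> \<psi> (FRight t X) = term_eval C \<phi> \<psi> t \<otimes>\<^bsub>C\<^esub> \<one>\<^bsub>C\<^esub> (word_eval C \<phi> X)"
| "term_eval C \<phi> \<psi> (FAss X Y Z) =
     ass\<^bsub>C\<^esub> (word_eval C \<phi> X) (word_eval C \<phi> Y) (word_eval C \<phi> Z)"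
| "term_eval C \<phi> \<psi> (FAssInv X Y Z) =
     ass_inv\<^bsub>C\<^esub> (word_eval C \<phi> X) (word_eval C \<phi> Y) (word_eval C \<phi> Z)"
| "term_eval C \<phi> \<psi> (FRho X) = \<r>\<^bsub>C\<^esub> (word_eval C \<phi> X)"
| "term_eval C \<phi> \<psi> (FRhoInv X) = \<r>_inv\<^bsub>C\<^esub> (word_eval C \<phi> X)"
| "term_eval C \<phi> \<psi> (FLam X) = \<l>\<^bsub>C\<^esub> (word_eval C \<phi> X)"
| "term_eval C \<phi> \<psi> (FLamInv X) = \<l>_inv\<^bsub>C\<^esub> (word_eval C \<phi> X)"
| "term_eval C \<phi> \<psi> (FSym X Y) = \<s>\<^bsub>C\<^esub> (word_eval C \<phi> X) (word_eval C \<phi> Y)"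

definition strict_extension ::
  "('g word, ('g, 'e) fterm set) smcat \<Rightarrow> ('o, 'm) smcat \<Rightarrow> ('g \<Rightarrow> 'o) \<Rightarrow> ('e \<Rightarrow> 'm)
     \<Rightarrow> ('g word, ('g, 'e) fterm set, 'o, 'm) smfun" where
  "strict_extension P C \<phi> \<psi> =
    \<lparr> FO = (\<lambda>X\<in>Obj P. word_eval C \<phi> X),
      FA = (\<lambda>p\<in>Arr P. the_elem (term_eval C \<phi> \<psi> ` p)),
      F0 = \<one>\<^bsub>C\<^esub> \<I>\<^bsub>C\<^esub>,
      F2 = (\<lambda>X\<in>Obj P. \<lambda>Y\<in>Obj P. \<one>\<^bsub>C\<^esub> (word_eval C \<phi> X \<odot>\<^bsub>C\<^esub> word_eval C \<phi> Y)) \<rparr>"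


section \<open>The tensor product of symmetric monoidal categories\<close>

text \<open>\<open>LArr f b\<close> and \<open>RArr a g\<close> are the generators \<open>f \<otimes> b\<close> and \<open>a \<otimes> g\<close>.\<close>

datatype ('a, 'm, 'b, 'n) tgen =
    Alpha 'b
  | Beta 'a
  | Gam 'a 'a 'b
  | Del 'a 'b 'b
  | LArr 'm 'b
  | RArr 'a 'n

definition tensor_sig ::
  "('a, 'm) smcat \<Rightarrow> ('b, 'n) smcat \<Rightarrow> ('a \<times> 'b, ('a, 'm, 'b, 'n) tgen) signature" where
  "tensor_sig A B =
    \<lparr> GObj = Obj A \<times> Obj B,
      GArr = {x. case x of
          Alpha b \<Rightarrow> b \<in> Obj B
        | Beta a \<Rightarrow> a \<in> Obj A
        | Gam a a' b \<Rightarrow> a \<in> Obj A \<and> a' \<in> Obj A \<and> b \<in> Obj B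
        | Del a b b' \<Rightarrow> a \<in> Obj A \<and> b \<in> Obj B \<and> b' \<in> Obj B
        | LArr f b \<Rightarrow> f \<in> Arr A \<and> b \<in> Obj B
        | RArr a g \<Rightarrow> a \<in> Obj A \<and> g \<in> Arr B},
      GSrc = (\<lambda>x. case x of
          Alpha b \<Rightarrow> WUnit
        | Beta a \<Rightarrow> WUnit
        | Gam a a' b \<Rightarrow> WTen (WGen (a, b)) (WGen (a', b))
        | Del a b b' \<Rightarrow> WTen (WGen (a, b)) (WGen (a, b'))
        | LArr f b \<Rightarrow> WGen (Src A f, b)
        | RArr a g \<Rightarrow> WGen (a, Src B g)),
      GTgt = (\<lambda>x. case x of
          Alpha b \<Rightarrow> WGen (\<I>\<^bsub>A\<^esub>, b)
        | Beta a \<Rightarrow> WGen (a, \<I>\<^bsub>B\<^esub>)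
        | Gam a a' b \<Rightarrow> WGen (a \<odot>\<^bsub>A\<^esub> a', b)
        | Del a b b' \<Rightarrow> WGen (a, b \<odot>\<^bsub>B\<^esub> b')
        | LArr f b \<Rightarrow> WGen (Tgt A f, b)
        | RArr a g \<Rightarrow> WGen (a, Tgt B g)) \<rparr>"

abbreviation "gAlpha b \<equiv> FGen (Alpha b)"
abbreviation "gBeta a \<equiv> FGen (Beta a)"
abbreviation "gGam a a' b \<equiv> FGen (Gam a a' b)"
abbreviation "gDel a b b' \<equiv> FGen (Del a b b')"
abbreviation "gL f b \<equiv> FGen (LArr f b)"
abbreviation "gR a g \<equiv> FGen (RArr a g)"

text \<open>
  The relations besides the symmetric monoidal laws: \<open>a \<otimes> -\<close> with structure \<open>\<beta>\<^sub>a, \<delta>\<^sub>a\<close> is a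
  symmetric monoidal functor, so is \<open>- \<otimes> b\<close> with structure \<open>\<alpha>\<^sub>b, \<gamma>\<^sub>b\<close>, the families
  \<open>f \<otimes> -\<close> and \<open>- \<otimes> g\<close> are monoidal natural transformations, and the compatibilities between
  \<open>\<alpha>, \<beta>, \<gamma>, \<delta>\<close>. As above, only instances with both sides well-formed are used; this takes care of
  all conditions on objects and arrows. The canonical arrow \<open>\<I> \<odot> \<I> \<rightarrow> \<I>\<close> is \<open>\<r> \<I>\<close>.
\<close>

context
  fixes A :: "('a, 'm) smcat" and B :: "('b, 'n) smcat"
    and T :: "(('a \<times> 'b) word, ('a \<times> 'b, ('a, 'm, 'b, 'n) tgen) fterm) smcat" (structure)
  defines "T \<equiv> term_cat (tensor_sig A B)"
begin

inductive tensor_rel ::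
  "('a \<times> 'b, ('a, 'm, 'b, 'n) tgen) fterm \<Rightarrow> ('a \<times> 'b, ('a, 'm, 'b, 'n) tgen) fterm \<Rightarrow> bool" where
  R_ide: "tensor_rel (gR a (\<one>\<^bsub>B\<^esub> b)) (\<one> (WGen (a, b)))"
| R_comp: "tensor_rel (gR a (g' \<cdot>\<^bsub>B\<^esub> g)) (gR a g' \<cdot> gR a g)"
| del_natural: "tensor_rel
    (gDel a (Tgt B g) (Tgt B g') \<cdot> (gR a g \<otimes> gR a g'))
    (gR a (g \<otimes>\<^bsub>B\<^esub> g') \<cdot> gDel a (Src B g) (Src B g'))"
| del_ass: "tensor_rel
    (gR a (ass\<^bsub>B\<^esub> b b' b'') \<cdot> gDel a b (b' \<odot>\<^bsub>B\<^esub> b'') \<cdot> (\<one> (WGen (a, b)) \<otimes> gDel a b' b''))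
    (gDel a (b \<odot>\<^bsub>B\<^esub> b') b'' \<cdot> (gDel a b b' \<otimes> \<one> (WGen (a, b'')))
       \<cdot> ass (WGen (a, b)) (WGen (a, b')) (WGen (a, b'')))"
| del_rho: "tensor_rel
    (gR a (\<r>\<^bsub>B\<^esub> b) \<cdot> gDel a b \<I>\<^bsub>B\<^esub> \<cdot> (\<one> (WGen (a, b)) \<otimes> gBeta a)) (\<r> (WGen (a, b)))"
| del_lam: "tensor_rel
    (gR a (\<l>\<^bsub>B\<^esub> b) \<cdot> gDel a \<I>\<^bsub>B\<^esub> b \<cdot> (gBeta a \<otimes> \<one> (WGen (a, b)))) (\<l> (WGen (a, b)))"
| del_sym: "tensor_rel
    (gR a (\<s>\<^bsub>B\<^esub> b b') \<cdot> gDel a b b') (gDel a b' b \<cdot> \<s> (WGen (a, b)) (WGen (a, b')))"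
| L_ide: "tensor_rel (gL (\<one>\<^bsub>A\<^esub> a) b) (\<one> (WGen (a, b)))"
| L_comp: "tensor_rel (gL (f' \<cdot>\<^bsub>A\<^esub> f) b) (gL f' b \<cdot> gL f b)"
| gam_natural: "tensor_rel
    (gGam (Tgt A f) (Tgt A f') b \<cdot> (gL f b \<otimes> gL f' b))
    (gL (f \<otimes>\<^bsub>A\<^esub> f') b \<cdot> gGam (Src A f) (Src A f') b)"
| gam_ass: "tensor_rel
    (gL (ass\<^bsub>A\<^esub> a a' a'') b \<cdot> gGam a (a' \<odot>\<^bsub>A\<^esub> a'') b \<cdot> (\<one> (WGen (a, b)) \<otimes> gGam a' a'' b))
    (gGam (a \<odot>\<^bsub>A\<^esub> a') a'' b \<cdot> (gGam a a' b \<otimes> \<one> (WGen (a'', b)))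
       \<cdot> ass (WGen (a, b)) (WGen (a', b)) (WGen (a'', b)))"
| gam_rho: "tensor_rel
    (gL (\<r>\<^bsub>A\<^esub> a) b \<cdot> gGam a \<I>\<^bsub>A\<^esub> b \<cdot> (\<one> (WGen (a, b)) \<otimes> gAlpha b)) (\<r> (WGen (a, b)))"
| gam_lam: "tensor_rel
    (gL (\<l>\<^bsub>A\<^esub> a) b \<cdot> gGam \<I>\<^bsub>A\<^esub> a b \<cdot> (gAlpha b \<otimes> \<one> (WGen (a, b)))) (\<l> (WGen (a, b)))"
| gam_sym: "tensor_rel
    (gL (\<s>\<^bsub>A\<^esub> a a') b \<cdot> gGam a a' b) (gGam a' a b \<cdot> \<s> (WGen (a, b)) (WGen (a', b)))"
| L_R_natural: "tensor_rel
    (gL f (Tgt B g) \<cdot> gR (Src A f) g) (gR (Tgt A f) g \<cdot> gL f (Src B g))"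
| L_beta: "tensor_rel (gL f \<I>\<^bsub>B\<^esub> \<cdot> gBeta (Src A f)) (gBeta (Tgt A f))"
| L_del: "tensor_rel
    (gL f (b \<odot>\<^bsub>B\<^esub> b') \<cdot> gDel (Src A f) b b') (gDel (Tgt A f) b b' \<cdot> (gL f b \<otimes> gL f b'))"
| R_alpha: "tensor_rel (gR \<I>\<^bsub>A\<^esub> g \<cdot> gAlpha (Src B g)) (gAlpha (Tgt B g))"
| R_gam: "tensor_rel
    (gR (a \<odot>\<^bsub>A\<^esub> a') g \<cdot> gGam a a' (Src B g)) (gGam a a' (Tgt B g) \<cdot> (gR a g \<otimes> gR a' g))"
| alpha_del: "tensor_rel
    (gAlpha (b \<odot>\<^bsub>B\<^esub> b') \<cdot> \<r> \<I>) (gDel \<I>\<^bsub>A\<^esub> b b' \<cdot> (gAlpha b \<otimes> gAlpha b'))"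
| beta_gam: "tensor_rel
    (gBeta (a \<odot>\<^bsub>A\<^esub> a') \<cdot> \<r> \<I>) (gGam a a' \<I>\<^bsub>B\<^esub> \<cdot> (gBeta a \<otimes> gBeta a'))"
| beta_alpha: "tensor_rel (gBeta \<I>\<^bsub>A\<^esub>) (gAlpha \<I>\<^bsub>B\<^esub>)"
| gam_del: "tensor_rel
    (gGam a a' (b \<odot>\<^bsub>B\<^esub> b') \<cdot> (gDel a b b' \<otimes> gDel a' b b'))
    (gDel (a \<odot>\<^bsub>A\<^esub> a') b b' \<cdot> (gGam a a' b \<otimes> gGam a a' b')
       \<cdot> interchange T (WGen (a, b)) (WGen (a, b')) (WGen (a', b)) (WGen (a', b')))"

end

type_synonym ('a, 'b) tobj = "('a \<times> 'b) word"
type_synonym ('a, 'm, 'b, 'n) tarr = "('a \<times> 'b, ('a, 'm, 'b, 'n) tgen) fterm set"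

definition tensor ::
  "('a, 'm) smcat \<Rightarrow> ('b, 'n) smcat \<Rightarrow> (('a, 'b) tobj, ('a, 'm, 'b, 'n) tarr) smcat" where
  "tensor A B = presented (tensor_sig A B) (tensor_rel A B)"

definition tensor_gen ::
  "('a, 'm) smcat \<Rightarrow> ('b, 'n) smcat \<Rightarrow> ('a, 'm, 'b, 'n) tgen \<Rightarrow> ('a, 'm, 'b, 'n) tarr" where
  "tensor_gen A B x = fclass (tensor_sig A B) (tensor_rel A B) (FGen x)"

definition eta_at ::
  "('a, 'm) smcat \<Rightarrow> ('b, 'n) smcat \<Rightarrow> 'a
     \<Rightarrow> ('b, 'n, ('a, 'b) tobj, ('a, 'm, 'b, 'n) tarr) smfun" where
  "eta_at A B a =
    \<lparr> FO = (\<lambda>b\<in>Obj B. WGen (a, b)),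
      FA = (\<lambda>g\<in>Arr B. tensor_gen A B (RArr a g)),
      F0 = tensor_gen A B (Beta a),
      F2 = (\<lambda>b\<in>Obj B. \<lambda>b'\<in>Obj B. tensor_gen A B (Del a b b')) \<rparr>"

definition eta ::
  "('a, 'm) smcat \<Rightarrow> ('b, 'n) smcat
     \<Rightarrow> ('a, 'm, ('b, 'n, ('a, 'b) tobj, ('a, 'm, 'b, 'n) tarr) smfun,
         ('b, 'n, ('a, 'b) tobj, ('a, 'm, 'b, 'n) tarr) smtrans) smfun" where
  "eta A B =
    \<lparr> FO = (\<lambda>a\<in>Obj A. eta_at A B a),
      FA = (\<lambda>f\<in>Arr A. (eta_at A B (Src A f), eta_at A B (Tgt A f),
                        \<lambda>b\<in>Obj B. tensor_gen A B (LArr f b))),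
      F0 = (unit_functor B (tensor A B), eta_at A B \<I>\<^bsub>A\<^esub>,
            \<lambda>b\<in>Obj B. tensor_gen A B (Alpha b)),
      F2 = (\<lambda>a\<in>Obj A. \<lambda>a'\<in>Obj A.
             (box B (tensor A B) (eta_at A B a) (eta_at A B a'), eta_at A B (a \<odot>\<^bsub>A\<^esub> a'),
              \<lambda>b\<in>Obj B. tensor_gen A B (Gam a a' b))) \<rparr>"

definition En ::
  "('a, 'm) smcat \<Rightarrow> ('b, 'n) smcat \<Rightarrow> ('c, 'k) smcat
     \<Rightarrow> ('a, 'm, ('b, 'n, 'c, 'k) smfun, ('b, 'n, 'c, 'k) smtrans) smfun
     \<Rightarrow> (('a, 'b) tobj, ('a, 'm, 'b, 'n) tarr, 'c, 'k) smfun" where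
  "En A B C F = strict_extension (tensor A B) C
     (\<lambda>(a, b). FO (FO F a) b)
     (\<lambda>x. case x of
         Alpha b \<Rightarrow> component (F0 F) b
       | Beta a \<Rightarrow> F0 (FO F a)
       | Gam a a' b \<Rightarrow> component (F2 F a a') b
       | Del a b b' \<Rightarrow> F2 (FO F a) b b'
       | LArr f b \<Rightarrow> component (FA F f) b
       | RArr a g \<Rightarrow> FA (FO F a) g)"


section \<open>Canonical arrows\<close>

definition S_fun ::
  "('a, 'm) smcat \<Rightarrow> ('b, 'n) smcat
     \<Rightarrow> (('a, 'b) tobj, ('a, 'm, 'b, 'n) tarr,
         ('b, 'a) tobj, ('b, 'n, 'a, 'm) tarr) smfun" where
  "S_fun A B = En A B (tensor B A) (dual B A (tensor B A) (eta B A))"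

text \<open>
  The free symmetric monoidal category on one object has no generating arrows and no relations;
  the second parameter of the signature is a dummy.
\<close>

definition free_smc :: "(unit word, (unit, unit) fterm set) smcat" where
  "free_smc = presented \<lparr>GObj = UNIV, GArr = {}, GSrc = (\<lambda>_. WUnit), GTgt = (\<lambda>_. WUnit)\<rparr>
     (\<lambda>_ _. False)"

definition star :: "unit word" where
  "star = WGen ()"

type_synonym fobj = "unit word"
type_synonym farr = "(unit, unit) fterm set"

definition R'_fun ::
  "('o, 'm) smcat
     \<Rightarrow> ('o, 'm, ('o, fobj) tobj, ('o, 'm, fobj, farr) tarr) smfun" where
  "R'_fun A = smf_comp A (tensor A free_smc) (ev free_smc (tensor A free_smc) star) (eta A free_smc)"

definition L'_fun ::
  "('o, 'm) smcat
     \<Rightarrow> ('o, 'm, (fobj, 'o) tobj, (fobj, farr, 'o, 'm) tarr) smfun" where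
  "L'_fun A = smf_comp A (tensor free_smc A) (ev free_smc (tensor free_smc A) star)
     (dual free_smc A (tensor free_smc A) (eta free_smc A))"

end

theory Submission
  imports Defs
begin

text \<open>
Write \<open>a \<otimes> b\<close> for the generating objects of a tensor product. The functor \<open>R'\<close> sends \<open>a\<close> to
\<open>a \<otimes> \<star>\<close> and has structure \<open>\<alpha>\<^sub>\<star>, \<gamma>\<^sub>\<star>\<close>; the functor \<open>L'\<close> sends \<open>a\<close> to \<open>\<star> \<otimes> a\<close> and has structure
\<open>\<beta>\<^sub>\<star>, \<delta>\<^sub>\<star>\<close>. The strict functor \<open>S\<close> exchanges the two factors of a generator, hence \<open>\<alpha>\<close> with \<open>\<beta>\<close>,
\<open>\<gamma>\<close> with \<open>\<delta>\<close> and \<open>f \<otimes> b\<close> with \<open>b \<otimes> f\<close>. So \<open>S \<circ> R'\<close> and \<open>L'\<close> agree on all data. What has to be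
proved is that these descriptions are legitimate: that tensor products are symmetric monoidal
categories, that \<open>S\<close> respects their relations, and that the functors and transformations from which
\<open>R'\<close> and \<open>L'\<close> are assembled do belong to the internal homs on which evaluation is defined.

All of this is organised around models. A model of \<open>A \<otimes> B\<close> in \<open>C\<close> is an assignment of objects and
arrows of \<open>C\<close> to the generators which respects the relations. The generators themselves form a model
in \<open>A \<otimes> B\<close> (\<open>tensor_generic_model\<close>), and each model induces a strict symmetric monoidal functor on
\<open>A \<otimes> B\<close> (\<open>strict_extension_SMC\<close>). The relations are symmetric in \<open>A\<close> and \<open>B\<close>: exchanging
the two factors turns a model of \<open>A \<otimes> B\<close> into a model of \<open>B \<otimes> A\<close> (\<open>swapped_model\<close>). In these terms
\<open>\<eta>\<close> is the curried form of the generic model, dualising is swapping (\<open>dual_curried\<close>), evaluating a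
curried model at \<open>b\<close> yields the partial functor in the other variable (\<open>ev_curried\<close>), and
composition with a strict extension carries generic partial functors to those of the model
(\<open>ext_partial_functor\<close>). The theorem follows by substitution.

Two places require coherence in an arbitrary symmetric monoidal category. The components of \<open>\<eta>\<close>
involve pointwise tensor products of functors, so these must be symmetric monoidal again
(\<open>box_SMC\<close>), which is a compatibility of the interchange isomorphism with associators, units and
symmetries. And the relation between \<open>\<gamma>\<close> and \<open>\<delta>\<close> is symmetric in the two factors only because the
interchange is its own inverse. Both follow from \<open>coherence\<close>: letting words act on objects by
nested left multiplication makes associators and unitors act as identities, so that a structural
arrow is determined by the sequence of elementary crossings by which it acts.
\<close>

section \<open>Calculus in a symmetric monoidal category\<close>

context symmetric_monoidal_category
begin

lemma homI: "\<lbrakk>f \<in> Arr C; Src C f = a; Tgt C f = b\<rbrakk> \<Longrightarrow> f \<in> hom C a b"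
  and homD: "f \<in> hom C a b \<Longrightarrow> f \<in> Arr C" "f \<in> hom C a b \<Longrightarrow> Src C f = a"
    "f \<in> hom C a b \<Longrightarrow> Tgt C f = b"
  by (auto simp: hom_def)

lemma arr_hom: "f \<in> Arr C \<Longrightarrow> f \<in> hom C (Src C f) (Tgt C f)"
  by (rule homI) auto

lemma hom_obj: "f \<in> hom C a b \<Longrightarrow> a \<in> Obj C" "f \<in> hom C a b \<Longrightarrow> b \<in> Obj C"
  using src_obj tgt_obj by (auto simp: hom_def)

lemma comp_arr: "\<lbrakk>f \<in> Arr C; g \<in> Arr C; Src C g = Tgt C f\<rbrakk> \<Longrightarrow> g \<cdot> f \<in> hom C (Src C f) (Tgt C g)"
  using comp_hom arr_hom by metis

lemmas obj_simps [simp] = src_obj tgt_obj unit_obj ten_obj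

lemma arr_simps [simp]:
  "a \<in> Obj C \<Longrightarrow> \<one> a \<in> Arr C"
  "\<lbrakk>f \<in> Arr C; g \<in> Arr C; Src C g = Tgt C f\<rbrakk> \<Longrightarrow> g \<cdot> f \<in> Arr C"
  "\<lbrakk>f \<in> Arr C; g \<in> Arr C\<rbrakk> \<Longrightarrow> f \<otimes> g \<in> Arr C"
  "\<lbrakk>a \<in> Obj C; b \<in> Obj C; c \<in> Obj C\<rbrakk> \<Longrightarrow> ass a b c \<in> Arr C"
  "\<lbrakk>a \<in> Obj C; b \<in> Obj C; c \<in> Obj C\<rbrakk> \<Longrightarrow> ass_inv a b c \<in> Arr C"
  "a \<in> Obj C \<Longrightarrow> \<r> a \<in> Arr C"
  "a \<in> Obj C \<Longrightarrow> \<r>_inv a \<in> Arr C"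
  "a \<in> Obj C \<Longrightarrow> \<l> a \<in> Arr C"
  "a \<in> Obj C \<Longrightarrow> \<l>_inv a \<in> Arr C"
  "\<lbrakk>a \<in> Obj C; b \<in> Obj C\<rbrakk> \<Longrightarrow> \<s> a b \<in> Arr C"
  using ide_hom comp_arr ten_hom[OF arr_hom arr_hom] ass_hom ass_inv_hom
    rho_hom rho_inv_hom lam_hom lam_inv_hom sym_hom
  by (simp_all add: hom_def)

lemma src_simps [simp]:
  "a \<in> Obj C \<Longrightarrow> Src C (\<one> a) = a"
  "\<lbrakk>f \<in> Arr C; g \<in> Arr C; Src C g = Tgt C f\<rbrakk> \<Longrightarrow> Src C (g \<cdot> f) = Src C f"
  "\<lbrakk>f \<in> Arr C; g \<in> Arr C\<rbrakk> \<Longrightarrow> Src C (f \<otimes> g) = Src C f \<odot> Src C g"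
  "\<lbrakk>a \<in> Obj C; b \<in> Obj C; c \<in> Obj C\<rbrakk> \<Longrightarrow> Src C (ass a b c) = a \<odot> (b \<odot> c)"
  "\<lbrakk>a \<in> Obj C; b \<in> Obj C; c \<in> Obj C\<rbrakk> \<Longrightarrow> Src C (ass_inv a b c) = (a \<odot> b) \<odot> c"
  "a \<in> Obj C \<Longrightarrow> Src C (\<r> a) = a \<odot> \<I>"
  "a \<in> Obj C \<Longrightarrow> Src C (\<r>_inv a) = a"
  "a \<in> Obj C \<Longrightarrow> Src C (\<l> a) = \<I> \<odot> a"
  "a \<in> Obj C \<Longrightarrow> Src C (\<l>_inv a) = a"
  "\<lbrakk>a \<in> Obj C; b \<in> Obj C\<rbrakk> \<Longrightarrow> Src C (\<s> a b) = a \<odot> b"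
  using ide_hom comp_arr ten_hom[OF arr_hom arr_hom] ass_hom ass_inv_hom
    rho_hom rho_inv_hom lam_hom lam_inv_hom sym_hom
  by (simp_all add: hom_def)

lemma tgt_simps [simp]:
  "a \<in> Obj C \<Longrightarrow> Tgt C (\<one> a) = a"
  "\<lbrakk>f \<in> Arr C; g \<in> Arr C; Src C g = Tgt C f\<rbrakk> \<Longrightarrow> Tgt C (g \<cdot> f) = Tgt C g"
  "\<lbrakk>f \<in> Arr C; g \<in> Arr C\<rbrakk> \<Longrightarrow> Tgt C (f \<otimes> g) = Tgt C f \<odot> Tgt C g"
  "\<lbrakk>a \<in> Obj C; b \<in> Obj C; c \<in> Obj C\<rbrakk> \<Longrightarrow> Tgt C (ass a b c) = (a \<odot> b) \<odot> c"
  "\<lbrakk>a \<in> Obj C; b \<in> Obj C; c \<in> Obj C\<rbrakk> \<Longrightarrow> Tgt C (ass_inv a b c) = a \<odot> (b \<odot> c)"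
  "a \<in> Obj C \<Longrightarrow> Tgt C (\<r> a) = a"
  "a \<in> Obj C \<Longrightarrow> Tgt C (\<r>_inv a) = a \<odot> \<I>"
  "a \<in> Obj C \<Longrightarrow> Tgt C (\<l> a) = a"
  "a \<in> Obj C \<Longrightarrow> Tgt C (\<l>_inv a) = \<I> \<odot> a"
  "\<lbrakk>a \<in> Obj C; b \<in> Obj C\<rbrakk> \<Longrightarrow> Tgt C (\<s> a b) = b \<odot> a"
  using ide_hom comp_arr ten_hom[OF arr_hom arr_hom] ass_hom ass_inv_hom
    rho_hom rho_inv_hom lam_hom lam_inv_hom sym_hom
  by (simp_all add: hom_def)

lemma comp_ide [simp]:
  "\<lbrakk>f \<in> Arr C; Src C f = a\<rbrakk> \<Longrightarrow> f \<cdot> \<one> a = f"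
  "\<lbrakk>f \<in> Arr C; Tgt C f = b\<rbrakk> \<Longrightarrow> \<one> b \<cdot> f = f"
  using comp_ide_right comp_ide_left arr_hom by blast+

lemma assoc: "\<lbrakk>f \<in> Arr C; g \<in> Arr C; h \<in> Arr C; Src C g = Tgt C f; Src C h = Tgt C g\<rbrakk> \<Longrightarrow>
    h \<cdot> g \<cdot> f = h \<cdot> (g \<cdot> f)"
  by (metis comp_assoc arr_hom)

lemma ten_ide' [simp]: "\<lbrakk>a \<in> Obj C; b \<in> Obj C\<rbrakk> \<Longrightarrow> \<one> a \<otimes> \<one> b = \<one> (a \<odot> b)"
  by (rule ten_ide)

lemma ten_comp':
  "\<lbrakk>f \<in> Arr C; f' \<in> Arr C; g \<in> Arr C; g' \<in> Arr C; Src C f' = Tgt C f; Src C g' = Tgt C g\<rbrakk> \<Longrightarrow>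
    (f' \<otimes> g') \<cdot> (f \<otimes> g) = (f' \<cdot> f) \<otimes> (g' \<cdot> g)"
  by (metis ten_comp arr_hom)

lemma ten_left_comp: "\<lbrakk>a \<in> Obj C; g \<in> Arr C; g' \<in> Arr C; Src C g' = Tgt C g\<rbrakk> \<Longrightarrow>
    \<one> a \<otimes> (g' \<cdot> g) = (\<one> a \<otimes> g') \<cdot> (\<one> a \<otimes> g)"
  by (simp add: ten_comp')

lemma ten_right_comp: "\<lbrakk>a \<in> Obj C; g \<in> Arr C; g' \<in> Arr C; Src C g' = Tgt C g\<rbrakk> \<Longrightarrow>
    (g' \<cdot> g) \<otimes> \<one> a = (g' \<otimes> \<one> a) \<cdot> (g \<otimes> \<one> a)"
  by (simp add: ten_comp')

lemma inv_left_cancel: "\<lbrakk>h' \<cdot> h = \<one> (Tgt C f); f \<in> Arr C; h \<in> Arr C; h' \<in> Arr C;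
    Src C h = Tgt C f; Src C h' = Tgt C h\<rbrakk> \<Longrightarrow> h' \<cdot> (h \<cdot> f) = f"
  using assoc[of f h h'] by simp

lemma inv_cancel:
  "\<lbrakk>f \<in> Arr C; Tgt C f = a \<odot> (b \<odot> c); a \<in> Obj C; b \<in> Obj C; c \<in> Obj C\<rbrakk> \<Longrightarrow>
     ass_inv a b c \<cdot> (ass a b c \<cdot> f) = f"
  "\<lbrakk>f \<in> Arr C; Tgt C f = (a \<odot> b) \<odot> c; a \<in> Obj C; b \<in> Obj C; c \<in> Obj C\<rbrakk> \<Longrightarrow>
     ass a b c \<cdot> (ass_inv a b c \<cdot> f) = f"
  "\<lbrakk>f \<in> Arr C; Tgt C f = a \<odot> \<I>; a \<in> Obj C\<rbrakk> \<Longrightarrow> \<r>_inv a \<cdot> (\<r> a \<cdot> f) = f"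
  "\<lbrakk>f \<in> Arr C; Tgt C f = a; a \<in> Obj C\<rbrakk> \<Longrightarrow> \<r> a \<cdot> (\<r>_inv a \<cdot> f) = f"
  "\<lbrakk>f \<in> Arr C; Tgt C f = \<I> \<odot> a; a \<in> Obj C\<rbrakk> \<Longrightarrow> \<l>_inv a \<cdot> (\<l> a \<cdot> f) = f"
  "\<lbrakk>f \<in> Arr C; Tgt C f = a; a \<in> Obj C\<rbrakk> \<Longrightarrow> \<l> a \<cdot> (\<l>_inv a \<cdot> f) = f"
  "\<lbrakk>f \<in> Arr C; Tgt C f = a \<odot> b; a \<in> Obj C; b \<in> Obj C\<rbrakk> \<Longrightarrow> \<s> b a \<cdot> (\<s> a b \<cdot> f) = f"
  by (simp_all add: inv_left_cancel ass_inv_left ass_inv_right rho_inv_left rho_inv_right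
      lam_inv_left lam_inv_right sym_sym)

lemmas inv_simps = inv_cancel ass_inv_left ass_inv_right rho_inv_left rho_inv_right
  lam_inv_left lam_inv_right sym_sym

lemma cancel_left: "\<lbrakk>h \<cdot> f = h \<cdot> g; h' \<cdot> h = \<one> (Tgt C f); f \<in> Arr C; g \<in> Arr C; h \<in> Arr C; h' \<in> Arr C;
    Tgt C g = Tgt C f; Src C h = Tgt C f; Src C h' = Tgt C h\<rbrakk> \<Longrightarrow> f = g"
  using inv_left_cancel[of h' h f] inv_left_cancel[of h' h g] by argo

lemma cancel_right:
  assumes "f \<cdot> h = g \<cdot> h" "h \<cdot> h' = \<one> (Src C f)" "f \<in> Arr C" "g \<in> Arr C" "h \<in> Arr C" "h' \<in> Arr C"
    "Src C g = Src C f" "Tgt C h = Src C f" "Src C h = Tgt C h'"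
  shows "f = g"
proof -
  have "f = f \<cdot> h \<cdot> h'" using assoc[of h' h f] assms(2-) by simp
  also have "\<dots> = g" unfolding assms(1) using assoc[of h' h g] assms(2-) by simp
  finally show ?thesis .
qed

text \<open>
By naturality, conjugating \<open>\<one> \<I> \<otimes> f\<close> with the unitors gives back \<open>f\<close>.
\<close>

lemma unit_left_faithful:
  assumes "\<one> \<I> \<otimes> f = \<one> \<I> \<otimes> g" "f \<in> Arr C" "g \<in> Arr C" "Src C f = Src C g" "Tgt C f = Tgt C g"
  shows "f = g"
proof (rule cancel_right)
  show "f \<cdot> \<l> (Src C f) = g \<cdot> \<l> (Src C f)"
    using lam_natural[OF arr_hom[OF assms(2)]] lam_natural[OF arr_hom[OF assms(3)]] assms by simp
  show "\<l> (Src C f) \<cdot> \<l>_inv (Src C f) = \<one> (Src C f)" using assms by (intro lam_inv_right) simp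
qed (use assms in simp_all)

lemma unit_right_faithful:
  assumes "f \<otimes> \<one> \<I> = g \<otimes> \<one> \<I>" "f \<in> Arr C" "g \<in> Arr C" "Src C f = Src C g" "Tgt C f = Tgt C g"
  shows "f = g"
proof (rule cancel_right)
  show "f \<cdot> \<r> (Src C f) = g \<cdot> \<r> (Src C f)"
    using rho_natural[OF arr_hom[OF assms(2)]] rho_natural[OF arr_hom[OF assms(3)]] assms by simp
  show "\<r> (Src C f) \<cdot> \<r>_inv (Src C f) = \<one> (Src C f)" using assms by (intro rho_inv_right) simp
qed (use assms in simp_all)

lemma ass_natural': "\<lbrakk>f \<in> Arr C; g \<in> Arr C; h \<in> Arr C\<rbrakk> \<Longrightarrow>
    ass (Tgt C f) (Tgt C g) (Tgt C h) \<cdot> (f \<otimes> (g \<otimes> h))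
    = ((f \<otimes> g) \<otimes> h) \<cdot> ass (Src C f) (Src C g) (Src C h)"
  by (rule ass_natural; erule arr_hom)

lemma ass_inv_natural: 
  assumes "f \<in> hom C a a'" "g \<in> hom C b b'" "h \<in> hom C c c'"
  shows "ass_inv a' b' c' \<cdot> ((f \<otimes> g) \<otimes> h) = (f \<otimes> (g \<otimes> h)) \<cdot> ass_inv a b c"
proof -
  note o [simp] = assms[THEN hom_obj(1)] assms[THEN hom_obj(2)]
    assms[THEN homD(1)] assms[THEN homD(2)] assms[THEN homD(3)]
  have "ass_inv a' b' c' \<cdot> ((f \<otimes> g) \<otimes> h)
      = ass_inv a' b' c' \<cdot> (((f \<otimes> g) \<otimes> h) \<cdot> ass a b c \<cdot> ass_inv a b c)"
    by (simp add: assoc ass_inv_right)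
  also have "\<dots> = ass_inv a' b' c' \<cdot> (ass a' b' c' \<cdot> (f \<otimes> (g \<otimes> h)) \<cdot> ass_inv a b c)"
    by (simp add: ass_natural[OF assms])
  also have "\<dots> = ass_inv a' b' c' \<cdot> ass a' b' c' \<cdot> ((f \<otimes> (g \<otimes> h)) \<cdot> ass_inv a b c)"
    by (simp add: assoc)
  also have "\<dots> = (f \<otimes> (g \<otimes> h)) \<cdot> ass_inv a b c"
    by (simp add: ass_inv_left)
  finally show ?thesis .
qed

text \<open>
Kelly's observation that this triangle with the unit in first position is a consequence of the
pentagon and of the triangle with the unit in the middle. After tensoring with \<open>\<I>\<close> on the left, which is
faithful, both sides appear in the pentagon for \<open>\<I>, \<I>, a, b\<close>.
\<close>

lemma lam_tensor:
  assumes [simp]: "a \<in> Obj C" "b \<in> Obj C"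
  shows "(\<l> a \<otimes> \<one> b) \<cdot> ass \<I> a b = \<l> (a \<odot> b)"
proof (rule unit_left_faithful)
  show "\<one> \<I> \<otimes> ((\<l> a \<otimes> \<one> b) \<cdot> ass \<I> a b) = \<one> \<I> \<otimes> \<l> (a \<odot> b)"
  proof (rule cancel_left[where h' = "ass_inv \<I> a b"])
    \<comment> \<open>the triangle turns \<open>\<one> \<I> \<otimes> \<l> a\<close> into \<open>?r\<close> and an associator, which completes a side of the pentagon\<close>
    let ?r = "(\<r> \<I> \<otimes> \<one> a) \<otimes> \<one> b"
    have "ass \<I> a b \<cdot> (\<one> \<I> \<otimes> ((\<l> a \<otimes> \<one> b) \<cdot> ass \<I> a b))
        = (ass \<I> a b \<cdot> (\<one> \<I> \<otimes> (\<l> a \<otimes> \<one> b))) \<cdot> (\<one> \<I> \<otimes> ass \<I> a b)"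
      by (simp add: ten_left_comp assoc)
    also have "\<dots> = (((\<one> \<I> \<otimes> \<l> a) \<otimes> \<one> b) \<cdot> ass \<I> (\<I> \<odot> a) b) \<cdot> (\<one> \<I> \<otimes> ass \<I> a b)"
      using ass_natural'[of "\<one> \<I>" "\<l> a" "\<one> b"] by simp
    also have "\<dots> = ?r \<cdot> ((ass \<I> \<I> a \<otimes> \<one> b) \<cdot> ass \<I> (\<I> \<odot> a) b \<cdot> (\<one> \<I> \<otimes> ass \<I> a b))"
      by (simp add: triangle[symmetric] ten_right_comp assoc)
    also have "\<dots> = (?r \<cdot> ass (\<I> \<odot> \<I>) a b) \<cdot> ass \<I> \<I> (a \<odot> b)"
      by (subst pentagon[symmetric]) (simp_all add: assoc)
    also have "\<dots> = (ass \<I> a b \<cdot> (\<r> \<I> \<otimes> \<one> (a \<odot> b))) \<cdot> ass \<I> \<I> (a \<odot> b)"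
      using ass_natural'[of "\<r> \<I>" "\<one> a" "\<one> b"] by simp
    also have "\<dots> = ass \<I> a b \<cdot> (\<one> \<I> \<otimes> \<l> (a \<odot> b))"
      by (simp add: triangle[symmetric] assoc)
    finally show "ass \<I> a b \<cdot> (\<one> \<I> \<otimes> ((\<l> a \<otimes> \<one> b) \<cdot> ass \<I> a b))
        = ass \<I> a b \<cdot> (\<one> \<I> \<otimes> \<l> (a \<odot> b))" .
  qed (simp_all add: ass_inv_left)
qed simp_all

text \<open>
The second hexagon, obtained from the first by inverting all symmetries.
\<close>

lemma sym_ten_right:
  assumes [simp]: "a \<in> Obj C" "b \<in> Obj C" "c \<in> Obj C"
  shows "\<s> c (a \<odot> b)
    = ass a b c \<cdot> ((\<one> a \<otimes> \<s> c b) \<cdot> (ass_inv a c b \<cdot> ((\<s> c a \<otimes> \<one> b) \<cdot> ass c a b)))" (is "_ = ?v")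
proof (rule cancel_right)
  let ?u = "(\<s> a c \<otimes> \<one> b) \<cdot> ass a c b \<cdot> (\<one> a \<otimes> \<s> b c)"
  let ?w = "ass c a b \<cdot> \<s> (a \<odot> b) c \<cdot> ass a b c"
  have s': "(\<one> a \<otimes> \<s> c b) \<cdot> (\<one> a \<otimes> \<s> b c) = \<one> (a \<odot> (b \<odot> c))"
    by (simp add: ten_comp' sym_sym)
  have s: "(\<s> c a \<otimes> \<one> b) \<cdot> ((\<s> a c \<otimes> \<one> b) \<cdot> f) = f"
    if "f \<in> Arr C" "Tgt C f = (a \<odot> c) \<odot> b" for f
    using that by (simp add: assoc[symmetric] ten_comp' sym_sym)
  have i: "ass_inv c a b \<cdot> ?w = \<s> (a \<odot> b) c \<cdot> ass a b c"
    by (simp add: assoc inv_simps)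
  have "?v \<cdot> (\<s> (a \<odot> b) c \<cdot> ass a b c)
     = ass a b c \<cdot> ((\<one> a \<otimes> \<s> c b) \<cdot> (ass_inv a c b \<cdot> ((\<s> c a \<otimes> \<one> b) \<cdot> ?w)))"
    by (simp add: assoc)
  also have "\<dots> = ass a b c"
    by (subst hexagon) (simp_all add: assoc s s' inv_simps)
  also have "\<dots> = \<s> c (a \<odot> b) \<cdot> (\<s> (a \<odot> b) c \<cdot> ass a b c)"
    by (simp add: inv_simps)
  finally show "\<s> c (a \<odot> b) \<cdot> (\<s> (a \<odot> b) c \<cdot> ass a b c) = ?v \<cdot> (\<s> (a \<odot> b) c \<cdot> ass a b c)" by simp
  show "(\<s> (a \<odot> b) c \<cdot> ass a b c) \<cdot> (ass_inv a b c \<cdot> \<s> c (a \<odot> b)) = \<one> (Src C (\<s> c (a \<odot> b)))"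
    by (simp add: assoc inv_simps sym_sym)
qed simp_all

lemma sym_ten_left:
  assumes [simp]: "a \<in> Obj C" "b \<in> Obj C" "c \<in> Obj C"
  shows "\<s> (a \<odot> b) c
    = ass_inv c a b \<cdot> ((\<s> a c \<otimes> \<one> b) \<cdot> (ass a c b \<cdot> ((\<one> a \<otimes> \<s> b c) \<cdot> ass_inv a b c)))"
proof -
  have "\<s> (a \<odot> b) c = ass_inv c a b \<cdot> ((ass c a b \<cdot> \<s> (a \<odot> b) c \<cdot> ass a b c) \<cdot> ass_inv a b c)"
    by (simp add: assoc inv_simps)
  also have "\<dots> = ass_inv c a b \<cdot> ((\<s> a c \<otimes> \<one> b) \<cdot> (ass a c b \<cdot> ((\<one> a \<otimes> \<s> b c) \<cdot> ass_inv a b c)))"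
    by (subst hexagon) (simp_all add: assoc)
  finally show ?thesis .
qed

lemma sym_unit_right: 
  assumes [simp]: "a \<in> Obj C" shows "\<s> a \<I> = \<l>_inv a \<cdot> \<r> a"
  by (simp add: unit_sym[symmetric] inv_simps)

lemma sym_unit_left: 
  assumes [simp]: "a \<in> Obj C" shows "\<s> \<I> a = \<r>_inv a \<cdot> \<l> a"
proof -
  have "\<r>_inv a \<cdot> \<l> a = \<r>_inv a \<cdot> (\<l> a \<cdot> (\<s> a \<I> \<cdot> \<s> \<I> a))"
    by (simp add: sym_sym)
  also have "\<dots> = \<r>_inv a \<cdot> (\<r> a \<cdot> \<s> \<I> a)"
    by (simp add: assoc[symmetric] unit_sym[symmetric])
  also have "\<dots> = \<s> \<I> a"
    by (simp add: inv_simps)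
  finally show ?thesis by simp
qed

end

section \<open>Evaluation of formal terms\<close>

text \<open>
Images of the generators, before any relations: just enough to make the evaluation of terms typed.
\<close>

locale generator_assignment = symmetric_monoidal_category C
  for C :: "('o, 'm) smcat" (structure)
    and \<Sigma> :: "('g, 'e) signature" and \<phi> :: "'g \<Rightarrow> 'o" and \<psi> :: "'e \<Rightarrow> 'm" +
  assumes gen_obj: "x \<in> GObj \<Sigma> \<Longrightarrow> \<phi> x \<in> Obj C"
    and gen_hom: "e \<in> GArr \<Sigma> \<Longrightarrow>
      \<psi> e \<in> hom C (word_eval C \<phi> (GSrc \<Sigma> e)) (word_eval C \<phi> (GTgt \<Sigma> e))"
begin

lemma word_eval_obj [simp]: "wf_word \<Sigma> X \<Longrightarrow> word_eval C \<phi> X \<in> Obj C"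
  by (induction X) (auto simp: gen_obj)

lemma term_eval_typed: "wf_term \<Sigma> t \<Longrightarrow>
   term_eval C \<phi> \<psi> t \<in> Arr C \<and> Src C (term_eval C \<phi> \<psi> t) = word_eval C \<phi> (fsrc \<Sigma> t)
   \<and> Tgt C (term_eval C \<phi> \<psi> t) = word_eval C \<phi> (ftgt \<Sigma> t)"
  by (induction t) (use gen_hom in \<open>auto simp: hom_def\<close>)

lemmas term_eval_simps [simp] =
  term_eval_typed[THEN conjunct1]
  term_eval_typed[THEN conjunct2, THEN conjunct1]
  term_eval_typed[THEN conjunct2, THEN conjunct2]

end

section \<open>Coherence\<close>

text \<open>
The words over this signature are the formal tensor products of objects of \<open>C\<close>. As there are no
generating arrows, its terms are the structural ones, composed of associators, unitors and symmetries.
\<close>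

definition object_signature :: "('o, 'm) smcat \<Rightarrow> ('o, unit) signature" where
  "object_signature C = \<lparr>GObj = Obj C, GArr = {}, GSrc = (\<lambda>_. WUnit), GTgt = (\<lambda>_. WUnit)\<rparr>"

context symmetric_monoidal_category
begin

text \<open>
A word acts on objects and arrows by multiplication from the left, one letter at a time. The action
does not see brackets and units: bracketings of the same word act in the same way. The arrow
\<open>flat X a\<close> is the canonical isomorphism from \<open>X \<odot> a\<close>, with \<open>X\<close> evaluated in \<open>C\<close>, to the result of the
action.
\<close>

primrec act_obj :: "'o word \<Rightarrow> 'o \<Rightarrow> 'o" where
  "act_obj WUnit a = a"
| "act_obj (WGen x) a = x \<odot> a"
| "act_obj (WTen X Y) a = act_obj X (act_obj Y a)"

primrec act_arr :: "'o word \<Rightarrow> 'm \<Rightarrow> 'm" where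
  "act_arr WUnit f = f"
| "act_arr (WGen x) f = \<one> x \<otimes> f"
| "act_arr (WTen X Y) f = act_arr X (act_arr Y f)"

abbreviation wobj :: "'o word \<Rightarrow> 'o" where "wobj X \<equiv> word_eval C (\<lambda>x. x) X"

abbreviation wf_obj :: "'o word \<Rightarrow> bool" where "wf_obj X \<equiv> wf_word (object_signature C) X"

primrec flat :: "'o word \<Rightarrow> 'o \<Rightarrow> 'm" where
  "flat WUnit a = \<l> a"
| "flat (WGen x) a = \<one> (x \<odot> a)"
| "flat (WTen X Y) a = act_arr X (flat Y a) \<cdot> (flat X (wobj Y \<odot> a) \<cdot> ass_inv (wobj X) (wobj Y) a)"

sublocale words: generator_assignment C "object_signature C" "\<lambda>x. x" "\<lambda>_. undefined"
  by unfold_locales (auto simp: object_signature_def)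

lemma object_signature_simps [simp]:
  "GObj (object_signature C) = Obj C" "GArr (object_signature C) = {}"
  by (simp_all add: object_signature_def)

lemma act_obj_obj [simp]: "\<lbrakk>wf_obj X; a \<in> Obj C\<rbrakk> \<Longrightarrow> act_obj X a \<in> Obj C"
  by (induction X arbitrary: a) (auto simp: object_signature_def)

lemma act_arr_simps [simp]:
  assumes "wf_obj X"
  shows "f \<in> Arr C \<Longrightarrow> act_arr X f \<in> Arr C"
    "f \<in> Arr C \<Longrightarrow> Src C (act_arr X f) = act_obj X (Src C f)"
    "f \<in> Arr C \<Longrightarrow> Tgt C (act_arr X f) = act_obj X (Tgt C f)"
    "a \<in> Obj C \<Longrightarrow> act_arr X (\<one> a) = \<one> (act_obj X a)"
proof -
  have "f \<in> Arr C \<Longrightarrow> act_arr X f \<in> Arr C \<and> Src C (act_arr X f) = act_obj X (Src C f)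
      \<and> Tgt C (act_arr X f) = act_obj X (Tgt C f)"
    using assms by (induction X arbitrary: f) (auto simp: object_signature_def)
  then show "f \<in> Arr C \<Longrightarrow> act_arr X f \<in> Arr C"
    "f \<in> Arr C \<Longrightarrow> Src C (act_arr X f) = act_obj X (Src C f)"
    "f \<in> Arr C \<Longrightarrow> Tgt C (act_arr X f) = act_obj X (Tgt C f)"
    by auto
  show "a \<in> Obj C \<Longrightarrow> act_arr X (\<one> a) = \<one> (act_obj X a)"
    using assms by (induction X arbitrary: a) (auto simp: object_signature_def)
qed

lemma act_arr_comp: "\<lbrakk>wf_obj X; f \<in> Arr C; g \<in> Arr C; Src C g = Tgt C f\<rbrakk> \<Longrightarrow>
    act_arr X (g \<cdot> f) = act_arr X g \<cdot> act_arr X f"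
  by (induction X arbitrary: f g) (auto simp: object_signature_def ten_left_comp)

lemma flat_simps [simp]:
  assumes "wf_obj X" "a \<in> Obj C"
  shows "flat X a \<in> Arr C" "Src C (flat X a) = wobj X \<odot> a" "Tgt C (flat X a) = act_obj X a"
proof -
  have "flat X a \<in> Arr C \<and> Src C (flat X a) = wobj X \<odot> a \<and> Tgt C (flat X a) = act_obj X a"
    using assms by (induction X arbitrary: a) (auto simp: object_signature_def)
  then show "flat X a \<in> Arr C" "Src C (flat X a) = wobj X \<odot> a" "Tgt C (flat X a) = act_obj X a"
    by auto
qed

lemma flat_natural:
  "\<lbrakk>wf_obj X; f \<in> Arr C\<rbrakk> \<Longrightarrow> act_arr X f \<cdot> flat X (Src C f) = flat X (Tgt C f) \<cdot> (\<one> (wobj X) \<otimes> f)"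
proof (induction X arbitrary: f)
  case WUnit
  then show ?case using lam_natural[OF arr_hom] by simp
next
  case (WGen x)
  then show ?case by simp
next
  case (WTen X Y)
  then have [simp]: "wf_obj X" "wf_obj Y" "f \<in> Arr C" by auto
  let ?a = "Src C f" and ?b = "Tgt C f"
  have "act_arr (WTen X Y) f \<cdot> flat (WTen X Y) ?a
      = act_arr X (act_arr Y f \<cdot> flat Y ?a) \<cdot> (flat X (wobj Y \<odot> ?a) \<cdot> ass_inv (wobj X) (wobj Y) ?a)"
    by (simp add: act_arr_comp assoc)
  also have "\<dots> = act_arr X (flat Y ?b) \<cdot>
      ((act_arr X (\<one> (wobj Y) \<otimes> f) \<cdot> flat X (wobj Y \<odot> ?a)) \<cdot> ass_inv (wobj X) (wobj Y) ?a)"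
    by (simp add: act_arr_comp assoc WTen.IH)
  also have "\<dots> = act_arr X (flat Y ?b) \<cdot>
      (flat X (wobj Y \<odot> ?b) \<cdot> ((\<one> (wobj X) \<otimes> (\<one> (wobj Y) \<otimes> f)) \<cdot> ass_inv (wobj X) (wobj Y) ?a))"
    using WTen.IH(1)[of "\<one> (wobj Y) \<otimes> f"] by (simp add: assoc)
  also have "\<dots> = flat (WTen X Y) ?b \<cdot> (\<one> (wobj (WTen X Y)) \<otimes> f)"
    using ass_inv_natural[OF arr_hom arr_hom arr_hom, of "\<one> (wobj X)" "\<one> (wobj Y)" f]
    by (simp add: assoc)
  finally show ?case .
qed

text \<open>The arrow \<open>f : X \<rightarrow> Y\<close> acts as the family \<open>g\<close>.\<close>

text \<open>
The arrow \<open>f\<close> from \<open>X\<close> to \<open>Y\<close> acts as the family \<open>g\<close> if \<open>g\<close> corresponds to \<open>f \<otimes> \<one> a\<close> under the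
canonical isomorphisms. Naturality of \<open>g\<close> is included because tensoring with a word on the right
replaces \<open>g a\<close> by \<open>g\<close> at the object to which that word sends \<open>a\<close>.
\<close>

definition acts_as :: "'o word \<Rightarrow> 'o word \<Rightarrow> 'm \<Rightarrow> ('o \<Rightarrow> 'm) \<Rightarrow> bool" where
  "acts_as X Y f g \<longleftrightarrow> wf_obj X \<and> wf_obj Y \<and> f \<in> hom C (wobj X) (wobj Y) \<and>
     (\<forall>a\<in>Obj C. g a \<in> hom C (act_obj X a) (act_obj Y a) \<and> flat Y a \<cdot> (f \<otimes> \<one> a) = g a \<cdot> flat X a) \<and>
     (\<forall>h\<in>Arr C. g (Tgt C h) \<cdot> act_arr X h = act_arr Y h \<cdot> g (Src C h))"

lemma acts_asD:
  assumes "acts_as X Y f g"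
  shows "wf_obj X" "wf_obj Y" "f \<in> Arr C" "Src C f = wobj X" "Tgt C f = wobj Y"
    "a \<in> Obj C \<Longrightarrow> g a \<in> Arr C" "a \<in> Obj C \<Longrightarrow> Src C (g a) = act_obj X a"
    "a \<in> Obj C \<Longrightarrow> Tgt C (g a) = act_obj Y a"
    "a \<in> Obj C \<Longrightarrow> flat Y a \<cdot> (f \<otimes> \<one> a) = g a \<cdot> flat X a"
    "h \<in> Arr C \<Longrightarrow> g (Tgt C h) \<cdot> act_arr X h = act_arr Y h \<cdot> g (Src C h)"
  using assms by (auto simp: acts_as_def hom_def)

lemma acts_asI:
  assumes "wf_obj X" "wf_obj Y" "f \<in> Arr C" "Src C f = wobj X" "Tgt C f = wobj Y"
    "\<And>a. a \<in> Obj C \<Longrightarrow> g a \<in> Arr C" "\<And>a. a \<in> Obj C \<Longrightarrow> Src C (g a) = act_obj X a"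
    "\<And>a. a \<in> Obj C \<Longrightarrow> Tgt C (g a) = act_obj Y a"
    "\<And>a. a \<in> Obj C \<Longrightarrow> flat Y a \<cdot> (f \<otimes> \<one> a) = g a \<cdot> flat X a"
    "\<And>h. h \<in> Arr C \<Longrightarrow> g (Tgt C h) \<cdot> act_arr X h = act_arr Y h \<cdot> g (Src C h)"
  shows "acts_as X Y f g"
  using assms by (auto simp: acts_as_def hom_def)

lemma acts_as_ide: "wf_obj X \<Longrightarrow> acts_as X X (\<one> (wobj X)) (\<lambda>a. \<one> (act_obj X a))"
  by (rule acts_asI) auto

lemma comp_assoc_eq: "\<lbrakk>v \<cdot> u = w; f \<in> Arr C; u \<in> Arr C; v \<in> Arr C; Src C u = Tgt C f; Src C v = Tgt C u\<rbrakk>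
  \<Longrightarrow> v \<cdot> (u \<cdot> f) = w \<cdot> f"
  using assoc by metis

lemma acts_as_comp:
  assumes "acts_as X Y f g" "acts_as Y Z f' g'"
  shows "acts_as X Z (f' \<cdot> f) (\<lambda>a. g' a \<cdot> g a)"
proof -
  note [simp] = acts_asD(1-8)[OF assms(1)] acts_asD(1-8)[OF assms(2)]
  show ?thesis
  proof (rule acts_asI)
    fix a assume [simp]: "a \<in> Obj C"
    have "flat Z a \<cdot> ((f' \<cdot> f) \<otimes> \<one> a) = (flat Z a \<cdot> (f' \<otimes> \<one> a)) \<cdot> (f \<otimes> \<one> a)"
      by (simp add: ten_right_comp assoc)
    also have "\<dots> = g' a \<cdot> (flat Y a \<cdot> (f \<otimes> \<one> a))"
      using acts_asD(9)[OF assms(2), of a] by (simp add: assoc)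
    also have "\<dots> = (g' a \<cdot> g a) \<cdot> flat X a"
      using acts_asD(9)[OF assms(1), of a] by (simp add: assoc)
    finally show "flat Z a \<cdot> ((f' \<cdot> f) \<otimes> \<one> a) = (g' a \<cdot> g a) \<cdot> flat X a" .
  next
    fix h assume [simp]: "h \<in> Arr C"
    have "(g' (Tgt C h) \<cdot> g (Tgt C h)) \<cdot> act_arr X h = (g' (Tgt C h) \<cdot> act_arr Y h) \<cdot> g (Src C h)"
      using acts_asD(10)[OF assms(1), of h] by (simp add: assoc)
    also have "\<dots> = act_arr Z h \<cdot> (g' (Src C h) \<cdot> g (Src C h))"
      using acts_asD(10)[OF assms(2), of h] by (simp add: assoc)
    finally show "(g' (Tgt C h) \<cdot> g (Tgt C h)) \<cdot> act_arr X h = act_arr Z h \<cdot> (g' (Src C h) \<cdot> g (Src C h))" .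
  qed auto
qed

text \<open>
Associators move \<open>\<one> \<otimes> f\<close> past \<open>a\<close>; then the claim is naturality of \<open>flat X\<close>.
\<close>

lemma acts_as_left:
  assumes "acts_as Y Z f g" "wf_obj X"
  shows "acts_as (WTen X Y) (WTen X Z) (\<one> (wobj X) \<otimes> f) (\<lambda>a. act_arr X (g a))"
proof -
  note [simp] = acts_asD(1-8)[OF assms(1)] assms(2)
  let ?x = "wobj X" and ?y = "wobj Y" and ?z = "wobj Z"
  show ?thesis
  proof (rule acts_asI)
    fix a assume [simp]: "a \<in> Obj C"
    have "flat (WTen X Z) a \<cdot> ((\<one> ?x \<otimes> f) \<otimes> \<one> a)
        = act_arr X (flat Z a) \<cdot> (flat X (?z \<odot> a) \<cdot> (ass_inv ?x ?z a \<cdot> ((\<one> ?x \<otimes> f) \<otimes> \<one> a)))"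
      by (simp add: assoc)
    also have "\<dots> = act_arr X (flat Z a) \<cdot> (flat X (?z \<odot> a) \<cdot> ((\<one> ?x \<otimes> (f \<otimes> \<one> a)) \<cdot> ass_inv ?x ?y a))"
      using ass_inv_natural[OF arr_hom arr_hom arr_hom, of "\<one> ?x" f "\<one> a"] by simp
    also have "\<dots> = act_arr X (flat Z a) \<cdot> ((flat X (?z \<odot> a) \<cdot> (\<one> ?x \<otimes> (f \<otimes> \<one> a))) \<cdot> ass_inv ?x ?y a)"
      by (simp add: assoc)
    also have "\<dots> = act_arr X (flat Z a \<cdot> (f \<otimes> \<one> a)) \<cdot> (flat X (?y \<odot> a) \<cdot> ass_inv ?x ?y a)"
      using flat_natural[of X "f \<otimes> \<one> a", symmetric] by (simp add: assoc act_arr_comp)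
    also have "\<dots> = act_arr X (g a) \<cdot> flat (WTen X Y) a"
      using acts_asD(9)[OF assms(1), of a] by (simp add: assoc act_arr_comp)
    finally show "flat (WTen X Z) a \<cdot> ((\<one> ?x \<otimes> f) \<otimes> \<one> a) = act_arr X (g a) \<cdot> flat (WTen X Y) a" .
  next
    fix h assume [simp]: "h \<in> Arr C"
    show "act_arr X (g (Tgt C h)) \<cdot> act_arr (WTen X Y) h = act_arr (WTen X Z) h \<cdot> act_arr X (g (Src C h))"
      using acts_asD(10)[OF assms(1), of h] by (simp add: act_arr_comp[symmetric])
  qed auto
qed

text \<open>
Here naturality of the family \<open>g\<close>, applied to \<open>flat X a\<close>, is what is used.
\<close>

lemma acts_as_right:
  assumes "acts_as Y Z f g" "wf_obj X"
  shows "acts_as (WTen Y X) (WTen Z X) (f \<otimes> \<one> (wobj X)) (\<lambda>a. g (act_obj X a))"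
proof -
  note [simp] = acts_asD(1-8)[OF assms(1)] assms(2)
  let ?x = "wobj X" and ?y = "wobj Y" and ?z = "wobj Z"
  show ?thesis
  proof (rule acts_asI)
    fix a assume [simp]: "a \<in> Obj C"
    have "flat (WTen Z X) a \<cdot> ((f \<otimes> \<one> ?x) \<otimes> \<one> a)
        = act_arr Z (flat X a) \<cdot> (flat Z (?x \<odot> a) \<cdot> (ass_inv ?z ?x a \<cdot> ((f \<otimes> \<one> ?x) \<otimes> \<one> a)))"
      by (simp add: assoc)
    also have "\<dots> = act_arr Z (flat X a) \<cdot> ((flat Z (?x \<odot> a) \<cdot> (f \<otimes> \<one> (?x \<odot> a))) \<cdot> ass_inv ?y ?x a)"
      using ass_inv_natural[OF arr_hom arr_hom arr_hom, of f "\<one> ?x" "\<one> a"] by (simp add: assoc)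
    also have "\<dots> = (act_arr Z (flat X a) \<cdot> g (?x \<odot> a)) \<cdot> (flat Y (?x \<odot> a) \<cdot> ass_inv ?y ?x a)"
      using acts_asD(9)[OF assms(1), of "?x \<odot> a"] by (simp add: assoc)
    also have "\<dots> = g (act_obj X a) \<cdot> flat (WTen Y X) a"
      using acts_asD(10)[OF assms(1), of "flat X a", symmetric] by (simp add: assoc)
    finally show "flat (WTen Z X) a \<cdot> ((f \<otimes> \<one> ?x) \<otimes> \<one> a) = g (act_obj X a) \<cdot> flat (WTen Y X) a" .
  next
    fix h assume [simp]: "h \<in> Arr C"
    show "g (act_obj X (Tgt C h)) \<cdot> act_arr (WTen Y X) h = act_arr (WTen Z X) h \<cdot> g (act_obj X (Src C h))"
      using acts_asD(10)[OF assms(1), of "act_arr X h"] by simp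
  qed auto
qed

text \<open>
An arrow acting as the identity has inverses acting as the identity; this covers the inverses of
associators and unitors.
\<close>

lemma acts_as_inverse:
  assumes "acts_as X Y f g" "f' \<in> hom C (wobj Y) (wobj X)" "f \<cdot> f' = \<one> (wobj Y)"
    "\<And>a. a \<in> Obj C \<Longrightarrow> g a = \<one> (act_obj X a)" "\<And>a. a \<in> Obj C \<Longrightarrow> act_obj X a = act_obj Y a"
    "\<And>h. h \<in> Arr C \<Longrightarrow> act_arr X h = act_arr Y h"
  shows "acts_as Y X f' g"
proof -
  note [simp] = acts_asD(1-5)[OF assms(1)] homD[OF assms(2)] assms(4-6)
  show ?thesis
  proof (rule acts_asI)
    fix a assume [simp]: "a \<in> Obj C"
    have "flat X a \<cdot> (f' \<otimes> \<one> a) = g a \<cdot> flat X a \<cdot> (f' \<otimes> \<one> a)" by simp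
    also have "\<dots> = flat Y a \<cdot> ((f \<cdot> f') \<otimes> \<one> a)"
      using acts_asD(9)[OF assms(1), of a, symmetric] by (simp add: assoc ten_right_comp)
    also have "\<dots> = g a \<cdot> flat Y a" by (simp add: assms(3))
    finally show "flat X a \<cdot> (f' \<otimes> \<one> a) = g a \<cdot> flat Y a" .
  qed auto
qed

text \<open>
The pentagon says exactly that associators act trivially; likewise the triangle for \<open>\<r>\<close> below.
\<close>

lemma acts_as_ass:
  assumes [simp]: "wf_obj X" "wf_obj Y" "wf_obj Z"
  shows "acts_as (WTen X (WTen Y Z)) (WTen (WTen X Y) Z) (ass (wobj X) (wobj Y) (wobj Z))
     (\<lambda>a. \<one> (act_obj X (act_obj Y (act_obj Z a))))"
proof (rule acts_asI)
  fix a assume [simp]: "a \<in> Obj C"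
  let ?x = "wobj X" and ?y = "wobj Y" and ?z = "wobj Z"
  \<comment> \<open>the pentagon, solved for the two inverse associators that occur in \<open>flat\<close>\<close>
  have pent: "ass_inv ?x ?y (?z \<odot> a) \<cdot> (ass_inv (?x \<odot> ?y) ?z a \<cdot> (ass ?x ?y ?z \<otimes> \<one> a))
     = (\<one> ?x \<otimes> ass_inv ?y ?z a) \<cdot> ass_inv ?x (?y \<odot> ?z) a" (is "?l = ?r")
  proof (rule cancel_right[where h' = "(\<one> ?x \<otimes> ass_inv ?y ?z a) \<cdot> ass_inv ?x (?y \<odot> ?z) a"])
    let ?h = "ass ?x (?y \<odot> ?z) a \<cdot> (\<one> ?x \<otimes> ass ?y ?z a)"
    have "?l \<cdot> ?h = ass_inv ?x ?y (?z \<odot> a) \<cdot> (ass_inv (?x \<odot> ?y) ?z a \<cdot>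
        ((ass ?x ?y ?z \<otimes> \<one> a) \<cdot> ass ?x (?y \<odot> ?z) a \<cdot> (\<one> ?x \<otimes> ass ?y ?z a)))"
      by (simp add: assoc)
    also have "\<dots> = \<one> (?x \<odot> (?y \<odot> (?z \<odot> a)))"
      by (subst pentagon[symmetric]) (simp_all add: assoc inv_simps)
    also have "\<dots> = ?r \<cdot> ?h"
      by (simp add: assoc inv_simps ten_comp')
    finally show "?l \<cdot> ?h = ?r \<cdot> ?h" .
    have "(\<one> ?x \<otimes> ass ?y ?z a) \<cdot> ((\<one> ?x \<otimes> ass_inv ?y ?z a) \<cdot> ass_inv ?x (?y \<odot> ?z) a)
       = ass_inv ?x (?y \<odot> ?z) a"
      by (subst comp_assoc_eq[OF HOL.refl]) (simp_all add: inv_simps ten_comp')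
    then show "?h \<cdot> ?r = \<one> (Src C ?l)"
      by (simp add: assoc inv_simps)
  qed simp_all
  have "flat (WTen (WTen X Y) Z) a \<cdot> (ass ?x ?y ?z \<otimes> \<one> a) =
      act_arr X (act_arr Y (flat Z a)) \<cdot> (act_arr X (flat Y (?z \<odot> a)) \<cdot> (flat X (?y \<odot> (?z \<odot> a)) \<cdot> ?l))"
    by (simp add: assoc)
  also have "\<dots> = act_arr X (act_arr Y (flat Z a)) \<cdot> (act_arr X (flat Y (?z \<odot> a)) \<cdot>
      ((flat X (?y \<odot> (?z \<odot> a)) \<cdot> (\<one> ?x \<otimes> ass_inv ?y ?z a)) \<cdot> ass_inv ?x (?y \<odot> ?z) a))"
    unfolding pent by (simp add: assoc)
  also have "\<dots> = \<one> (act_obj X (act_obj Y (act_obj Z a))) \<cdot> flat (WTen X (WTen Y Z)) a"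
    using flat_natural[of X "ass_inv ?y ?z a", symmetric] by (simp add: assoc act_arr_comp)
  finally show "flat (WTen (WTen X Y) Z) a \<cdot> (ass ?x ?y ?z \<otimes> \<one> a)
      = \<one> (act_obj X (act_obj Y (act_obj Z a))) \<cdot> flat (WTen X (WTen Y Z)) a" .
qed auto

lemma acts_as_rho:
  assumes [simp]: "wf_obj X"
  shows "acts_as (WTen X WUnit) X (\<r> (wobj X)) (\<lambda>a. \<one> (act_obj X a))"
proof (rule acts_asI)
  fix a assume [simp]: "a \<in> Obj C"
  have "flat (WTen X WUnit) a = (flat X a \<cdot> (\<one> (wobj X) \<otimes> \<l> a)) \<cdot> ass_inv (wobj X) \<I> a"
    using flat_natural[of X "\<l> a"] by (simp add: assoc[symmetric])
  also have "\<dots> = flat X a \<cdot> (\<r> (wobj X) \<otimes> \<one> a)"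
    by (simp add: assoc triangle[symmetric] inv_simps)
  finally show "flat X a \<cdot> (\<r> (wobj X) \<otimes> \<one> a) = \<one> (act_obj X a) \<cdot> flat (WTen X WUnit) a"
    by simp
qed auto

lemma acts_as_lam:
  assumes [simp]: "wf_obj X"
  shows "acts_as (WTen WUnit X) X (\<l> (wobj X)) (\<lambda>a. \<one> (act_obj X a))"
proof (rule acts_asI)
  fix a assume [simp]: "a \<in> Obj C"
  have "flat (WTen WUnit X) a = flat X a \<cdot> (\<l> (wobj X) \<otimes> \<one> a)"
    by (simp add: lam_tensor[symmetric] assoc inv_simps)
  then show "flat X a \<cdot> (\<l> (wobj X) \<otimes> \<one> a) = \<one> (act_obj X a) \<cdot> flat (WTen WUnit X) a"
    by simp
qed auto

lemma acts_as_ass_inv: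
  assumes [simp]: "wf_obj X" "wf_obj Y" "wf_obj Z"
  shows "acts_as (WTen (WTen X Y) Z) (WTen X (WTen Y Z)) (ass_inv (wobj X) (wobj Y) (wobj Z))
     (\<lambda>a. \<one> (act_obj X (act_obj Y (act_obj Z a))))"
  by (rule acts_as_inverse[OF acts_as_ass]) (auto intro!: homI simp: inv_simps)

lemma acts_as_rho_inv:
  assumes [simp]: "wf_obj X"
  shows "acts_as X (WTen X WUnit) (\<r>_inv (wobj X)) (\<lambda>a. \<one> (act_obj X a))"
  by (rule acts_as_inverse[OF acts_as_rho]) (auto intro!: homI simp: inv_simps)

lemma acts_as_lam_inv:
  assumes [simp]: "wf_obj X"
  shows "acts_as X (WTen WUnit X) (\<l>_inv (wobj X)) (\<lambda>a. \<one> (act_obj X a))"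
  by (rule acts_as_inverse[OF acts_as_lam]) (auto intro!: homI simp: inv_simps)

text \<open>
The elementary crossing of two letters in front of \<open>a\<close>.
\<close>

definition swap :: "'o \<Rightarrow> 'o \<Rightarrow> 'o \<Rightarrow> 'm" where
  "swap x y a = ass_inv y x a \<cdot> ((\<s> x y \<otimes> \<one> a) \<cdot> ass x y a)"

text \<open>
The action of the symmetry of two words is the sequence of crossings of their letters given by the
hexagons: \<open>swap_gen x Z\<close> takes a letter past a word, \<open>swap_word X Z\<close> takes the letters of \<open>X\<close> past \<open>Z\<close>,
the last one first.
\<close>

primrec swap_gen :: "'o \<Rightarrow> 'o word \<Rightarrow> 'o \<Rightarrow> 'm" where
  "swap_gen x WUnit a = \<one> (x \<odot> a)"
| "swap_gen x (WGen y) a = swap x y a"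
| "swap_gen x (WTen Y Z) a = act_arr Y (swap_gen x Z a) \<cdot> swap_gen x Y (act_obj Z a)"

primrec swap_word :: "'o word \<Rightarrow> 'o word \<Rightarrow> 'o \<Rightarrow> 'm" where
  "swap_word WUnit Z a = \<one> (act_obj Z a)"
| "swap_word (WGen x) Z a = swap_gen x Z a"
| "swap_word (WTen X Y) Z a = swap_word X Z (act_obj Y a) \<cdot> act_arr X (swap_word Y Z a)"

lemma swap_simps [simp]:
  assumes "x \<in> Obj C" "y \<in> Obj C" "a \<in> Obj C"
  shows "swap x y a \<in> Arr C" "Src C (swap x y a) = x \<odot> (y \<odot> a)"
    "Tgt C (swap x y a) = y \<odot> (x \<odot> a)"
  using assms by (simp_all add: swap_def)

lemma swap_natural:
  assumes [simp]: "x \<in> Obj C" "y \<in> Obj C" "h \<in> Arr C"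
  shows "swap x y (Tgt C h) \<cdot> (\<one> x \<otimes> (\<one> y \<otimes> h)) = (\<one> y \<otimes> (\<one> x \<otimes> h)) \<cdot> swap x y (Src C h)"
proof -
  let ?a = "Src C h" and ?b = "Tgt C h"
  have "swap x y ?b \<cdot> (\<one> x \<otimes> (\<one> y \<otimes> h))
      = ass_inv y x ?b \<cdot> ((\<s> x y \<otimes> \<one> ?b) \<cdot> (ass x y ?b \<cdot> (\<one> x \<otimes> (\<one> y \<otimes> h))))"
    by (simp add: swap_def assoc)
  also have "\<dots> = ass_inv y x ?b \<cdot> (((\<s> x y \<otimes> \<one> ?b) \<cdot> (\<one> (x \<odot> y) \<otimes> h)) \<cdot> ass x y ?a)"
    using ass_natural'[of "\<one> x" "\<one> y" h] by (simp add: assoc)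
  also have "(\<s> x y \<otimes> \<one> ?b) \<cdot> (\<one> (x \<odot> y) \<otimes> h) = (\<one> (y \<odot> x) \<otimes> h) \<cdot> (\<s> x y \<otimes> \<one> ?a)"
    by (simp add: ten_comp')
  also have "ass_inv y x ?b \<cdot> ((\<one> (y \<odot> x) \<otimes> h) \<cdot> (\<s> x y \<otimes> \<one> ?a) \<cdot> ass x y ?a)
      = (ass_inv y x ?b \<cdot> (\<one> (y \<odot> x) \<otimes> h)) \<cdot> ((\<s> x y \<otimes> \<one> ?a) \<cdot> ass x y ?a)"
    by (simp add: assoc)
  also have "\<dots> = (\<one> y \<otimes> (\<one> x \<otimes> h)) \<cdot> swap x y ?a"
    using ass_inv_natural[OF arr_hom arr_hom arr_hom, of "\<one> y" "\<one> x" h]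
    by (simp add: swap_def assoc)
  finally show ?thesis .
qed

lemma swap_swap:
  assumes [simp]: "x \<in> Obj C" "y \<in> Obj C" "a \<in> Obj C"
  shows "swap y x a \<cdot> swap x y a = \<one> (x \<odot> (y \<odot> a))"
proof -
  have "(\<s> y x \<otimes> \<one> a) \<cdot> ((\<s> x y \<otimes> \<one> a) \<cdot> ass x y a) = ass x y a"
    by (subst comp_assoc_eq[OF HOL.refl]) (simp_all add: inv_simps ten_comp')
  then show ?thesis by (simp add: swap_def assoc inv_simps)
qed

lemma acts_as_swap:
  assumes [simp]: "x \<in> Obj C" "y \<in> Obj C"
  shows "acts_as (WTen (WGen x) (WGen y)) (WTen (WGen y) (WGen x)) (\<s> x y) (swap x y)"
proof (rule acts_asI)
  fix a assume [simp]: "a \<in> Obj C"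
  show "flat (WTen (WGen y) (WGen x)) a \<cdot> (\<s> x y \<otimes> \<one> a)
      = swap x y a \<cdot> flat (WTen (WGen x) (WGen y)) a"
    by (simp add: swap_def assoc inv_simps)
qed (auto simp: swap_natural)

lemma acts_as_cong: "\<lbrakk>acts_as X Y f g; f' = f; \<And>a. a \<in> Obj C \<Longrightarrow> g' a = g a\<rbrakk> \<Longrightarrow> acts_as X Y f' g'"
  unfolding acts_as_def by simp

lemma acts_as_swap_gen:
  "\<lbrakk>x \<in> Obj C; wf_obj Y\<rbrakk> \<Longrightarrow> acts_as (WTen (WGen x) Y) (WTen Y (WGen x)) (\<s> x (wobj Y)) (swap_gen x Y)"
proof (induction Y)
  case WUnit
  then have [simp]: "x \<in> Obj C" by simp
  show ?case
    by (rule acts_as_cong[OF acts_as_comp[OF acts_as_rho acts_as_lam_inv]])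
      (auto simp: sym_unit_right)
next
  case (WGen y)
  then show ?case by (auto intro: acts_as_cong[OF acts_as_swap])
next
  case (WTen Y Z)
  then have [simp]: "x \<in> Obj C" "wf_obj Y" "wf_obj Z" by auto
  note h = acts_as_comp[OF acts_as_comp[OF acts_as_comp[OF acts_as_comp[OF
      acts_as_ass[of "WGen x" Y Z] acts_as_right[OF WTen.IH(1)]] acts_as_ass_inv]
      acts_as_left[OF WTen.IH(2)]] acts_as_ass]
  note [simp] = acts_asD(6-8)[OF WTen.IH(1)] acts_asD(6-8)[OF WTen.IH(2)]
  show ?case by (rule acts_as_cong[OF h]) (simp_all add: sym_ten_right assoc)
qed

lemma acts_as_swap_word:
  "\<lbrakk>wf_obj X; wf_obj Z\<rbrakk> \<Longrightarrow> acts_as (WTen X Z) (WTen Z X) (\<s> (wobj X) (wobj Z)) (swap_word X Z)"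
proof (induction X)
  case WUnit
  then have [simp]: "wf_obj Z" by simp
  show ?case
    by (rule acts_as_cong[OF acts_as_comp[OF acts_as_lam acts_as_rho_inv]])
      (auto simp: sym_unit_left)
next
  case (WGen x)
  then show ?case using acts_as_swap_gen[of x Z] by (auto intro: acts_as_cong)
next
  case (WTen X Y)
  then have [simp]: "wf_obj X" "wf_obj Y" "wf_obj Z" by auto
  note h = acts_as_comp[OF acts_as_comp[OF acts_as_comp[OF acts_as_comp[OF
      acts_as_ass_inv[of X Y Z] acts_as_left[OF WTen.IH(2)]] acts_as_ass]
      acts_as_right[OF WTen.IH(1)]] acts_as_ass_inv]
  note [simp] = acts_asD(6-8)[OF WTen.IH(1)] acts_asD(6-8)[OF WTen.IH(2)]
  show ?case by (rule acts_as_cong[OF h]) (simp_all add: sym_ten_left assoc)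
qed

text \<open>
On structural terms this computes, by recursion on the term, the family by which its value acts.
\<close>

primrec act :: "('o, unit) fterm \<Rightarrow> 'o \<Rightarrow> 'm" where
  "act (FGen e) a = undefined"
| "act (FIde X) a = \<one> (act_obj X a)"
| "act (FComp u t) a = act u a \<cdot> act t a"
| "act (FLeft X t) a = act_arr X (act t a)"
| "act (FRight t X) a = act t (act_obj X a)"
| "act (FAss X Y Z) a = \<one> (act_obj X (act_obj Y (act_obj Z a)))"
| "act (FAssInv X Y Z) a = \<one> (act_obj X (act_obj Y (act_obj Z a)))"
| "act (FRho X) a = \<one> (act_obj X a)"
| "act (FRhoInv X) a = \<one> (act_obj X a)"
| "act (FLam X) a = \<one> (act_obj X a)"
| "act (FLamInv X) a = \<one> (act_obj X a)"
| "act (FSym X Y) a = swap_word X Y a"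

abbreviation "structural t \<equiv> wf_term (object_signature C) t"
abbreviation "term_src t \<equiv> fsrc (object_signature C) t"
abbreviation "term_tgt t \<equiv> ftgt (object_signature C) t"
abbreviation "term_val t \<equiv> term_eval C (\<lambda>x. x) (\<lambda>_::unit. undefined) t"

lemma acts_as_act: "structural t \<Longrightarrow> acts_as (term_src t) (term_tgt t) (term_val t) (act t)"
proof (induction t)
  case (FComp u t)
  then show ?case using acts_as_comp by (auto intro: acts_as_cong)
next
  case (FRight t X)
  then show ?case using acts_as_right by (auto intro: acts_as_cong)
next
  case (FLeft X t)
  then show ?case using acts_as_left by (auto intro: acts_as_cong)
next
  case (FSym X Y)
  then show ?case using acts_as_swap_word by (auto intro: acts_as_cong)
qed (auto simp: 
     intro: acts_as_cong[OF acts_as_ide] acts_as_cong[OF acts_as_ass] acts_as_cong[OF acts_as_ass_inv]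
     acts_as_cong[OF acts_as_rho] acts_as_cong[OF acts_as_rho_inv]
     acts_as_cong[OF acts_as_lam] acts_as_cong[OF acts_as_lam_inv])

lemma flat_left_inverse:
  "\<lbrakk>wf_obj X; a \<in> Obj C\<rbrakk> \<Longrightarrow>
    \<exists>h\<in>Arr C. Src C h = act_obj X a \<and> Tgt C h = wobj X \<odot> a \<and> h \<cdot> flat X a = \<one> (wobj X \<odot> a)"
proof (induction X arbitrary: a)
  case WUnit
  then show ?case by (intro bexI[of _ "\<l>_inv a"]) (auto simp: inv_simps)
next
  case (WGen x)
  then show ?case by (intro bexI[of _ "\<one> (x \<odot> a)"]) auto
next
  case (WTen X Y)
  then have [simp]: "wf_obj X" "wf_obj Y" "a \<in> Obj C" by auto
  obtain h where h [simp]: "h \<in> Arr C" "Src C h = act_obj Y a" "Tgt C h = wobj Y \<odot> a"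
    "h \<cdot> flat Y a = \<one> (wobj Y \<odot> a)"
    using WTen.IH(2)[of a] by auto
  obtain k where k [simp]: "k \<in> Arr C" "Src C k = act_obj X (wobj Y \<odot> a)" "Tgt C k = wobj X \<odot> (wobj Y \<odot> a)"
    "k \<cdot> flat X (wobj Y \<odot> a) = \<one> (wobj X \<odot> (wobj Y \<odot> a))"
    using WTen.IH(1)[of "wobj Y \<odot> a"] by auto
  have "act_arr X h \<cdot> (act_arr X (flat Y a) \<cdot> f) = f" if "f \<in> Arr C" "Tgt C f = act_obj X (wobj Y \<odot> a)" for f
    using that by (subst comp_assoc_eq[OF HOL.refl]) (simp_all add: act_arr_comp[symmetric])
  moreover have "k \<cdot> (flat X (wobj Y \<odot> a) \<cdot> f) = f" if "f \<in> Arr C" "Tgt C f = wobj X \<odot> (wobj Y \<odot> a)" for f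
    using that by (subst comp_assoc_eq[OF HOL.refl]) simp_all
  ultimately show ?case
    by (intro bexI[of _ "ass (wobj X) (wobj Y) a \<cdot> (k \<cdot> act_arr X h)"]) (auto simp: assoc inv_simps)
qed

text \<open>
Parallel structural terms acting in the same way on \<open>\<I>\<close> have the same value: the canonical isomorphisms
are left cancellable, so the values agree after tensoring with \<open>\<one> \<I>\<close>, which is faithful. Since
associators and unitors contribute only identities to \<open>act\<close>, this rule reduces a coherence diagram to an
identity between composites of crossings, where naturality and involutivity of \<open>swap\<close> suffice.
\<close>

theorem coherence:
  assumes t: "structural t" and u: "structural u"
    and st: "term_src t = term_src u" "term_tgt t = term_tgt u"
    and eq: "act t \<I> = act u \<I>"
  shows "term_val t = term_val u"
proof (rule unit_right_faithful)
  note T = acts_asD[OF acts_as_act[OF t]] and U = acts_asD[OF acts_as_act[OF u]]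
  obtain h where h: "h \<in> Arr C" "Src C h = act_obj (term_tgt t) \<I>" "Tgt C h = wobj (term_tgt t) \<odot> \<I>"
    "h \<cdot> flat (term_tgt t) \<I> = \<one> (wobj (term_tgt t) \<odot> \<I>)"
    using flat_left_inverse[of "term_tgt t" \<I>] T by auto
  show "term_val t \<otimes> \<one> \<I> = term_val u \<otimes> \<one> \<I>"
  proof (rule cancel_left)
    show "flat (term_tgt t) \<I> \<cdot> (term_val t \<otimes> \<one> \<I>) = flat (term_tgt t) \<I> \<cdot> (term_val u \<otimes> \<one> \<I>)"
      using T(9)[of \<I>] U(9)[of \<I>] eq st by simp
    show "h \<cdot> flat (term_tgt t) \<I> = \<one> (Tgt C (term_val t \<otimes> \<one> \<I>))"
      using h T by simp
  qed (use h T U st in simp_all)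
  show "term_val t \<in> Arr C" "term_val u \<in> Arr C" "Src C (term_val t) = Src C (term_val u)"
    "Tgt C (term_val t) = Tgt C (term_val u)"
    using T U st by simp_all
qed

end

section \<open>The interchange\<close>

context symmetric_monoidal_category
begin

text \<open>
The formal counterpart of \<open>interchange\<close>; it acts as the crossing of its two middle words.
\<close>

definition interchange_term :: "'o word \<Rightarrow> 'o word \<Rightarrow> 'o word \<Rightarrow> 'o word \<Rightarrow> ('o, unit) fterm" where
  "interchange_term W X Y Z =
     FComp (FComp (FComp (FComp (FAss W Y (WTen X Z)) (FLeft W (FAssInv Y X Z)))
       (FLeft W (FRight (FSym X Y) Z))) (FLeft W (FAss X Y Z))) (FAssInv W X (WTen Y Z))"

lemma interchange_term_simps [simp]:
  "structural (interchange_term W X Y Z) \<longleftrightarrow> wf_obj W \<and> wf_obj X \<and> wf_obj Y \<and> wf_obj Z"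
  "term_src (interchange_term W X Y Z) = WTen (WTen W X) (WTen Y Z)"
  "term_tgt (interchange_term W X Y Z) = WTen (WTen W Y) (WTen X Z)"
  "term_val (interchange_term W X Y Z) = interchange C (wobj W) (wobj X) (wobj Y) (wobj Z)"
  by (auto simp: interchange_term_def interchange_def)

lemma interchange_simps [simp]:
  assumes "a \<in> Obj C" "b \<in> Obj C" "c \<in> Obj C" "d \<in> Obj C"
  shows "interchange C a b c d \<in> Arr C" "Src C (interchange C a b c d) = (a \<odot> b) \<odot> (c \<odot> d)"
    "Tgt C (interchange C a b c d) = (a \<odot> c) \<odot> (b \<odot> d)"
  using assms by (simp_all add: interchange_def)

lemma act_interchange_term:
  assumes "wf_obj W" "wf_obj X" "wf_obj Y" "wf_obj Z" "a \<in> Obj C"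
  shows "act (interchange_term W X Y Z) a = act_arr W (swap_word X Y (act_obj Z a))"
  using assms acts_asD(6-8)[OF acts_as_swap_word[of X Y]] by (simp add: interchange_term_def)

lemma interchange_involutive:
  assumes [simp]: "a \<in> Obj C" "b \<in> Obj C" "c \<in> Obj C" "d \<in> Obj C"
  shows "interchange C a c b d \<cdot> interchange C a b c d = \<one> ((a \<odot> b) \<odot> (c \<odot> d))"
proof -
  have "term_val (FComp (interchange_term (WGen a) (WGen c) (WGen b) (WGen d))
        (interchange_term (WGen a) (WGen b) (WGen c) (WGen d)))
     = term_val (FIde (WTen (WTen (WGen a) (WGen b)) (WTen (WGen c) (WGen d))))"
    by (rule coherence) (simp_all add: act_interchange_term ten_comp' swap_swap)
  then show ?thesis by simp
qed

text \<open>
On the right \<open>a\<close> and \<open>d\<close> cross twice, which cancels; the remaining crossings are those on the left.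
\<close>

lemma interchange_sym:
  assumes [simp]: "a \<in> Obj C" "b \<in> Obj C" "c \<in> Obj C" "d \<in> Obj C"
  shows "(\<s> a c \<otimes> \<s> b d) \<cdot> interchange C a b c d = interchange C c d a b \<cdot> \<s> (a \<odot> b) (c \<odot> d)"
proof -
  let ?s = "FComp (FRight (FSym (WGen a) (WGen c)) (WTen (WGen d) (WGen b)))
      (FLeft (WTen (WGen a) (WGen c)) (FSym (WGen b) (WGen d)))"
  have [simp]: "(\<one> c \<otimes> swap d a e) \<cdot> ((\<one> c \<otimes> swap a d e) \<cdot> f) = f"
    if "e \<in> Obj C" "f \<in> Arr C" "Tgt C f = c \<odot> (a \<odot> (d \<odot> e))" for e f
    using that by (subst comp_assoc_eq[OF HOL.refl]) (simp_all add: ten_comp' swap_swap)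
  have "term_val (FComp ?s (interchange_term (WGen a) (WGen b) (WGen c) (WGen d)))
     = term_val (FComp (interchange_term (WGen c) (WGen d) (WGen a) (WGen b))
         (FSym (WTen (WGen a) (WGen b)) (WTen (WGen c) (WGen d))))"
    by (rule coherence) (simp_all add: act_interchange_term ten_left_comp assoc)
  then show ?thesis by (simp add: ten_comp')
qed

lemma interchange_rho:
  assumes [simp]: "a \<in> Obj C" "b \<in> Obj C"
  shows "(\<r> a \<otimes> \<r> b) \<cdot> interchange C a b \<I> \<I> \<cdot> (\<one> (a \<odot> b) \<otimes> \<r>_inv \<I>) = \<r> (a \<odot> b)"
proof -
  let ?r = "FComp (FRight (FRho (WGen a)) (WGen b)) (FLeft (WTen (WGen a) WUnit) (FRho (WGen b)))"
  have "term_val (FComp (FComp ?r (interchange_term (WGen a) (WGen b) WUnit WUnit))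
        (FLeft (WTen (WGen a) (WGen b)) (FRhoInv WUnit)))
     = term_val (FRho (WTen (WGen a) (WGen b)))"
    by (rule coherence) (simp_all add: act_interchange_term)
  then show ?thesis by (simp add: ten_comp')
qed

lemma interchange_lam:
  assumes [simp]: "a \<in> Obj C" "b \<in> Obj C"
  shows "(\<l> a \<otimes> \<l> b) \<cdot> interchange C \<I> \<I> a b \<cdot> (\<r>_inv \<I> \<otimes> \<one> (a \<odot> b)) = \<l> (a \<odot> b)"
proof -
  let ?l = "FComp (FRight (FLam (WGen a)) (WGen b)) (FLeft (WTen WUnit (WGen a)) (FLam (WGen b)))"
  have "term_val (FComp (FComp ?l (interchange_term WUnit WUnit (WGen a) (WGen b)))
        (FRight (FRhoInv WUnit) (WTen (WGen a) (WGen b))))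
     = term_val (FLam (WTen (WGen a) (WGen b)))"
    by (rule coherence) (simp_all add: act_interchange_term)
  then show ?thesis by (simp add: ten_comp')
qed

text \<open>
Both sides move \<open>a'\<close> past \<open>b\<close> and \<open>c\<close>, and \<open>b'\<close> past \<open>c\<close>. They differ in the order of the disjoint
crossings of \<open>a', b\<close> and of \<open>b', c\<close>, which commute by naturality.
\<close>

lemma interchange_ass:
  assumes [simp]: "a \<in> Obj C" "b \<in> Obj C" "c \<in> Obj C" "a' \<in> Obj C" "b' \<in> Obj C" "c' \<in> Obj C"
  shows "(ass a b c \<otimes> ass a' b' c') \<cdot> interchange C a a' (b \<odot> c) (b' \<odot> c')
       \<cdot> (\<one> (a \<odot> a') \<otimes> interchange C b b' c c')
     = interchange C (a \<odot> b) (a' \<odot> b') c c' \<cdot> (interchange C a a' b b' \<otimes> \<one> (c \<odot> c'))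
       \<cdot> ass (a \<odot> a') (b \<odot> b') (c \<odot> c')"
proof -
  let ?a = "WGen a" and ?b = "WGen b" and ?c = "WGen c"
  let ?a' = "WGen a'" and ?b' = "WGen b'" and ?c' = "WGen c'"
  let ?x = "FComp (FRight (FAss ?a ?b ?c) (WTen (WTen ?a' ?b') ?c'))
      (FLeft (WTen ?a (WTen ?b ?c)) (FAss ?a' ?b' ?c'))"
  have nat: "swap a' b (c \<odot> (b' \<odot> e)) \<cdot> (\<one> a' \<otimes> (\<one> b \<otimes> swap b' c e))
     = (\<one> b \<otimes> (\<one> a' \<otimes> swap b' c e)) \<cdot> swap a' b (b' \<odot> (c \<odot> e))" if "e \<in> Obj C" for e
    using swap_natural[of a' b "swap b' c e"] that by simp
  have "term_val (FComp (FComp ?x (interchange_term ?a ?a' (WTen ?b ?c) (WTen ?b' ?c')))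
        (FLeft (WTen ?a ?a') (interchange_term ?b ?b' ?c ?c')))
     = term_val (FComp (FComp (interchange_term (WTen ?a ?b) (WTen ?a' ?b') ?c ?c')
          (FRight (interchange_term ?a ?a' ?b ?b') (WTen ?c ?c')))
        (FAss (WTen ?a ?a') (WTen ?b ?b') (WTen ?c ?c')))"
    by (rule coherence)
      (simp_all add: act_interchange_term ten_left_comp[symmetric] assoc nat,
       simp add: ten_left_comp assoc)
  then show ?thesis by (simp add: ten_comp')
qed

lemma unit_coherence: "\<r> \<I> = \<l> \<I>" "\<s> \<I> \<I> = \<one> (\<I> \<odot> \<I>)"
    "\<r> \<I> \<cdot> (\<one> \<I> \<otimes> \<r> \<I>) = \<r> \<I> \<cdot> (\<r> \<I> \<otimes> \<one> \<I>) \<cdot> ass \<I> \<I> \<I>"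
proof -
  have "term_val (FRho WUnit) = term_val (FLam WUnit)"
    by (rule coherence) simp_all
  then show "\<r> \<I> = \<l> \<I>" by simp
  have "term_val (FSym WUnit WUnit) = term_val (FIde (WTen WUnit WUnit))"
    by (rule coherence) simp_all
  then show "\<s> \<I> \<I> = \<one> (\<I> \<odot> \<I>)" by simp
  have "term_val (FComp (FRho WUnit) (FLeft WUnit (FRho WUnit)))
     = term_val (FComp (FComp (FRho WUnit) (FRight (FRho WUnit) WUnit)) (FAss WUnit WUnit WUnit))"
    by (rule coherence) simp_all
  then show "\<r> \<I> \<cdot> (\<one> \<I> \<otimes> \<r> \<I>) = \<r> \<I> \<cdot> (\<r> \<I> \<otimes> \<one> \<I>) \<cdot> ass \<I> \<I> \<I>" by simp
qed

lemma paste_squares: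
  assumes "p' \<cdot> f = g \<cdot> p" "q' \<cdot> g = h \<cdot> q"
    "f \<in> Arr C" "g \<in> Arr C" "h \<in> Arr C" "p \<in> Arr C" "p' \<in> Arr C" "q \<in> Arr C" "q' \<in> Arr C"
    "Src C p' = Tgt C f" "Src C q' = Tgt C g" "Tgt C p' = Tgt C g"
    "Src C g = Tgt C p" "Src C h = Tgt C q" "Src C q = Tgt C p"
  shows "(q' \<cdot> p') \<cdot> f = h \<cdot> (q \<cdot> p)"
proof -
  have "(q' \<cdot> p') \<cdot> f = q' \<cdot> (p' \<cdot> f)" using assms(3-) by (simp add: assoc)
  also have "\<dots> = (q' \<cdot> g) \<cdot> p" unfolding assms(1) using assms(3-) by (simp add: assoc)
  also have "\<dots> = h \<cdot> (q \<cdot> p)" unfolding assms(2) using assms(3-) by (simp add: assoc)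
  finally show ?thesis .
qed

lemma tensor_square:
  assumes "p' \<cdot> f = g \<cdot> p" "k \<in> Arr C" "f \<in> Arr C" "g \<in> Arr C" "p \<in> Arr C" "p' \<in> Arr C"
    "Src C p' = Tgt C f" "Src C g = Tgt C p"
  shows "(\<one> (Tgt C k) \<otimes> p') \<cdot> (k \<otimes> f) = (k \<otimes> g) \<cdot> (\<one> (Src C k) \<otimes> p)"
  using assms by (simp add: ten_comp')

text \<open>
The interchange is a composite of five natural isomorphisms, so five naturality squares are pasted.
\<close>

lemma interchange_natural:
  assumes [simp]: "f \<in> Arr C" "g \<in> Arr C" "h \<in> Arr C" "k \<in> Arr C"
  shows "interchange C (Tgt C f) (Tgt C g) (Tgt C h) (Tgt C k) \<cdot> ((f \<otimes> g) \<otimes> (h \<otimes> k))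
       = ((f \<otimes> h) \<otimes> (g \<otimes> k)) \<cdot> interchange C (Src C f) (Src C g) (Src C h) (Src C k)"
proof -
  have inv: "ass_inv (Tgt C u) (Tgt C v) (Tgt C w) \<cdot> ((u \<otimes> v) \<otimes> w)
      = (u \<otimes> (v \<otimes> w)) \<cdot> ass_inv (Src C u) (Src C v) (Src C w)"
    if "u \<in> Arr C" "v \<in> Arr C" "w \<in> Arr C" for u v w
    using ass_inv_natural[OF arr_hom arr_hom arr_hom] that by blast
  have braid: "(\<s> (Tgt C g) (Tgt C h) \<otimes> \<one> (Tgt C k)) \<cdot> ((g \<otimes> h) \<otimes> k)
      = ((h \<otimes> g) \<otimes> k) \<cdot> (\<s> (Src C g) (Src C h) \<otimes> \<one> (Src C k))"
    using sym_natural[OF arr_hom arr_hom, of g h] by (simp add: ten_comp')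
  have 1: "(\<one> (Tgt C f) \<otimes> ass (Tgt C g) (Tgt C h) (Tgt C k)) \<cdot> (f \<otimes> (g \<otimes> (h \<otimes> k)))
     = (f \<otimes> ((g \<otimes> h) \<otimes> k)) \<cdot> (\<one> (Src C f) \<otimes> ass (Src C g) (Src C h) (Src C k))"
    by (rule tensor_square[OF ass_natural']) simp_all
  have 2: "(\<one> (Tgt C f) \<otimes> (\<s> (Tgt C g) (Tgt C h) \<otimes> \<one> (Tgt C k))) \<cdot> (f \<otimes> ((g \<otimes> h) \<otimes> k))
     = (f \<otimes> ((h \<otimes> g) \<otimes> k)) \<cdot> (\<one> (Src C f) \<otimes> (\<s> (Src C g) (Src C h) \<otimes> \<one> (Src C k)))"
    by (rule tensor_square[OF braid]) simp_all
  have 3: "(\<one> (Tgt C f) \<otimes> ass_inv (Tgt C h) (Tgt C g) (Tgt C k)) \<cdot> (f \<otimes> ((h \<otimes> g) \<otimes> k))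
     = (f \<otimes> (h \<otimes> (g \<otimes> k))) \<cdot> (\<one> (Src C f) \<otimes> ass_inv (Src C h) (Src C g) (Src C k))"
    by (rule tensor_square[OF inv]) simp_all
  have 4: "ass_inv (Tgt C f) (Tgt C g) (Tgt C h \<odot> Tgt C k) \<cdot> ((f \<otimes> g) \<otimes> (h \<otimes> k))
     = (f \<otimes> (g \<otimes> (h \<otimes> k))) \<cdot> ass_inv (Src C f) (Src C g) (Src C h \<odot> Src C k)"
    using inv[of f g "h \<otimes> k"] by simp
  have 5: "ass (Tgt C f) (Tgt C h) (Tgt C g \<odot> Tgt C k) \<cdot> (f \<otimes> (h \<otimes> (g \<otimes> k)))
     = ((f \<otimes> h) \<otimes> (g \<otimes> k)) \<cdot> ass (Src C f) (Src C h) (Src C g \<odot> Src C k)"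
    using ass_natural'[of f h "g \<otimes> k"] by simp
  note p = paste_squares[OF paste_squares[OF paste_squares[OF paste_squares[OF 4 1] 2] 3] 5]
  show ?thesis
    unfolding interchange_def using p by (simp add: assoc)
qed

end

section \<open>The pointwise tensor product\<close>

context symmetric_monoidal_functor
begin

lemma FO_obj' [simp]: "a \<in> Obj A \<Longrightarrow> FO F a \<in> Obj B"
  by (rule FO_obj)

lemma FA_simps [simp]:
  assumes "f \<in> Arr A"
  shows "FA F f \<in> Arr B" "Src B (FA F f) = FO F (Src A f)" "Tgt B (FA F f) = FO F (Tgt A f)"
  using FA_hom[OF A.arr_hom[OF assms]] by (auto simp: hom_def)

lemma F0_simps [simp]: "F0 F \<in> Arr B" "Src B (F0 F) = \<I>" "Tgt B (F0 F) = FO F \<I>\<^bsub>A\<^esub>"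
  using F0_hom by (auto simp: hom_def)

lemma F2_simps [simp]:
  assumes "a \<in> Obj A" "b \<in> Obj A"
  shows "F2 F a b \<in> Arr B" "Src B (F2 F a b) = FO F a \<odot> FO F b"
    "Tgt B (F2 F a b) = FO F (a \<odot>\<^bsub>A\<^esub> b)"
  using F2_hom[OF assms] by (auto simp: hom_def)

end

text \<open>
The comparison arrow \<open>\<r> \<I>\<close> makes \<open>\<I>\<close> a commutative monoid; the axioms of a symmetric monoidal functor
express that, and hold by coherence.
\<close>

lemma unit_functor_SMC:
  assumes "symmetric_monoidal_category A" "symmetric_monoidal_category B"
  shows "unit_functor A B \<in> SMC A B"
proof -
  interpret A: symmetric_monoidal_category A by fact
  interpret B: symmetric_monoidal_category B by fact
  let ?F = "unit_functor A B"
  have [simp]: "\<And>a. a \<in> Obj A \<Longrightarrow> FO ?F a = \<I>\<^bsub>B\<^esub>" "\<And>f. f \<in> Arr A \<Longrightarrow> FA ?F f = \<one>\<^bsub>B\<^esub> \<I>\<^bsub>B\<^esub>"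
    "F0 ?F = \<one>\<^bsub>B\<^esub> \<I>\<^bsub>B\<^esub>" "\<And>a b. \<lbrakk>a \<in> Obj A; b \<in> Obj A\<rbrakk> \<Longrightarrow> F2 ?F a b = \<r>\<^bsub>B\<^esub> \<I>\<^bsub>B\<^esub>"
    by (simp_all add: unit_functor_def)
  have "symmetric_monoidal_functor A B ?F"
  proof unfold_locales
    show "FO ?F \<in> extensional (Obj A)" "FA ?F \<in> extensional (Arr A)" "F2 ?F \<in> extensional (Obj A)"
      "\<And>a. a \<in> Obj A \<Longrightarrow> F2 ?F a \<in> extensional (Obj A)"
      by (simp_all add: unit_functor_def)
  next
    fix f a b assume f: "f \<in> hom A a b"
    show "FA ?F f \<in> hom B (FO ?F a) (FO ?F b)"
      using A.hom_obj[OF f] A.homD[OF f] by (intro B.homI) auto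
  next
    fix f g a b c assume f: "f \<in> hom A a b" and g: "g \<in> hom A b c"
    show "FA ?F (g \<cdot>\<^bsub>A\<^esub> f) = FA ?F g \<cdot>\<^bsub>B\<^esub> FA ?F f"
      using A.homD[OF f] A.homD[OF g] by simp
  next
    fix f g a a' b b' assume f: "f \<in> hom A a a'" and g: "g \<in> hom A b b'"
    show "F2 ?F a' b' \<cdot>\<^bsub>B\<^esub> (FA ?F f \<otimes>\<^bsub>B\<^esub> FA ?F g) = FA ?F (f \<otimes>\<^bsub>A\<^esub> g) \<cdot>\<^bsub>B\<^esub> F2 ?F a b"
      using A.homD[OF f] A.homD[OF g] A.hom_obj[OF f] A.hom_obj[OF g] by simp
  next
    fix a b c assume [simp]: "a \<in> Obj A" "b \<in> Obj A" "c \<in> Obj A"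
    show "FA ?F (Ass A a b c) \<cdot>\<^bsub>B\<^esub> F2 ?F a (b \<odot>\<^bsub>A\<^esub> c) \<cdot>\<^bsub>B\<^esub> (\<one>\<^bsub>B\<^esub> (FO ?F a) \<otimes>\<^bsub>B\<^esub> F2 ?F b c) =
          F2 ?F (a \<odot>\<^bsub>A\<^esub> b) c \<cdot>\<^bsub>B\<^esub> (F2 ?F a b \<otimes>\<^bsub>B\<^esub> \<one>\<^bsub>B\<^esub> (FO ?F c)) \<cdot>\<^bsub>B\<^esub> Ass B (FO ?F a) (FO ?F b) (FO ?F c)"
      using B.unit_coherence(3) by simp
  qed (auto intro!: B.homI simp: B.unit_coherence(1)[symmetric] B.unit_coherence(2))
  then show ?thesis by (simp add: SMC_def)
qed

text \<open>
Each axiom for the pointwise tensor product is the tensor product of the axioms for \<open>F\<close> and \<open>G\<close>,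
rearranged: naturality of the interchange brings the structure arrows of \<open>F\<close> together and those of \<open>G\<close>
together, and one of the compatibilities of the interchange closes the diagram.
\<close>

lemma box_SMC:
  assumes "F \<in> SMC A B" "G \<in> SMC A B"
  shows "box A B F G \<in> SMC A B"
proof -
  interpret A: symmetric_monoidal_category A using assms by (simp add: SMC_def symmetric_monoidal_functor_def)
  interpret B: symmetric_monoidal_category B using assms by (simp add: SMC_def symmetric_monoidal_functor_def)
  interpret F: symmetric_monoidal_functor A B F using assms by (simp add: SMC_def)
  interpret G: symmetric_monoidal_functor A B G using assms by (simp add: SMC_def)
  let ?H = "box A B F G"
  let ?m = "\<lambda>a b. interchange B (FO F a) (FO G a) (FO F b) (FO G b)"
  have H [simp]: "\<And>a. a \<in> Obj A \<Longrightarrow> FO ?H a = FO F a \<odot>\<^bsub>B\<^esub> FO G a"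
    "\<And>f. f \<in> Arr A \<Longrightarrow> FA ?H f = FA F f \<otimes>\<^bsub>B\<^esub> FA G f"
    "F0 ?H = (F0 F \<otimes>\<^bsub>B\<^esub> F0 G) \<cdot>\<^bsub>B\<^esub> \<r>_inv\<^bsub>B\<^esub> \<I>\<^bsub>B\<^esub>"
    "\<And>a b. \<lbrakk>a \<in> Obj A; b \<in> Obj A\<rbrakk> \<Longrightarrow> F2 ?H a b = (F2 F a b \<otimes>\<^bsub>B\<^esub> F2 G a b) \<cdot>\<^bsub>B\<^esub> ?m a b"
    by (simp_all add: box_def)
  have "symmetric_monoidal_functor A B ?H"
  proof unfold_locales
    show "FO ?H \<in> extensional (Obj A)" "FA ?H \<in> extensional (Arr A)" "F2 ?H \<in> extensional (Obj A)"
      "\<And>a. a \<in> Obj A \<Longrightarrow> F2 ?H a \<in> extensional (Obj A)"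
      by (simp_all add: box_def)
  next
    fix f a b assume f: "f \<in> hom A a b"
    then show "FA ?H f \<in> hom B (FO ?H a) (FO ?H b)"
      using A.hom_obj[OF f] A.homD[OF f] by (intro B.homI) auto
  next
    fix f g a b c assume f: "f \<in> hom A a b" and g: "g \<in> hom A b c"
    show "FA ?H (g \<cdot>\<^bsub>A\<^esub> f) = FA ?H g \<cdot>\<^bsub>B\<^esub> FA ?H f"
      using A.homD[OF f] A.homD[OF g] F.FA_comp[OF f g] G.FA_comp[OF f g]
      by (simp add: B.ten_comp')
  next
    fix f g a a' b b' assume f: "f \<in> hom A a a'" and g: "g \<in> hom A b b'"
    note [simp] = A.homD[OF f] A.homD[OF g] A.hom_obj[OF f] A.hom_obj[OF g]
    have "F2 ?H a' b' \<cdot>\<^bsub>B\<^esub> (FA ?H f \<otimes>\<^bsub>B\<^esub> FA ?H g)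
       = (F2 F a' b' \<otimes>\<^bsub>B\<^esub> F2 G a' b') \<cdot>\<^bsub>B\<^esub>
          (?m a' b' \<cdot>\<^bsub>B\<^esub> ((FA F f \<otimes>\<^bsub>B\<^esub> FA G f) \<otimes>\<^bsub>B\<^esub> (FA F g \<otimes>\<^bsub>B\<^esub> FA G g)))"
      by (simp add: B.assoc)
    also have "\<dots> = (F2 F a' b' \<otimes>\<^bsub>B\<^esub> F2 G a' b') \<cdot>\<^bsub>B\<^esub>
          ((FA F f \<otimes>\<^bsub>B\<^esub> FA F g) \<otimes>\<^bsub>B\<^esub> (FA G f \<otimes>\<^bsub>B\<^esub> FA G g)) \<cdot>\<^bsub>B\<^esub> ?m a b"
      using B.interchange_natural[of "FA F f" "FA G f" "FA F g" "FA G g"] by (simp add: B.assoc)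
    also have "\<dots> = FA ?H (f \<otimes>\<^bsub>A\<^esub> g) \<cdot>\<^bsub>B\<^esub> F2 ?H a b"
      using F.F2_natural[OF f g] G.F2_natural[OF f g]
      by (simp add: B.ten_comp' B.assoc[symmetric])
    finally show "F2 ?H a' b' \<cdot>\<^bsub>B\<^esub> (FA ?H f \<otimes>\<^bsub>B\<^esub> FA ?H g) = FA ?H (f \<otimes>\<^bsub>A\<^esub> g) \<cdot>\<^bsub>B\<^esub> F2 ?H a b" .
  next
    fix a b c assume [simp]: "a \<in> Obj A" "b \<in> Obj A" "c \<in> Obj A"
    let ?bc = "b \<odot>\<^bsub>A\<^esub> c" and ?ab = "a \<odot>\<^bsub>A\<^esub> b"
    let ?Fa = "FO F a" and ?Fb = "FO F b" and ?Fc = "FO F c"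
    let ?Ga = "FO G a" and ?Gb = "FO G b" and ?Gc = "FO G c"
    have Fa: "FA F (Ass A a b c) \<cdot>\<^bsub>B\<^esub> (F2 F a ?bc \<cdot>\<^bsub>B\<^esub> (\<one>\<^bsub>B\<^esub> ?Fa \<otimes>\<^bsub>B\<^esub> F2 F b c)) =
          F2 F ?ab c \<cdot>\<^bsub>B\<^esub> ((F2 F a b \<otimes>\<^bsub>B\<^esub> \<one>\<^bsub>B\<^esub> ?Fc) \<cdot>\<^bsub>B\<^esub> Ass B ?Fa ?Fb ?Fc)"
      using F.F_ass[of a b c] by (simp add: B.assoc)
    have Ga: "FA G (Ass A a b c) \<cdot>\<^bsub>B\<^esub> (F2 G a ?bc \<cdot>\<^bsub>B\<^esub> (\<one>\<^bsub>B\<^esub> ?Ga \<otimes>\<^bsub>B\<^esub> F2 G b c)) =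
          F2 G ?ab c \<cdot>\<^bsub>B\<^esub> ((F2 G a b \<otimes>\<^bsub>B\<^esub> \<one>\<^bsub>B\<^esub> ?Gc) \<cdot>\<^bsub>B\<^esub> Ass B ?Ga ?Gb ?Gc)"
      using G.F_ass[of a b c] by (simp add: B.assoc)
    let ?m1 = "interchange B ?Fa ?Ga (?Fb \<odot>\<^bsub>B\<^esub> ?Fc) (?Gb \<odot>\<^bsub>B\<^esub> ?Gc)"
    let ?m2 = "interchange B (?Fa \<odot>\<^bsub>B\<^esub> ?Fb) (?Ga \<odot>\<^bsub>B\<^esub> ?Gb) ?Fc ?Gc"
    let ?A = "FA F (Ass A a b c) \<otimes>\<^bsub>B\<^esub> FA G (Ass A a b c)"
    have n1: "?m a ?bc \<cdot>\<^bsub>B\<^esub> (\<one>\<^bsub>B\<^esub> (?Fa \<odot>\<^bsub>B\<^esub> ?Ga) \<otimes>\<^bsub>B\<^esub> (F2 F b c \<otimes>\<^bsub>B\<^esub> F2 G b c))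
       = ((\<one>\<^bsub>B\<^esub> ?Fa \<otimes>\<^bsub>B\<^esub> F2 F b c) \<otimes>\<^bsub>B\<^esub> (\<one>\<^bsub>B\<^esub> ?Ga \<otimes>\<^bsub>B\<^esub> F2 G b c)) \<cdot>\<^bsub>B\<^esub> ?m1"
      using B.interchange_natural[of "\<one>\<^bsub>B\<^esub> ?Fa" "\<one>\<^bsub>B\<^esub> ?Ga" "F2 F b c" "F2 G b c"] by simp
    have n2: "((F2 F a b \<otimes>\<^bsub>B\<^esub> \<one>\<^bsub>B\<^esub> ?Fc) \<otimes>\<^bsub>B\<^esub> (F2 G a b \<otimes>\<^bsub>B\<^esub> \<one>\<^bsub>B\<^esub> ?Gc)) \<cdot>\<^bsub>B\<^esub> ?m2
       = ?m ?ab c \<cdot>\<^bsub>B\<^esub> ((F2 F a b \<otimes>\<^bsub>B\<^esub> F2 G a b) \<otimes>\<^bsub>B\<^esub> \<one>\<^bsub>B\<^esub> (?Fc \<odot>\<^bsub>B\<^esub> ?Gc))"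
      using B.interchange_natural[of "F2 F a b" "F2 G a b" "\<one>\<^bsub>B\<^esub> ?Fc" "\<one>\<^bsub>B\<^esub> ?Gc"] by simp
    have "FA ?H (Ass A a b c) \<cdot>\<^bsub>B\<^esub> F2 ?H a ?bc \<cdot>\<^bsub>B\<^esub> (\<one>\<^bsub>B\<^esub> (FO ?H a) \<otimes>\<^bsub>B\<^esub> F2 ?H b c)
       = ?A \<cdot>\<^bsub>B\<^esub> ((F2 F a ?bc \<otimes>\<^bsub>B\<^esub> F2 G a ?bc) \<cdot>\<^bsub>B\<^esub>
           ((?m a ?bc \<cdot>\<^bsub>B\<^esub> (\<one>\<^bsub>B\<^esub> (?Fa \<odot>\<^bsub>B\<^esub> ?Ga) \<otimes>\<^bsub>B\<^esub> (F2 F b c \<otimes>\<^bsub>B\<^esub> F2 G b c)))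
            \<cdot>\<^bsub>B\<^esub> (\<one>\<^bsub>B\<^esub> (?Fa \<odot>\<^bsub>B\<^esub> ?Ga) \<otimes>\<^bsub>B\<^esub> ?m b c)))"
      by (simp add: B.assoc B.ten_left_comp)
    also have "\<dots> = (?A \<cdot>\<^bsub>B\<^esub> (F2 F a ?bc \<otimes>\<^bsub>B\<^esub> F2 G a ?bc)
         \<cdot>\<^bsub>B\<^esub> ((\<one>\<^bsub>B\<^esub> ?Fa \<otimes>\<^bsub>B\<^esub> F2 F b c) \<otimes>\<^bsub>B\<^esub> (\<one>\<^bsub>B\<^esub> ?Ga \<otimes>\<^bsub>B\<^esub> F2 G b c)))
         \<cdot>\<^bsub>B\<^esub> (?m1 \<cdot>\<^bsub>B\<^esub> (\<one>\<^bsub>B\<^esub> (?Fa \<odot>\<^bsub>B\<^esub> ?Ga) \<otimes>\<^bsub>B\<^esub> ?m b c))"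
      unfolding n1 by (simp add: B.assoc)
    also have "\<dots> = (F2 F ?ab c \<otimes>\<^bsub>B\<^esub> F2 G ?ab c)
         \<cdot>\<^bsub>B\<^esub> (((F2 F a b \<otimes>\<^bsub>B\<^esub> \<one>\<^bsub>B\<^esub> ?Fc) \<otimes>\<^bsub>B\<^esub> (F2 G a b \<otimes>\<^bsub>B\<^esub> \<one>\<^bsub>B\<^esub> ?Gc))
         \<cdot>\<^bsub>B\<^esub> ((Ass B ?Fa ?Fb ?Fc \<otimes>\<^bsub>B\<^esub> Ass B ?Ga ?Gb ?Gc)
         \<cdot>\<^bsub>B\<^esub> ?m1 \<cdot>\<^bsub>B\<^esub> (\<one>\<^bsub>B\<^esub> (?Fa \<odot>\<^bsub>B\<^esub> ?Ga) \<otimes>\<^bsub>B\<^esub> ?m b c)))"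
    proof -
      have "?A \<cdot>\<^bsub>B\<^esub> (F2 F a ?bc \<otimes>\<^bsub>B\<^esub> F2 G a ?bc)
         \<cdot>\<^bsub>B\<^esub> ((\<one>\<^bsub>B\<^esub> ?Fa \<otimes>\<^bsub>B\<^esub> F2 F b c) \<otimes>\<^bsub>B\<^esub> (\<one>\<^bsub>B\<^esub> ?Ga \<otimes>\<^bsub>B\<^esub> F2 G b c))
        = (F2 F ?ab c \<otimes>\<^bsub>B\<^esub> F2 G ?ab c)
         \<cdot>\<^bsub>B\<^esub> ((F2 F a b \<otimes>\<^bsub>B\<^esub> \<one>\<^bsub>B\<^esub> ?Fc) \<otimes>\<^bsub>B\<^esub> (F2 G a b \<otimes>\<^bsub>B\<^esub> \<one>\<^bsub>B\<^esub> ?Gc))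
         \<cdot>\<^bsub>B\<^esub> (Ass B ?Fa ?Fb ?Fc \<otimes>\<^bsub>B\<^esub> Ass B ?Ga ?Gb ?Gc)"
        using Fa Ga by (simp add: B.ten_comp' B.assoc)
      then show ?thesis by (simp add: B.assoc)
    qed
    also have "\<dots> = (F2 F ?ab c \<otimes>\<^bsub>B\<^esub> F2 G ?ab c)
         \<cdot>\<^bsub>B\<^esub> ((((F2 F a b \<otimes>\<^bsub>B\<^esub> \<one>\<^bsub>B\<^esub> ?Fc) \<otimes>\<^bsub>B\<^esub> (F2 G a b \<otimes>\<^bsub>B\<^esub> \<one>\<^bsub>B\<^esub> ?Gc)) \<cdot>\<^bsub>B\<^esub> ?m2)
         \<cdot>\<^bsub>B\<^esub> ((?m a b \<otimes>\<^bsub>B\<^esub> \<one>\<^bsub>B\<^esub> (?Fc \<odot>\<^bsub>B\<^esub> ?Gc))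
         \<cdot>\<^bsub>B\<^esub> Ass B (?Fa \<odot>\<^bsub>B\<^esub> ?Ga) (?Fb \<odot>\<^bsub>B\<^esub> ?Gb) (?Fc \<odot>\<^bsub>B\<^esub> ?Gc)))"
      by (subst B.interchange_ass) (simp_all add: B.assoc)
    also have "\<dots> = F2 ?H ?ab c \<cdot>\<^bsub>B\<^esub> (F2 ?H a b \<otimes>\<^bsub>B\<^esub> \<one>\<^bsub>B\<^esub> (FO ?H c))
         \<cdot>\<^bsub>B\<^esub> Ass B (FO ?H a) (FO ?H b) (FO ?H c)"
      unfolding n2 by (simp add: B.assoc B.ten_right_comp)
    finally show "FA ?H (Ass A a b c) \<cdot>\<^bsub>B\<^esub> F2 ?H a ?bc \<cdot>\<^bsub>B\<^esub> (\<one>\<^bsub>B\<^esub> (FO ?H a) \<otimes>\<^bsub>B\<^esub> F2 ?H b c)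
       = F2 ?H ?ab c \<cdot>\<^bsub>B\<^esub> (F2 ?H a b \<otimes>\<^bsub>B\<^esub> \<one>\<^bsub>B\<^esub> (FO ?H c))
         \<cdot>\<^bsub>B\<^esub> Ass B (FO ?H a) (FO ?H b) (FO ?H c)" .
  next
    fix a assume [simp]: "a \<in> Obj A"
    have n: "?m a (Unit A) \<cdot>\<^bsub>B\<^esub> (\<one>\<^bsub>B\<^esub> (FO F a \<odot>\<^bsub>B\<^esub> FO G a) \<otimes>\<^bsub>B\<^esub> (F0 F \<otimes>\<^bsub>B\<^esub> F0 G))
       = ((\<one>\<^bsub>B\<^esub> (FO F a) \<otimes>\<^bsub>B\<^esub> F0 F) \<otimes>\<^bsub>B\<^esub> (\<one>\<^bsub>B\<^esub> (FO G a) \<otimes>\<^bsub>B\<^esub> F0 G))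
         \<cdot>\<^bsub>B\<^esub> interchange B (FO F a) (FO G a) \<I>\<^bsub>B\<^esub> \<I>\<^bsub>B\<^esub>"
      using B.interchange_natural[of "\<one>\<^bsub>B\<^esub> (FO F a)" "\<one>\<^bsub>B\<^esub> (FO G a)" "F0 F" "F0 G"] by simp
    have "FA ?H (\<r>\<^bsub>A\<^esub> a) \<cdot>\<^bsub>B\<^esub> F2 ?H a (Unit A) \<cdot>\<^bsub>B\<^esub> (\<one>\<^bsub>B\<^esub> (FO ?H a) \<otimes>\<^bsub>B\<^esub> F0 ?H)
       = (FA F (\<r>\<^bsub>A\<^esub> a) \<otimes>\<^bsub>B\<^esub> FA G (\<r>\<^bsub>A\<^esub> a)) \<cdot>\<^bsub>B\<^esub> ((F2 F a (Unit A) \<otimes>\<^bsub>B\<^esub> F2 G a (Unit A)) \<cdot>\<^bsub>B\<^esub>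
         ((?m a (Unit A) \<cdot>\<^bsub>B\<^esub> (\<one>\<^bsub>B\<^esub> (FO F a \<odot>\<^bsub>B\<^esub> FO G a) \<otimes>\<^bsub>B\<^esub> (F0 F \<otimes>\<^bsub>B\<^esub> F0 G)))
          \<cdot>\<^bsub>B\<^esub> (\<one>\<^bsub>B\<^esub> (FO F a \<odot>\<^bsub>B\<^esub> FO G a) \<otimes>\<^bsub>B\<^esub> \<r>_inv\<^bsub>B\<^esub> \<I>\<^bsub>B\<^esub>)))"
      by (simp add: B.assoc B.ten_left_comp)
    also have "\<dots> = ((FA F (\<r>\<^bsub>A\<^esub> a) \<cdot>\<^bsub>B\<^esub> F2 F a (Unit A) \<cdot>\<^bsub>B\<^esub> (\<one>\<^bsub>B\<^esub> (FO F a) \<otimes>\<^bsub>B\<^esub> F0 F))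
         \<otimes>\<^bsub>B\<^esub> (FA G (\<r>\<^bsub>A\<^esub> a) \<cdot>\<^bsub>B\<^esub> F2 G a (Unit A) \<cdot>\<^bsub>B\<^esub> (\<one>\<^bsub>B\<^esub> (FO G a) \<otimes>\<^bsub>B\<^esub> F0 G)))
         \<cdot>\<^bsub>B\<^esub> (interchange B (FO F a) (FO G a) \<I>\<^bsub>B\<^esub> \<I>\<^bsub>B\<^esub>
         \<cdot>\<^bsub>B\<^esub> (\<one>\<^bsub>B\<^esub> (FO F a \<odot>\<^bsub>B\<^esub> FO G a) \<otimes>\<^bsub>B\<^esub> \<r>_inv\<^bsub>B\<^esub> \<I>\<^bsub>B\<^esub>))"
      unfolding n by (simp add: B.assoc B.ten_comp'[symmetric])
    also have "\<dots> = \<r>\<^bsub>B\<^esub> (FO ?H a)"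
      unfolding F.F_rho[OF \<open>a \<in> Obj A\<close>] G.F_rho[OF \<open>a \<in> Obj A\<close>]
      using B.interchange_rho[of "FO F a" "FO G a"] by (simp add: B.assoc)
    finally show "FA ?H (\<r>\<^bsub>A\<^esub> a) \<cdot>\<^bsub>B\<^esub> F2 ?H a (Unit A) \<cdot>\<^bsub>B\<^esub> (\<one>\<^bsub>B\<^esub> (FO ?H a) \<otimes>\<^bsub>B\<^esub> F0 ?H)
       = \<r>\<^bsub>B\<^esub> (FO ?H a)" .
    have n: "?m (Unit A) a \<cdot>\<^bsub>B\<^esub> ((F0 F \<otimes>\<^bsub>B\<^esub> F0 G) \<otimes>\<^bsub>B\<^esub> \<one>\<^bsub>B\<^esub> (FO F a \<odot>\<^bsub>B\<^esub> FO G a))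
       = ((F0 F \<otimes>\<^bsub>B\<^esub> \<one>\<^bsub>B\<^esub> (FO F a)) \<otimes>\<^bsub>B\<^esub> (F0 G \<otimes>\<^bsub>B\<^esub> \<one>\<^bsub>B\<^esub> (FO G a)))
         \<cdot>\<^bsub>B\<^esub> interchange B \<I>\<^bsub>B\<^esub> \<I>\<^bsub>B\<^esub> (FO F a) (FO G a)"
      using B.interchange_natural[of "F0 F" "F0 G" "\<one>\<^bsub>B\<^esub> (FO F a)" "\<one>\<^bsub>B\<^esub> (FO G a)"] by simp
    have "FA ?H (\<l>\<^bsub>A\<^esub> a) \<cdot>\<^bsub>B\<^esub> F2 ?H (Unit A) a \<cdot>\<^bsub>B\<^esub> (F0 ?H \<otimes>\<^bsub>B\<^esub> \<one>\<^bsub>B\<^esub> (FO ?H a))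
       = (FA F (\<l>\<^bsub>A\<^esub> a) \<otimes>\<^bsub>B\<^esub> FA G (\<l>\<^bsub>A\<^esub> a)) \<cdot>\<^bsub>B\<^esub> ((F2 F (Unit A) a \<otimes>\<^bsub>B\<^esub> F2 G (Unit A) a) \<cdot>\<^bsub>B\<^esub>
         ((?m (Unit A) a \<cdot>\<^bsub>B\<^esub> ((F0 F \<otimes>\<^bsub>B\<^esub> F0 G) \<otimes>\<^bsub>B\<^esub> \<one>\<^bsub>B\<^esub> (FO F a \<odot>\<^bsub>B\<^esub> FO G a)))
          \<cdot>\<^bsub>B\<^esub> (\<r>_inv\<^bsub>B\<^esub> \<I>\<^bsub>B\<^esub> \<otimes>\<^bsub>B\<^esub> \<one>\<^bsub>B\<^esub> (FO F a \<odot>\<^bsub>B\<^esub> FO G a))))"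
      by (simp add: B.assoc B.ten_right_comp)
    also have "\<dots> = ((FA F (\<l>\<^bsub>A\<^esub> a) \<cdot>\<^bsub>B\<^esub> F2 F (Unit A) a \<cdot>\<^bsub>B\<^esub> (F0 F \<otimes>\<^bsub>B\<^esub> \<one>\<^bsub>B\<^esub> (FO F a)))
         \<otimes>\<^bsub>B\<^esub> (FA G (\<l>\<^bsub>A\<^esub> a) \<cdot>\<^bsub>B\<^esub> F2 G (Unit A) a \<cdot>\<^bsub>B\<^esub> (F0 G \<otimes>\<^bsub>B\<^esub> \<one>\<^bsub>B\<^esub> (FO G a))))
         \<cdot>\<^bsub>B\<^esub> (interchange B \<I>\<^bsub>B\<^esub> \<I>\<^bsub>B\<^esub> (FO F a) (FO G a)
         \<cdot>\<^bsub>B\<^esub> (\<r>_inv\<^bsub>B\<^esub> \<I>\<^bsub>B\<^esub> \<otimes>\<^bsub>B\<^esub> \<one>\<^bsub>B\<^esub> (FO F a \<odot>\<^bsub>B\<^esub> FO G a)))"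
      unfolding n by (simp add: B.assoc B.ten_comp'[symmetric])
    also have "\<dots> = \<l>\<^bsub>B\<^esub> (FO ?H a)"
      unfolding F.F_lam[OF \<open>a \<in> Obj A\<close>] G.F_lam[OF \<open>a \<in> Obj A\<close>]
      using B.interchange_lam[of "FO F a" "FO G a"] by (simp add: B.assoc)
    finally show "FA ?H (\<l>\<^bsub>A\<^esub> a) \<cdot>\<^bsub>B\<^esub> F2 ?H (Unit A) a \<cdot>\<^bsub>B\<^esub> (F0 ?H \<otimes>\<^bsub>B\<^esub> \<one>\<^bsub>B\<^esub> (FO ?H a))
       = \<l>\<^bsub>B\<^esub> (FO ?H a)" .
  next
    fix a b assume [simp]: "a \<in> Obj A" "b \<in> Obj A"
    have "FA ?H (\<s>\<^bsub>A\<^esub> a b) \<cdot>\<^bsub>B\<^esub> F2 ?H a b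
       = ((FA F (\<s>\<^bsub>A\<^esub> a b) \<cdot>\<^bsub>B\<^esub> F2 F a b) \<otimes>\<^bsub>B\<^esub> (FA G (\<s>\<^bsub>A\<^esub> a b) \<cdot>\<^bsub>B\<^esub> F2 G a b)) \<cdot>\<^bsub>B\<^esub> ?m a b"
      by (simp add: B.assoc B.ten_comp'[symmetric])
    also have "\<dots> = (F2 F b a \<otimes>\<^bsub>B\<^esub> F2 G b a) \<cdot>\<^bsub>B\<^esub>
        ((\<s>\<^bsub>B\<^esub> (FO F a) (FO F b) \<otimes>\<^bsub>B\<^esub> \<s>\<^bsub>B\<^esub> (FO G a) (FO G b)) \<cdot>\<^bsub>B\<^esub> ?m a b)"
      unfolding F.F_sym[OF \<open>a \<in> Obj A\<close> \<open>b \<in> Obj A\<close>] G.F_sym[OF \<open>a \<in> Obj A\<close> \<open>b \<in> Obj A\<close>]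
      by (simp add: B.assoc B.ten_comp'[symmetric])
    also have "\<dots> = F2 ?H b a \<cdot>\<^bsub>B\<^esub> \<s>\<^bsub>B\<^esub> (FO ?H a) (FO ?H b)"
      by (subst B.interchange_sym) (simp_all add: B.assoc)
    finally show "FA ?H (\<s>\<^bsub>A\<^esub> a b) \<cdot>\<^bsub>B\<^esub> F2 ?H a b = F2 ?H b a \<cdot>\<^bsub>B\<^esub> \<s>\<^bsub>B\<^esub> (FO ?H a) (FO ?H b)" .
  qed (auto intro!: B.homI simp: F.FA_ide G.FA_ide)
  then show ?thesis by (simp add: SMC_def)
qed

section \<open>Presented symmetric monoidal categories\<close>

lemma term_cat_simps [simp]:
  "Obj (term_cat \<Sigma>) = {X. wf_word \<Sigma> X}" "Arr (term_cat \<Sigma>) = {t. wf_term \<Sigma> t}"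
  "Src (term_cat \<Sigma>) = fsrc \<Sigma>" "Tgt (term_cat \<Sigma>) = ftgt \<Sigma>"
  "Ide (term_cat \<Sigma>) = FIde" "Comp (term_cat \<Sigma>) = FComp"
  "Unit (term_cat \<Sigma>) = WUnit" "TenO (term_cat \<Sigma>) = WTen"
  "TenA (term_cat \<Sigma>) p q = FComp (FRight p (ftgt \<Sigma> q)) (FLeft (fsrc \<Sigma> p) q)"
  "Ass (term_cat \<Sigma>) = FAss" "AssInv (term_cat \<Sigma>) = FAssInv"
  "Rho (term_cat \<Sigma>) = FRho" "RhoInv (term_cat \<Sigma>) = FRhoInv"
  "Lam (term_cat \<Sigma>) = FLam" "LamInv (term_cat \<Sigma>) = FLamInv" "Sym (term_cat \<Sigma>) = FSym"
  by (simp_all add: term_cat_def)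

lemma interchange_term_cat [simp]:
  "wf_term \<Sigma> (interchange (term_cat \<Sigma>) W X Y Z) \<longleftrightarrow>
     wf_word \<Sigma> W \<and> wf_word \<Sigma> X \<and> wf_word \<Sigma> Y \<and> wf_word \<Sigma> Z"
  "fsrc \<Sigma> (interchange (term_cat \<Sigma>) W X Y Z) = WTen (WTen W X) (WTen Y Z)"
  "ftgt \<Sigma> (interchange (term_cat \<Sigma>) W X Y Z) = WTen (WTen W Y) (WTen X Z)"
  by (auto simp: interchange_def)

lemma UN_UN_constant:
  assumes "a \<in> A" "b \<in> B" "\<And>x y. \<lbrakk>x \<in> A; y \<in> B\<rbrakk> \<Longrightarrow> h x y = c"
  shows "(\<Union>x\<in>A. \<Union>y\<in>B. h x y) = c"
proof -
  have "(\<Union>y\<in>B. h x y) = c" if "x \<in> A" for x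
    using assms(2,3) that by (intro UN_constant_eq) auto
  then show ?thesis using assms(1) by (intro UN_constant_eq) auto
qed

lemma smc_law_parallel:
  "\<lbrakk>smc_law \<Sigma> t u; wf_term \<Sigma> t; wf_term \<Sigma> u\<rbrakk> \<Longrightarrow> fsrc \<Sigma> t = fsrc \<Sigma> u \<and> ftgt \<Sigma> t = ftgt \<Sigma> u"
  by (erule smc_law.cases) auto

text \<open>
Congruent terms should have the same source and target. For the relations \<open>R\<close> this is a requirement;
it then extends to the generated congruence.
\<close>

locale presentation =
  fixes \<Sigma> :: "('g, 'e) signature" and R :: "('g, 'e) fterm \<Rightarrow> ('g, 'e) fterm \<Rightarrow> bool"
  assumes gen_src: "e \<in> GArr \<Sigma> \<Longrightarrow> wf_word \<Sigma> (GSrc \<Sigma> e)"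
    and gen_tgt: "e \<in> GArr \<Sigma> \<Longrightarrow> wf_word \<Sigma> (GTgt \<Sigma> e)"
    and rel_parallel: "\<lbrakk>R t u; wf_term \<Sigma> t; wf_term \<Sigma> u\<rbrakk> \<Longrightarrow>
      fsrc \<Sigma> t = fsrc \<Sigma> u \<and> ftgt \<Sigma> t = ftgt \<Sigma> u"
begin

abbreviation "P \<equiv> presented \<Sigma> R"
abbreviation "cl \<equiv> fclass \<Sigma> R"

lemma wf_boundary: "wf_term \<Sigma> t \<Longrightarrow> wf_word \<Sigma> (fsrc \<Sigma> t) \<and> wf_word \<Sigma> (ftgt \<Sigma> t)"
  by (induction t) (auto simp: gen_src gen_tgt)

lemmas wf_boundary' [simp] = wf_boundary[THEN conjunct1] wf_boundary[THEN conjunct2]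

lemma fcong_parallel:
  "fcong \<Sigma> R t u \<Longrightarrow> wf_term \<Sigma> t \<and> wf_term \<Sigma> u \<and> fsrc \<Sigma> t = fsrc \<Sigma> u \<and> ftgt \<Sigma> t = ftgt \<Sigma> u"
  by (induction rule: fcong.induct) (auto dest: smc_law_parallel rel_parallel)

lemma cl_eq: "fcong \<Sigma> R t u \<Longrightarrow> cl t = cl u"
  unfolding fclass_def using fcong.sym fcong.trans by blast

lemma cl_eqD: "\<lbrakk>cl t = cl u; wf_term \<Sigma> u\<rbrakk> \<Longrightarrow> fcong \<Sigma> R t u"
  unfolding fclass_def using fcong.refl by blast

lemma cl_law: "\<lbrakk>smc_law \<Sigma> t u; wf_term \<Sigma> t; wf_term \<Sigma> u\<rbrakk> \<Longrightarrow> cl t = cl u"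
  by (intro cl_eq fcong.law)

lemma cl_rel: "\<lbrakk>R t u; wf_term \<Sigma> t; wf_term \<Sigma> u\<rbrakk> \<Longrightarrow> cl t = cl u"
  by (intro cl_eq fcong.rel)

lemma image_cl:
  assumes "wf_term \<Sigma> t" "\<And>u. fcong \<Sigma> R t u \<Longrightarrow> h u = h t"
  shows "h ` cl t = {h t}"
proof (rule set_eqI)
  have "fcong \<Sigma> R t t" using assms(1) by (rule fcong.refl)
  then show "x \<in> h ` cl t \<longleftrightarrow> x \<in> {h t}" for x
    unfolding fclass_def image_def using assms(2) by blast
qed

lemma P_simps [simp]:
  "Obj P = {X. wf_word \<Sigma> X}" "Unit P = WUnit" "TenO P = WTen"
  "Ide P X = cl (FIde X)" "Ass P X Y Z = cl (FAss X Y Z)" "AssInv P X Y Z = cl (FAssInv X Y Z)"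
  "Rho P X = cl (FRho X)" "RhoInv P X = cl (FRhoInv X)"
  "Lam P X = cl (FLam X)" "LamInv P X = cl (FLamInv X)" "Sym P X Y = cl (FSym X Y)"
  by (simp_all add: presented_def Let_def)

lemma P_Arr: "Arr P = cl ` {t. wf_term \<Sigma> t}"
  by (simp add: presented_def Let_def)

lemma P_arr [simp]:
  assumes "wf_term \<Sigma> t"
  shows "cl t \<in> Arr P" "Src P (cl t) = fsrc \<Sigma> t" "Tgt P (cl t) = ftgt \<Sigma> t"
proof -
  have "fsrc \<Sigma> ` cl t = {fsrc \<Sigma> t}" "ftgt \<Sigma> ` cl t = {ftgt \<Sigma> t}"
    by (rule image_cl[OF assms], simp add: fcong_parallel)+
  then show "cl t \<in> Arr P" "Src P (cl t) = fsrc \<Sigma> t" "Tgt P (cl t) = ftgt \<Sigma> t"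
    using assms by (auto simp: presented_def Let_def)
qed

lemma P_homI [intro!]: "\<lbrakk>wf_term \<Sigma> t; fsrc \<Sigma> t = X; ftgt \<Sigma> t = Y\<rbrakk> \<Longrightarrow> cl t \<in> hom P X Y"
  by (simp add: hom_def)

lemma P_homE [elim!]:
  assumes "p \<in> hom P X Y"
  obtains t where "wf_term \<Sigma> t" "fsrc \<Sigma> t = X" "ftgt \<Sigma> t = Y" "p = cl t"
  using assms by (auto simp: hom_def P_Arr)

lemma in_cl: "u \<in> cl t \<longleftrightarrow> fcong \<Sigma> R t u"
  by (simp add: fclass_def)

lemma P_comp [simp]:
  assumes "wf_term \<Sigma> u" "wf_term \<Sigma> t" "fsrc \<Sigma> u = ftgt \<Sigma> t"
  shows "cl u \<cdot>\<^bsub>P\<^esub> cl t = cl (FComp u t)"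
proof -
  have eq: "cl (FComp u' t') = cl (FComp u t)" if "u' \<in> cl u" "t' \<in> cl t" for u' t'
    using that assms(3) unfolding in_cl by (intro cl_eq[THEN HOL.sym] fcong.comp)
  have "u \<in> cl u" "t \<in> cl t"
    using assms by (auto simp: in_cl intro: fcong.refl)
  then have "(\<Union>u'\<in>cl u. \<Union>t'\<in>cl t. cl (FComp u' t')) = cl (FComp u t)"
    by (rule UN_UN_constant) (rule eq)
  then show ?thesis by (simp add: presented_def Let_def)
qed

lemma P_ten [simp]:
  assumes "wf_term \<Sigma> t" "wf_term \<Sigma> u"
  shows "cl t \<otimes>\<^bsub>P\<^esub> cl u = cl (FComp (FRight t (ftgt \<Sigma> u)) (FLeft (fsrc \<Sigma> t) u))"
proof -
  have eq: "cl (FComp (FRight t' (ftgt \<Sigma> u')) (FLeft (fsrc \<Sigma> t') u'))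
      = cl (FComp (FRight t (ftgt \<Sigma> u)) (FLeft (fsrc \<Sigma> t) u))"
    if "t' \<in> cl t" "u' \<in> cl u" for t' u'
  proof (rule cl_eq[THEN HOL.sym])
    have tu: "fcong \<Sigma> R t t'" "fcong \<Sigma> R u u'" using that by (simp_all add: in_cl)
    have "fcong \<Sigma> R (FRight t (ftgt \<Sigma> u)) (FRight t' (ftgt \<Sigma> u))"
      "fcong \<Sigma> R (FLeft (fsrc \<Sigma> t) u) (FLeft (fsrc \<Sigma> t) u')"
      using tu assms by (auto intro: fcong.right fcong.left)
    from fcong.comp[OF this(2,1)]
    show "fcong \<Sigma> R (FComp (FRight t (ftgt \<Sigma> u)) (FLeft (fsrc \<Sigma> t) u))
        (FComp (FRight t' (ftgt \<Sigma> u')) (FLeft (fsrc \<Sigma> t') u'))"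
      using tu[THEN fcong_parallel] by simp
  qed
  have "t \<in> cl t" "u \<in> cl u"
    using assms by (auto simp: in_cl intro: fcong.refl)
  then have "(\<Union>t'\<in>cl t. \<Union>u'\<in>cl u. cl (FComp (FRight t' (ftgt \<Sigma> u')) (FLeft (fsrc \<Sigma> t') u')))
      = cl (FComp (FRight t (ftgt \<Sigma> u)) (FLeft (fsrc \<Sigma> t) u))"
    by (rule UN_UN_constant) (rule eq)
  then show ?thesis by (simp add: presented_def Let_def)
qed

lemma cl_comp_cong: "\<lbrakk>cl u = cl u'; cl t = cl t'; wf_term \<Sigma> u'; wf_term \<Sigma> t'; fsrc \<Sigma> u' = ftgt \<Sigma> t'\<rbrakk> \<Longrightarrow>
    cl (FComp u t) = cl (FComp u' t')"
  using fcong.comp[of \<Sigma> R t' t u' u] cl_eq cl_eqD fcong.sym by metis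

lemma cl_assoc: "\<lbrakk>wf_term \<Sigma> v; wf_term \<Sigma> u; wf_term \<Sigma> t; fsrc \<Sigma> v = ftgt \<Sigma> u; fsrc \<Sigma> u = ftgt \<Sigma> t\<rbrakk> \<Longrightarrow>
    cl (FComp (FComp v u) t) = cl (FComp v (FComp u t))"
  using cl_law[OF smc_law.intros(3)[of \<Sigma> v u t]] by simp

lemma cl_ide:
  "wf_term \<Sigma> t \<Longrightarrow> fsrc \<Sigma> t = X \<Longrightarrow> cl (FComp t (FIde X)) = cl t"
  "wf_term \<Sigma> t \<Longrightarrow> ftgt \<Sigma> t = X \<Longrightarrow> cl (FComp (FIde X) t) = cl t"
  using cl_law[OF smc_law.intros(1)[of \<Sigma> t X]] cl_law[OF smc_law.intros(2)[of \<Sigma> X t]] by auto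

lemma cl_whisker_ide:
  "\<lbrakk>wf_word \<Sigma> X; wf_word \<Sigma> Y\<rbrakk> \<Longrightarrow> cl (FLeft X (FIde Y)) = cl (FIde (WTen X Y))"
  "\<lbrakk>wf_word \<Sigma> X; wf_word \<Sigma> Y\<rbrakk> \<Longrightarrow> cl (FRight (FIde X) Y) = cl (FIde (WTen X Y))"
  using cl_law[OF smc_law.intros(4)[of \<Sigma> X Y]] cl_law[OF smc_law.intros(5)[of \<Sigma> X Y]] by auto

text \<open>
Tensoring with an identity is whiskering. The axioms of a symmetric monoidal category use identities
where the generating laws use whiskered terms; these equations translate between the two.
\<close>

lemma cl_ten_ide:
  "\<lbrakk>wf_term \<Sigma> t; wf_word \<Sigma> Y\<rbrakk> \<Longrightarrow> cl t \<otimes>\<^bsub>P\<^esub> cl (FIde Y) = cl (FRight t Y)"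
  "\<lbrakk>wf_term \<Sigma> t; wf_word \<Sigma> X\<rbrakk> \<Longrightarrow> cl (FIde X) \<otimes>\<^bsub>P\<^esub> cl t = cl (FLeft X t)"
proof -
  assume t: "wf_term \<Sigma> t" "wf_word \<Sigma> Y"
  have "cl (FComp (FRight t Y) (FLeft (fsrc \<Sigma> t) (FIde Y)))
      = cl (FComp (FRight t Y) (FIde (WTen (fsrc \<Sigma> t) Y)))"
    using t by (intro cl_comp_cong cl_whisker_ide) auto
  then show "cl t \<otimes>\<^bsub>P\<^esub> cl (FIde Y) = cl (FRight t Y)"
    using t by (simp add: cl_ide)
next
  assume t: "wf_term \<Sigma> t" "wf_word \<Sigma> X"
  have "cl (FComp (FRight (FIde X) (ftgt \<Sigma> t)) (FLeft X t))
      = cl (FComp (FIde (WTen X (ftgt \<Sigma> t))) (FLeft X t))"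
    using t by (intro cl_comp_cong cl_whisker_ide) auto
  then show "cl (FIde X) \<otimes>\<^bsub>P\<^esub> cl t = cl (FLeft X t)"
    using t by (simp add: cl_ide)
qed

text \<open>
Functoriality of whiskering, and the exchange law for the two middle whiskered arrows.
\<close>

lemma cl_ten_comp:
  assumes wf: "wf_term \<Sigma> f" "wf_term \<Sigma> f'" "wf_term \<Sigma> g" "wf_term \<Sigma> g'"
    and c: "fsrc \<Sigma> f' = ftgt \<Sigma> f" "fsrc \<Sigma> g' = ftgt \<Sigma> g"
  shows "cl (FComp f' f) \<otimes>\<^bsub>P\<^esub> cl (FComp g' g) = (cl f' \<otimes>\<^bsub>P\<^esub> cl g') \<cdot>\<^bsub>P\<^esub> (cl f \<otimes>\<^bsub>P\<^esub> cl g)"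
proof -
  let ?a = "fsrc \<Sigma> f" and ?b = "ftgt \<Sigma> f" and ?e = "ftgt \<Sigma> g" and ?k = "ftgt \<Sigma> g'"
  let ?F = "FRight f ?k" and ?F' = "FRight f' ?k" and ?G = "FLeft ?a g" and ?G' = "FLeft ?a g'"
  have "cl (FComp f' f) \<otimes>\<^bsub>P\<^esub> cl (FComp g' g) = cl (FComp (FRight (FComp f' f) ?k) (FLeft ?a (FComp g' g)))"
    using wf c by simp
  also have "\<dots> = cl (FComp (FComp ?F' ?F) (FComp ?G' ?G))"
    using wf c cl_law[OF smc_law.intros(6)[of \<Sigma> ?a g' g]] cl_law[OF smc_law.intros(7)[of \<Sigma> f' f ?k]]
    by (intro cl_comp_cong) auto
  also have "\<dots> = cl (FComp ?F' (FComp ?F (FComp ?G' ?G)))"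
    using wf c by (intro cl_assoc) auto
  also have "\<dots> = cl (FComp ?F' (FComp (FComp ?F ?G') ?G))"
    using wf c by (intro cl_comp_cong[OF HOL.refl] cl_assoc[symmetric]) auto
  also have "\<dots> = cl (FComp ?F' (FComp (FComp (FLeft ?b g') (FRight f ?e)) ?G))"
    using wf c cl_law[OF smc_law.intros(8)[of \<Sigma> f g']]
    by (intro cl_comp_cong[OF HOL.refl] cl_comp_cong[OF _ HOL.refl]) auto
  also have "\<dots> = cl (FComp ?F' (FComp (FLeft ?b g') (FComp (FRight f ?e) ?G)))"
    using wf c by (intro cl_comp_cong[OF HOL.refl] cl_assoc) auto
  also have "\<dots> = cl (FComp (FComp ?F' (FLeft ?b g')) (FComp (FRight f ?e) ?G))"
    using wf c by (intro cl_assoc[symmetric]) auto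
  finally show ?thesis using wf c by simp
qed

lemma cl_natural:
  assumes [simp]: "wf_term \<Sigma> p"
  shows "cl (FComp (FRho (ftgt \<Sigma> p)) (FRight p WUnit)) = cl (FComp p (FRho (fsrc \<Sigma> p)))"
    "cl (FComp (FLam (ftgt \<Sigma> p)) (FLeft WUnit p)) = cl (FComp p (FLam (fsrc \<Sigma> p)))"
  using cl_law[OF smc_law.intros(14)[of \<Sigma> p]] cl_law[OF smc_law.intros(17)[of \<Sigma> p]] by auto

text \<open>
Arrows are represented by well-formed terms, and each axiom becomes an instance of a law between
representatives. The numbered introduction rules of \<open>smc_law\<close> are these laws in the order of their
declaration.
\<close>

theorem presented_smc: "symmetric_monoidal_category P"
proof
  fix f assume "f \<in> Arr P"
  then show "Src P f \<in> Obj P" "Tgt P f \<in> Obj P" by (auto simp: P_Arr)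
next
  fix a assume "a \<in> Obj P"
  then show "\<one>\<^bsub>P\<^esub> a \<in> hom P a a" by auto
next
  fix f g a b c assume "f \<in> hom P a b" "g \<in> hom P b c"
  then show "g \<cdot>\<^bsub>P\<^esub> f \<in> hom P a c" by auto
next
  fix f a b assume "f \<in> hom P a b"
  then show "f \<cdot>\<^bsub>P\<^esub> \<one>\<^bsub>P\<^esub> a = f" "\<one>\<^bsub>P\<^esub> b \<cdot>\<^bsub>P\<^esub> f = f" by (auto simp: cl_ide)
next
  fix f g h a b c d assume "f \<in> hom P a b" "g \<in> hom P b c" "h \<in> hom P c d"
  then show "h \<cdot>\<^bsub>P\<^esub> (g \<cdot>\<^bsub>P\<^esub> f) = h \<cdot>\<^bsub>P\<^esub> g \<cdot>\<^bsub>P\<^esub> f" by (auto simp: cl_assoc)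
next
  show "\<I>\<^bsub>P\<^esub> \<in> Obj P" by simp
next
  fix a b assume "a \<in> Obj P" "b \<in> Obj P"
  then show "a \<odot>\<^bsub>P\<^esub> b \<in> Obj P" "\<one>\<^bsub>P\<^esub> a \<otimes>\<^bsub>P\<^esub> \<one>\<^bsub>P\<^esub> b = \<one>\<^bsub>P\<^esub> (a \<odot>\<^bsub>P\<^esub> b)"
    "\<s>\<^bsub>P\<^esub> a b \<in> hom P (a \<odot>\<^bsub>P\<^esub> b) (b \<odot>\<^bsub>P\<^esub> a)"
    "\<s>\<^bsub>P\<^esub> b a \<cdot>\<^bsub>P\<^esub> \<s>\<^bsub>P\<^esub> a b = \<one>\<^bsub>P\<^esub> (a \<odot>\<^bsub>P\<^esub> b)"
    "(\<r>\<^bsub>P\<^esub> a \<otimes>\<^bsub>P\<^esub> \<one>\<^bsub>P\<^esub> b) \<cdot>\<^bsub>P\<^esub> ass\<^bsub>P\<^esub> a \<I>\<^bsub>P\<^esub> b = \<one>\<^bsub>P\<^esub> a \<otimes>\<^bsub>P\<^esub> \<l>\<^bsub>P\<^esub> b"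
    using cl_law[OF smc_law.intros(18)[of \<Sigma> b a]] cl_law[OF smc_law.intros(21)[of \<Sigma> a b]]
    by (auto simp: cl_ten_ide cl_whisker_ide simp del: P_ten)
next
  fix f g a b c d assume "f \<in> hom P a b" "g \<in> hom P c d"
  then show "f \<otimes>\<^bsub>P\<^esub> g \<in> hom P (a \<odot>\<^bsub>P\<^esub> c) (b \<odot>\<^bsub>P\<^esub> d)"
    by auto
next
  fix f f' g g' a b c d e k
  assume "f \<in> hom P a b" "f' \<in> hom P b c" "g \<in> hom P d e" "g' \<in> hom P e k"
  then show "(f' \<cdot>\<^bsub>P\<^esub> f) \<otimes>\<^bsub>P\<^esub> (g' \<cdot>\<^bsub>P\<^esub> g) = (f' \<otimes>\<^bsub>P\<^esub> g') \<cdot>\<^bsub>P\<^esub> (f \<otimes>\<^bsub>P\<^esub> g)"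
    by (auto simp: cl_ten_comp simp del: P_ten)
next
  fix a b c assume "a \<in> Obj P" "b \<in> Obj P" "c \<in> Obj P"
  then have [simp]: "wf_word \<Sigma> a" "wf_word \<Sigma> b" "wf_word \<Sigma> c" by auto
  show "ass\<^bsub>P\<^esub> a b c \<in> hom P (a \<odot>\<^bsub>P\<^esub> (b \<odot>\<^bsub>P\<^esub> c)) (a \<odot>\<^bsub>P\<^esub> b \<odot>\<^bsub>P\<^esub> c)"
    by auto
  show "ass_inv\<^bsub>P\<^esub> a b c \<in> hom P (a \<odot>\<^bsub>P\<^esub> b \<odot>\<^bsub>P\<^esub> c) (a \<odot>\<^bsub>P\<^esub> (b \<odot>\<^bsub>P\<^esub> c))"
    by auto
  show "ass_inv\<^bsub>P\<^esub> a b c \<cdot>\<^bsub>P\<^esub> ass\<^bsub>P\<^esub> a b c = \<one>\<^bsub>P\<^esub> (a \<odot>\<^bsub>P\<^esub> (b \<odot>\<^bsub>P\<^esub> c))"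
    "ass\<^bsub>P\<^esub> a b c \<cdot>\<^bsub>P\<^esub> ass_inv\<^bsub>P\<^esub> a b c = \<one>\<^bsub>P\<^esub> (a \<odot>\<^bsub>P\<^esub> b \<odot>\<^bsub>P\<^esub> c)"
    using cl_law[OF smc_law.intros(9)[of \<Sigma> a b c]] cl_law[OF smc_law.intros(10)[of \<Sigma> a b c]] by auto
  show "ass\<^bsub>P\<^esub> c a b \<cdot>\<^bsub>P\<^esub> \<s>\<^bsub>P\<^esub> (a \<odot>\<^bsub>P\<^esub> b) c \<cdot>\<^bsub>P\<^esub> ass\<^bsub>P\<^esub> a b c
      = (\<s>\<^bsub>P\<^esub> a c \<otimes>\<^bsub>P\<^esub> \<one>\<^bsub>P\<^esub> b) \<cdot>\<^bsub>P\<^esub> ass\<^bsub>P\<^esub> a c b \<cdot>\<^bsub>P\<^esub> (\<one>\<^bsub>P\<^esub> a \<otimes>\<^bsub>P\<^esub> \<s>\<^bsub>P\<^esub> b c)"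
    using cl_law[OF smc_law.intros(22)[of \<Sigma> c a b]] by (simp add: cl_ten_ide del: P_ten)
next
  fix f g h a b c a' b' c' assume "f \<in> hom P a a'" "g \<in> hom P b b'" "h \<in> hom P c c'"
  then obtain p q t where [simp]: "wf_term \<Sigma> p" "wf_term \<Sigma> q" "wf_term \<Sigma> t"
    and e: "f = cl p" "g = cl q" "h = cl t" "a = fsrc \<Sigma> p" "b = fsrc \<Sigma> q" "c = fsrc \<Sigma> t"
    "a' = ftgt \<Sigma> p" "b' = ftgt \<Sigma> q" "c' = ftgt \<Sigma> t"
    by auto
  show "ass\<^bsub>P\<^esub> a' b' c' \<cdot>\<^bsub>P\<^esub> (f \<otimes>\<^bsub>P\<^esub> (g \<otimes>\<^bsub>P\<^esub> h)) = (f \<otimes>\<^bsub>P\<^esub> g \<otimes>\<^bsub>P\<^esub> h) \<cdot>\<^bsub>P\<^esub> ass\<^bsub>P\<^esub> a b c"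
    unfolding e using cl_law[OF smc_law.intros(11)[of \<Sigma> p q t]] by simp
next
  fix a assume "a \<in> Obj P"
  then have [simp]: "wf_word \<Sigma> a" by simp
  show "\<r>\<^bsub>P\<^esub> a \<in> hom P (a \<odot>\<^bsub>P\<^esub> \<I>\<^bsub>P\<^esub>) a" by auto
  show "\<r>_inv\<^bsub>P\<^esub> a \<in> hom P a (a \<odot>\<^bsub>P\<^esub> \<I>\<^bsub>P\<^esub>)" by auto
  show "\<l>\<^bsub>P\<^esub> a \<in> hom P (\<I>\<^bsub>P\<^esub> \<odot>\<^bsub>P\<^esub> a) a" by auto
  show "\<l>_inv\<^bsub>P\<^esub> a \<in> hom P a (\<I>\<^bsub>P\<^esub> \<odot>\<^bsub>P\<^esub> a)" by auto
  show "\<r>_inv\<^bsub>P\<^esub> a \<cdot>\<^bsub>P\<^esub> \<r>\<^bsub>P\<^esub> a = \<one>\<^bsub>P\<^esub> (a \<odot>\<^bsub>P\<^esub> \<I>\<^bsub>P\<^esub>)" "\<r>\<^bsub>P\<^esub> a \<cdot>\<^bsub>P\<^esub> \<r>_inv\<^bsub>P\<^esub> a = \<one>\<^bsub>P\<^esub> a"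
    "\<l>_inv\<^bsub>P\<^esub> a \<cdot>\<^bsub>P\<^esub> \<l>\<^bsub>P\<^esub> a = \<one>\<^bsub>P\<^esub> (\<I>\<^bsub>P\<^esub> \<odot>\<^bsub>P\<^esub> a)" "\<l>\<^bsub>P\<^esub> a \<cdot>\<^bsub>P\<^esub> \<l>_inv\<^bsub>P\<^esub> a = \<one>\<^bsub>P\<^esub> a"
    "\<l>\<^bsub>P\<^esub> a \<cdot>\<^bsub>P\<^esub> \<s>\<^bsub>P\<^esub> a \<I>\<^bsub>P\<^esub> = \<r>\<^bsub>P\<^esub> a"
    using cl_law[OF smc_law.intros(12)[of \<Sigma> a]] cl_law[OF smc_law.intros(13)[of \<Sigma> a]]
      cl_law[OF smc_law.intros(15)[of \<Sigma> a]] cl_law[OF smc_law.intros(16)[of \<Sigma> a]]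
      cl_law[OF smc_law.intros(23)[of \<Sigma> a]]
    by simp_all
next
  fix f a a' assume "f \<in> hom P a a'"
  then show "\<r>\<^bsub>P\<^esub> a' \<cdot>\<^bsub>P\<^esub> (f \<otimes>\<^bsub>P\<^esub> \<one>\<^bsub>P\<^esub> \<I>\<^bsub>P\<^esub>) = f \<cdot>\<^bsub>P\<^esub> \<r>\<^bsub>P\<^esub> a"
    "\<l>\<^bsub>P\<^esub> a' \<cdot>\<^bsub>P\<^esub> (\<one>\<^bsub>P\<^esub> \<I>\<^bsub>P\<^esub> \<otimes>\<^bsub>P\<^esub> f) = f \<cdot>\<^bsub>P\<^esub> \<l>\<^bsub>P\<^esub> a"
    by (auto simp: cl_ten_ide cl_natural simp del: P_ten)
next
  fix f g a b a' b' assume "f \<in> hom P a a'" "g \<in> hom P b b'"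
  then obtain p q where [simp]: "wf_term \<Sigma> p" "wf_term \<Sigma> q"
    and e: "f = cl p" "g = cl q" "a = fsrc \<Sigma> p" "b = fsrc \<Sigma> q" "a' = ftgt \<Sigma> p" "b' = ftgt \<Sigma> q"
    by auto
  show "\<s>\<^bsub>P\<^esub> a' b' \<cdot>\<^bsub>P\<^esub> (f \<otimes>\<^bsub>P\<^esub> g) = (g \<otimes>\<^bsub>P\<^esub> f) \<cdot>\<^bsub>P\<^esub> \<s>\<^bsub>P\<^esub> a b"
    unfolding e using cl_law[OF smc_law.intros(19)[of \<Sigma> p q]] by simp
next
  fix a b c d assume "a \<in> Obj P" "b \<in> Obj P" "c \<in> Obj P" "d \<in> Obj P"
  then show "ass\<^bsub>P\<^esub> (a \<odot>\<^bsub>P\<^esub> b) c d \<cdot>\<^bsub>P\<^esub> ass\<^bsub>P\<^esub> a b (c \<odot>\<^bsub>P\<^esub> d)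
      = (ass\<^bsub>P\<^esub> a b c \<otimes>\<^bsub>P\<^esub> \<one>\<^bsub>P\<^esub> d) \<cdot>\<^bsub>P\<^esub> ass\<^bsub>P\<^esub> a (b \<odot>\<^bsub>P\<^esub> c) d \<cdot>\<^bsub>P\<^esub> (\<one>\<^bsub>P\<^esub> a \<otimes>\<^bsub>P\<^esub> ass\<^bsub>P\<^esub> b c d)"
    using cl_law[OF smc_law.intros(20)[of \<Sigma> a b c d]] by (simp add: cl_ten_ide del: P_ten)
qed

text \<open>
The generators of a presented category are an assignment in that category, and evaluating a term
there yields its class. So relations between terms turn into equations between evaluations, in the
generic case as in any other.
\<close>

lemma class_assignment: "generator_assignment P \<Sigma> WGen (\<lambda>e. cl (FGen e))"
proof -
  interpret P: symmetric_monoidal_category P by (rule presented_smc)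
  have w: "word_eval P WGen X = X" for X by (induction X) auto
  show ?thesis by unfold_locales (auto simp: hom_def w)
qed

lemma eval_class: "wf_term \<Sigma> t \<Longrightarrow> term_eval P WGen (\<lambda>e. cl (FGen e)) t = cl t"
proof -
  have w: "word_eval P WGen X = X" for X by (induction X) auto
  show "wf_term \<Sigma> t \<Longrightarrow> ?thesis"
    by (induction t) (auto simp: w cl_ten_ide simp del: P_ten)
qed

end

section \<open>Models\<close>

locale evaluation = presentation \<Sigma> R + generator_assignment C \<Sigma> \<phi> \<psi>
  for \<Sigma> :: "('g, 'e) signature" and R and C :: "('o, 'm) smcat" (structure) and \<phi> \<psi>
begin

lemma eval_interchange: "\<lbrakk>wf_word \<Sigma> W; wf_word \<Sigma> X; wf_word \<Sigma> Y; wf_word \<Sigma> Z\<rbrakk> \<Longrightarrow>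
    term_eval C \<phi> \<psi> (interchange (term_cat \<Sigma>) W X Y Z)
    = interchange C (word_eval C \<phi> W) (word_eval C \<phi> X) (word_eval C \<phi> Y) (word_eval C \<phi> Z)"
  by (simp add: interchange_def ten_comp')

text \<open>
Every law holds in \<open>C\<close> by the axiom it expresses. The cases treated separately are the naturality laws,
which quantify over terms.
\<close>

lemma smc_law_sound:
  "\<lbrakk>smc_law \<Sigma> t u; wf_term \<Sigma> t; wf_term \<Sigma> u\<rbrakk> \<Longrightarrow> term_eval C \<phi> \<psi> t = term_eval C \<phi> \<psi> u"
proof (erule smc_law.cases, goal_cases)
  case (11 p q t)
  then show ?case
    using ass_natural'[of "term_eval C \<phi> \<psi> p" "term_eval C \<phi> \<psi> q" "term_eval C \<phi> \<psi> t"]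
    by (simp add: ten_comp')
next
  case (14 p)
  then show ?case using rho_natural[OF arr_hom, of "term_eval C \<phi> \<psi> p"] by simp
next
  case (17 p)
  then show ?case using lam_natural[OF arr_hom, of "term_eval C \<phi> \<psi> p"] by simp
next
  case (19 p q)
  then show ?case
    using sym_natural[OF arr_hom arr_hom, of "term_eval C \<phi> \<psi> p" "term_eval C \<phi> \<psi> q"]
    by (simp add: ten_comp')
qed (simp_all add: ten_comp' assoc[symmetric] inv_simps pentagon triangle hexagon unit_sym)

end

locale model = evaluation +
  assumes respects: "\<lbrakk>R t u; wf_term \<Sigma> t; wf_term \<Sigma> u\<rbrakk> \<Longrightarrow> term_eval C \<phi> \<psi> t = term_eval C \<phi> \<psi> u"
begin

lemma eval_fcong: "fcong \<Sigma> R t u \<Longrightarrow> term_eval C \<phi> \<psi> t = term_eval C \<phi> \<psi> u"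
  by (induction rule: fcong.induct) (simp_all add: smc_law_sound respects)

abbreviation "ext \<equiv> strict_extension P C \<phi> \<psi>"

lemma ext_simps [simp]:
  "wf_word \<Sigma> X \<Longrightarrow> FO ext X = word_eval C \<phi> X"
  "wf_term \<Sigma> t \<Longrightarrow> FA ext (cl t) = term_eval C \<phi> \<psi> t"
  "F0 ext = \<one> \<I>"
  "\<lbrakk>wf_word \<Sigma> X; wf_word \<Sigma> Y\<rbrakk> \<Longrightarrow> F2 ext X Y = \<one> (word_eval C \<phi> X \<odot> word_eval C \<phi> Y)"
  using image_cl[of t "term_eval C \<phi> \<psi>"] eval_fcong by (auto simp: strict_extension_def)

text \<open>
All comparison arrows are identities and evaluation commutes with the structure, so that the
axioms become trivial once the value on a class is computed from a representative.
\<close>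

theorem strict_extension_SMC: "ext \<in> SMC P C"
proof -
  interpret P: symmetric_monoidal_category P by (rule presented_smc)
  have "symmetric_monoidal_functor P C ext"
  proof unfold_locales
    show "FO ext \<in> extensional (Obj P)" "FA ext \<in> extensional (Arr P)" "F2 ext \<in> extensional (Obj P)"
      "\<And>a. a \<in> Obj P \<Longrightarrow> F2 ext a \<in> extensional (Obj P)"
      by (simp_all add: strict_extension_def)
  next
    fix f a b assume "f \<in> hom P a b"
    then show "FA ext f \<in> hom C (FO ext a) (FO ext b)" by (auto intro!: homI)
  next
    fix f g a b c assume "f \<in> hom P a b" "g \<in> hom P b c"
    then show "FA ext (g \<cdot>\<^bsub>P\<^esub> f) = FA ext g \<cdot> FA ext f" by auto
  next
    fix f g a a' b b' assume "f \<in> hom P a a'" "g \<in> hom P b b'"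
    then show "F2 ext a' b' \<cdot> (FA ext f \<otimes> FA ext g) = FA ext (f \<otimes>\<^bsub>P\<^esub> g) \<cdot> F2 ext a b"
      by (auto simp: ten_comp')
  qed (auto intro!: homI)
  then show ?thesis by (simp add: SMC_def)
qed

end

lemma word_eval_cong: "\<lbrakk>wf_word \<Sigma> X; \<And>x. x \<in> GObj \<Sigma> \<Longrightarrow> \<phi> x = \<phi>' x\<rbrakk> \<Longrightarrow> word_eval C \<phi> X = word_eval C \<phi>' X"
  by (induction X) auto

lemma term_eval_cong: "\<lbrakk>wf_term \<Sigma> t; \<And>x. x \<in> GObj \<Sigma> \<Longrightarrow> \<phi> x = \<phi>' x; \<And>e. e \<in> GArr \<Sigma> \<Longrightarrow> \<psi> e = \<psi>' e\<rbrakk> \<Longrightarrow>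
    term_eval C \<phi> \<psi> t = term_eval C \<phi>' \<psi>' t"
  by (induction t) (auto simp: word_eval_cong[of \<Sigma> _ \<phi> \<phi>' C])

lemma (in presentation) strict_extension_cong:
  assumes "\<And>x. x \<in> GObj \<Sigma> \<Longrightarrow> \<phi> x = \<phi>' x" "\<And>e. e \<in> GArr \<Sigma> \<Longrightarrow> \<psi> e = \<psi>' e"
  shows "strict_extension P C \<phi> \<psi> = strict_extension P C \<phi>' \<psi>'"
proof -
  have w: "word_eval C \<phi> X = word_eval C \<phi>' X" if "wf_word \<Sigma> X" for X
    using that assms(1) by (rule word_eval_cong)
  have "term_eval C \<phi> \<psi> ` p = term_eval C \<phi>' \<psi>' ` p" if "p \<in> Arr P" for p
  proof (rule image_cong[OF HOL.refl])
    fix t assume "t \<in> p"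
    then have "wf_term \<Sigma> t" using that by (auto simp: P_Arr fclass_def dest: fcong_parallel)
    then show "term_eval C \<phi> \<psi> t = term_eval C \<phi>' \<psi>' t" using assms by (rule term_eval_cong)
  qed
  then show ?thesis
    by (auto simp: strict_extension_def w intro!: restrict_ext)
qed

section \<open>Models of the tensor product\<close>

lemma tensor_sig_simps [simp]:
  "GObj (tensor_sig A B) = Obj A \<times> Obj B"
  "Alpha b \<in> GArr (tensor_sig A B) \<longleftrightarrow> b \<in> Obj B"
  "Beta a \<in> GArr (tensor_sig A B) \<longleftrightarrow> a \<in> Obj A"
  "Gam a a' b \<in> GArr (tensor_sig A B) \<longleftrightarrow> a \<in> Obj A \<and> a' \<in> Obj A \<and> b \<in> Obj B"
  "Del a b b' \<in> GArr (tensor_sig A B) \<longleftrightarrow> a \<in> Obj A \<and> b \<in> Obj B \<and> b' \<in> Obj B"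
  "LArr f b \<in> GArr (tensor_sig A B) \<longleftrightarrow> f \<in> Arr A \<and> b \<in> Obj B"
  "RArr a g \<in> GArr (tensor_sig A B) \<longleftrightarrow> a \<in> Obj A \<and> g \<in> Arr B"
  "GSrc (tensor_sig A B) (Alpha b) = WUnit"
  "GSrc (tensor_sig A B) (Beta a) = WUnit"
  "GSrc (tensor_sig A B) (Gam a a' b) = WTen (WGen (a, b)) (WGen (a', b))"
  "GSrc (tensor_sig A B) (Del a b b') = WTen (WGen (a, b)) (WGen (a, b'))"
  "GSrc (tensor_sig A B) (LArr f b) = WGen (Src A f, b)"
  "GSrc (tensor_sig A B) (RArr a g) = WGen (a, Src B g)"
  "GTgt (tensor_sig A B) (Alpha b) = WGen (\<I>\<^bsub>A\<^esub>, b)"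
  "GTgt (tensor_sig A B) (Beta a) = WGen (a, \<I>\<^bsub>B\<^esub>)"
  "GTgt (tensor_sig A B) (Gam a a' b) = WGen (a \<odot>\<^bsub>A\<^esub> a', b)"
  "GTgt (tensor_sig A B) (Del a b b') = WGen (a, b \<odot>\<^bsub>B\<^esub> b')"
  "GTgt (tensor_sig A B) (LArr f b) = WGen (Tgt A f, b)"
  "GTgt (tensor_sig A B) (RArr a g) = WGen (a, Tgt B g)"
  by (simp_all add: tensor_sig_def)

locale smc_pair = A: symmetric_monoidal_category A + B: symmetric_monoidal_category B
  for A :: "('a, 'm) smcat" and B :: "('b, 'n) smcat"

lemma (in smc_pair) tensor_presentation: "presentation (tensor_sig A B) (tensor_rel A B)"
proof
  fix e assume "e \<in> GArr (tensor_sig A B)"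
  then show "wf_word (tensor_sig A B) (GSrc (tensor_sig A B) e)"
    "wf_word (tensor_sig A B) (GTgt (tensor_sig A B) e)"
    by (cases e; simp)+
next
  fix t u assume "tensor_rel A B t u" "wf_term (tensor_sig A B) t" "wf_term (tensor_sig A B) u"
  then show "fsrc (tensor_sig A B) t = fsrc (tensor_sig A B) u \<and>
      ftgt (tensor_sig A B) t = ftgt (tensor_sig A B) u"
    by (cases rule: tensor_rel.cases) auto
qed

text \<open>
A model of the tensor product: by its explicit form below, a symmetric monoidal functor in each
variable, with compatibilities between the two.
\<close>

locale tensor_model = smc_pair A B + model "tensor_sig A B" "tensor_rel A B" C \<phi> \<psi>
  for A :: "('a, 'm) smcat" and B :: "('b, 'n) smcat" and C :: "('o, 'k) smcat" (structure)
    and \<phi> :: "'a \<times> 'b \<Rightarrow> 'o" and \<psi> :: "('a, 'm, 'b, 'n) tgen \<Rightarrow> 'k"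

text \<open>
The relations need only be checked under the assumption that evaluation is typed, which makes the
typing facts of \<open>evaluation\<close> available in that check.
\<close>

lemma (in smc_pair) tensor_modelI:
  assumes "symmetric_monoidal_category C"
    and "\<And>x. x \<in> Obj A \<times> Obj B \<Longrightarrow> \<phi> x \<in> Obj C"
    and "\<And>e. e \<in> GArr (tensor_sig A B) \<Longrightarrow>
      \<psi> e \<in> hom C (word_eval C \<phi> (GSrc (tensor_sig A B) e)) (word_eval C \<phi> (GTgt (tensor_sig A B) e))"
    and "\<And>t u. \<lbrakk>evaluation (tensor_sig A B) (tensor_rel A B) C \<phi> \<psi>;
      tensor_rel A B t u; wf_term (tensor_sig A B) t; wf_term (tensor_sig A B) u\<rbrakk> \<Longrightarrow>
      term_eval C \<phi> \<psi> t = term_eval C \<phi> \<psi> u"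
  shows "tensor_model A B C \<phi> \<psi>"
proof -
  interpret C: symmetric_monoidal_category C by fact
  interpret presentation "tensor_sig A B" "tensor_rel A B" by (rule tensor_presentation)
  interpret evaluation "tensor_sig A B" "tensor_rel A B" C \<phi> \<psi>
    using assms(2,3) by unfold_locales auto
  show ?thesis
    using assms(4) evaluation_axioms by unfold_locales auto
qed

lemma (in smc_pair) tensor_generic_model:
  "tensor_model A B (tensor A B) WGen (tensor_gen A B)"
proof -
  interpret presentation "tensor_sig A B" "tensor_rel A B" by (rule tensor_presentation)
  have e: "tensor_gen A B = (\<lambda>x. cl (FGen x))"
    by (auto simp: tensor_gen_def)
  interpret generator_assignment "tensor A B" "tensor_sig A B" WGen "tensor_gen A B"
    using class_assignment unfolding tensor_def e .
  show ?thesis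
    by unfold_locales (simp add: tensor_def e eval_class cl_rel)
qed

context tensor_model
begin

lemma obj_gen [simp]: "\<lbrakk>a \<in> Obj A; b \<in> Obj B\<rbrakk> \<Longrightarrow> \<phi> (a, b) \<in> Obj C"
  using gen_obj by simp

lemma gen_simps [simp]:
  "b \<in> Obj B \<Longrightarrow> \<psi> (Alpha b) \<in> Arr C" "b \<in> Obj B \<Longrightarrow> Src C (\<psi> (Alpha b)) = \<I>"
  "b \<in> Obj B \<Longrightarrow> Tgt C (\<psi> (Alpha b)) = \<phi> (\<I>\<^bsub>A\<^esub>, b)"
  "a \<in> Obj A \<Longrightarrow> \<psi> (Beta a) \<in> Arr C" "a \<in> Obj A \<Longrightarrow> Src C (\<psi> (Beta a)) = \<I>"
  "a \<in> Obj A \<Longrightarrow> Tgt C (\<psi> (Beta a)) = \<phi> (a, \<I>\<^bsub>B\<^esub>)"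
  "\<lbrakk>a \<in> Obj A; a' \<in> Obj A; b \<in> Obj B\<rbrakk> \<Longrightarrow> \<psi> (Gam a a' b) \<in> Arr C"
  "\<lbrakk>a \<in> Obj A; a' \<in> Obj A; b \<in> Obj B\<rbrakk> \<Longrightarrow> Src C (\<psi> (Gam a a' b)) = \<phi> (a, b) \<odot> \<phi> (a', b)"
  "\<lbrakk>a \<in> Obj A; a' \<in> Obj A; b \<in> Obj B\<rbrakk> \<Longrightarrow> Tgt C (\<psi> (Gam a a' b)) = \<phi> (a \<odot>\<^bsub>A\<^esub> a', b)"
  "\<lbrakk>a \<in> Obj A; b \<in> Obj B; b' \<in> Obj B\<rbrakk> \<Longrightarrow> \<psi> (Del a b b') \<in> Arr C"
  "\<lbrakk>a \<in> Obj A; b \<in> Obj B; b' \<in> Obj B\<rbrakk> \<Longrightarrow> Src C (\<psi> (Del a b b')) = \<phi> (a, b) \<odot> \<phi> (a, b')"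
  "\<lbrakk>a \<in> Obj A; b \<in> Obj B; b' \<in> Obj B\<rbrakk> \<Longrightarrow> Tgt C (\<psi> (Del a b b')) = \<phi> (a, b \<odot>\<^bsub>B\<^esub> b')"
  "\<lbrakk>f \<in> Arr A; b \<in> Obj B\<rbrakk> \<Longrightarrow> \<psi> (LArr f b) \<in> Arr C"
  "\<lbrakk>f \<in> Arr A; b \<in> Obj B\<rbrakk> \<Longrightarrow> Src C (\<psi> (LArr f b)) = \<phi> (Src A f, b)"
  "\<lbrakk>f \<in> Arr A; b \<in> Obj B\<rbrakk> \<Longrightarrow> Tgt C (\<psi> (LArr f b)) = \<phi> (Tgt A f, b)"
  "\<lbrakk>a \<in> Obj A; g \<in> Arr B\<rbrakk> \<Longrightarrow> \<psi> (RArr a g) \<in> Arr C"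
  "\<lbrakk>a \<in> Obj A; g \<in> Arr B\<rbrakk> \<Longrightarrow> Src C (\<psi> (RArr a g)) = \<phi> (a, Src B g)"
  "\<lbrakk>a \<in> Obj A; g \<in> Arr B\<rbrakk> \<Longrightarrow> Tgt C (\<psi> (RArr a g)) = \<phi> (a, Tgt B g)"
  using gen_hom[of "Alpha b"] gen_hom[of "Beta a"] gen_hom[of "Gam a a' b"] gen_hom[of "Del a b b'"]
    gen_hom[of "LArr f b"] gen_hom[of "RArr a g"]
  by (simp_all add: hom_def)

text \<open>
The relations read in \<open>C\<close>. Those collected here say that \<open>\<phi> (a, -)\<close> is a symmetric monoidal
functor; \<open>left_equations\<close> says the same of \<open>\<phi> (-, b)\<close>, and \<open>mixed_equations\<close> relates the two.
\<close>

lemma right_equations: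
  assumes a: "a \<in> Obj A"
  shows "b \<in> Obj B \<Longrightarrow> \<psi> (RArr a (\<one>\<^bsub>B\<^esub> b)) = \<one> (\<phi> (a, b))"
    "\<lbrakk>g \<in> Arr B; g' \<in> Arr B; Src B g' = Tgt B g\<rbrakk> \<Longrightarrow>
       \<psi> (RArr a (g' \<cdot>\<^bsub>B\<^esub> g)) = \<psi> (RArr a g') \<cdot> \<psi> (RArr a g)"
    "\<lbrakk>g \<in> Arr B; g' \<in> Arr B\<rbrakk> \<Longrightarrow>
       \<psi> (Del a (Tgt B g) (Tgt B g')) \<cdot> (\<psi> (RArr a g) \<otimes> \<psi> (RArr a g'))
       = \<psi> (RArr a (g \<otimes>\<^bsub>B\<^esub> g')) \<cdot> \<psi> (Del a (Src B g) (Src B g'))"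
    "\<lbrakk>b \<in> Obj B; b' \<in> Obj B; b'' \<in> Obj B\<rbrakk> \<Longrightarrow>
       \<psi> (RArr a (ass\<^bsub>B\<^esub> b b' b'')) \<cdot> \<psi> (Del a b (b' \<odot>\<^bsub>B\<^esub> b'')) \<cdot> (\<one> (\<phi> (a, b)) \<otimes> \<psi> (Del a b' b''))
       = \<psi> (Del a (b \<odot>\<^bsub>B\<^esub> b') b'') \<cdot> (\<psi> (Del a b b') \<otimes> \<one> (\<phi> (a, b'')))
         \<cdot> ass (\<phi> (a, b)) (\<phi> (a, b')) (\<phi> (a, b''))"
    "b \<in> Obj B \<Longrightarrow> \<psi> (RArr a (\<r>\<^bsub>B\<^esub> b)) \<cdot> \<psi> (Del a b \<I>\<^bsub>B\<^esub>) \<cdot> (\<one> (\<phi> (a, b)) \<otimes> \<psi> (Beta a))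
       = \<r> (\<phi> (a, b))"
    "b \<in> Obj B \<Longrightarrow> \<psi> (RArr a (\<l>\<^bsub>B\<^esub> b)) \<cdot> \<psi> (Del a \<I>\<^bsub>B\<^esub> b) \<cdot> (\<psi> (Beta a) \<otimes> \<one> (\<phi> (a, b)))
       = \<l> (\<phi> (a, b))"
    "\<lbrakk>b \<in> Obj B; b' \<in> Obj B\<rbrakk> \<Longrightarrow>
       \<psi> (RArr a (\<s>\<^bsub>B\<^esub> b b')) \<cdot> \<psi> (Del a b b') = \<psi> (Del a b' b) \<cdot> \<s> (\<phi> (a, b)) (\<phi> (a, b'))"
  using a
    respects[OF tensor_rel.R_ide[of A B a b]]
    respects[OF tensor_rel.R_comp[of A B a g' g]]
    respects[OF tensor_rel.del_natural[of A B a g g']]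
    respects[OF tensor_rel.del_ass[of A B a b b' b'']]
    respects[OF tensor_rel.del_rho[of A B a b]]
    respects[OF tensor_rel.del_lam[of A B a b]]
    respects[OF tensor_rel.del_sym[of A B a b b']]
  by (simp_all add: ten_comp')

lemma left_equations:
  assumes b: "b \<in> Obj B"
  shows "a \<in> Obj A \<Longrightarrow> \<psi> (LArr (\<one>\<^bsub>A\<^esub> a) b) = \<one> (\<phi> (a, b))"
    "\<lbrakk>f \<in> Arr A; f' \<in> Arr A; Src A f' = Tgt A f\<rbrakk> \<Longrightarrow>
       \<psi> (LArr (f' \<cdot>\<^bsub>A\<^esub> f) b) = \<psi> (LArr f' b) \<cdot> \<psi> (LArr f b)"
    "\<lbrakk>f \<in> Arr A; f' \<in> Arr A\<rbrakk> \<Longrightarrow>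
       \<psi> (Gam (Tgt A f) (Tgt A f') b) \<cdot> (\<psi> (LArr f b) \<otimes> \<psi> (LArr f' b))
       = \<psi> (LArr (f \<otimes>\<^bsub>A\<^esub> f') b) \<cdot> \<psi> (Gam (Src A f) (Src A f') b)"
    "\<lbrakk>a \<in> Obj A; a' \<in> Obj A; a'' \<in> Obj A\<rbrakk> \<Longrightarrow>
       \<psi> (LArr (ass\<^bsub>A\<^esub> a a' a'') b) \<cdot> \<psi> (Gam a (a' \<odot>\<^bsub>A\<^esub> a'') b) \<cdot> (\<one> (\<phi> (a, b)) \<otimes> \<psi> (Gam a' a'' b))
       = \<psi> (Gam (a \<odot>\<^bsub>A\<^esub> a') a'' b) \<cdot> (\<psi> (Gam a a' b) \<otimes> \<one> (\<phi> (a'', b)))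
         \<cdot> ass (\<phi> (a, b)) (\<phi> (a', b)) (\<phi> (a'', b))"
    "a \<in> Obj A \<Longrightarrow> \<psi> (LArr (\<r>\<^bsub>A\<^esub> a) b) \<cdot> \<psi> (Gam a \<I>\<^bsub>A\<^esub> b) \<cdot> (\<one> (\<phi> (a, b)) \<otimes> \<psi> (Alpha b))
       = \<r> (\<phi> (a, b))"
    "a \<in> Obj A \<Longrightarrow> \<psi> (LArr (\<l>\<^bsub>A\<^esub> a) b) \<cdot> \<psi> (Gam \<I>\<^bsub>A\<^esub> a b) \<cdot> (\<psi> (Alpha b) \<otimes> \<one> (\<phi> (a, b)))
       = \<l> (\<phi> (a, b))"
    "\<lbrakk>a \<in> Obj A; a' \<in> Obj A\<rbrakk> \<Longrightarrow>
       \<psi> (LArr (\<s>\<^bsub>A\<^esub> a a') b) \<cdot> \<psi> (Gam a a' b) = \<psi> (Gam a' a b) \<cdot> \<s> (\<phi> (a, b)) (\<phi> (a', b))"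
  using b
    respects[OF tensor_rel.L_ide[of A B a b]]
    respects[OF tensor_rel.L_comp[of A B f' f b]]
    respects[OF tensor_rel.gam_natural[of A B f f' b]]
    respects[OF tensor_rel.gam_ass[of A B a a' a'' b]]
    respects[OF tensor_rel.gam_rho[of A B a b]]
    respects[OF tensor_rel.gam_lam[of A B a b]]
    respects[OF tensor_rel.gam_sym[of A B a a' b]]
  by (simp_all add: ten_comp')

lemma mixed_equations:
  "\<lbrakk>f \<in> Arr A; g \<in> Arr B\<rbrakk> \<Longrightarrow>
     \<psi> (LArr f (Tgt B g)) \<cdot> \<psi> (RArr (Src A f) g) = \<psi> (RArr (Tgt A f) g) \<cdot> \<psi> (LArr f (Src B g))"
  "f \<in> Arr A \<Longrightarrow> \<psi> (LArr f \<I>\<^bsub>B\<^esub>) \<cdot> \<psi> (Beta (Src A f)) = \<psi> (Beta (Tgt A f))"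
  "\<lbrakk>f \<in> Arr A; b \<in> Obj B; b' \<in> Obj B\<rbrakk> \<Longrightarrow>
     \<psi> (LArr f (b \<odot>\<^bsub>B\<^esub> b')) \<cdot> \<psi> (Del (Src A f) b b')
     = \<psi> (Del (Tgt A f) b b') \<cdot> (\<psi> (LArr f b) \<otimes> \<psi> (LArr f b'))"
  "g \<in> Arr B \<Longrightarrow> \<psi> (RArr \<I>\<^bsub>A\<^esub> g) \<cdot> \<psi> (Alpha (Src B g)) = \<psi> (Alpha (Tgt B g))"
  "\<lbrakk>a \<in> Obj A; a' \<in> Obj A; g \<in> Arr B\<rbrakk> \<Longrightarrow>
     \<psi> (RArr (a \<odot>\<^bsub>A\<^esub> a') g) \<cdot> \<psi> (Gam a a' (Src B g))
     = \<psi> (Gam a a' (Tgt B g)) \<cdot> (\<psi> (RArr a g) \<otimes> \<psi> (RArr a' g))"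
  "\<lbrakk>b \<in> Obj B; b' \<in> Obj B\<rbrakk> \<Longrightarrow>
     \<psi> (Alpha (b \<odot>\<^bsub>B\<^esub> b')) \<cdot> \<r> \<I> = \<psi> (Del \<I>\<^bsub>A\<^esub> b b') \<cdot> (\<psi> (Alpha b) \<otimes> \<psi> (Alpha b'))"
  "\<lbrakk>a \<in> Obj A; a' \<in> Obj A\<rbrakk> \<Longrightarrow>
     \<psi> (Beta (a \<odot>\<^bsub>A\<^esub> a')) \<cdot> \<r> \<I> = \<psi> (Gam a a' \<I>\<^bsub>B\<^esub>) \<cdot> (\<psi> (Beta a) \<otimes> \<psi> (Beta a'))"
  "\<psi> (Beta \<I>\<^bsub>A\<^esub>) = \<psi> (Alpha \<I>\<^bsub>B\<^esub>)"
  "\<lbrakk>a \<in> Obj A; a' \<in> Obj A; b \<in> Obj B; b' \<in> Obj B\<rbrakk> \<Longrightarrow>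
     \<psi> (Gam a a' (b \<odot>\<^bsub>B\<^esub> b')) \<cdot> (\<psi> (Del a b b') \<otimes> \<psi> (Del a' b b'))
     = \<psi> (Del (a \<odot>\<^bsub>A\<^esub> a') b b') \<cdot> (\<psi> (Gam a a' b) \<otimes> \<psi> (Gam a a' b'))
       \<cdot> interchange C (\<phi> (a, b)) (\<phi> (a, b')) (\<phi> (a', b)) (\<phi> (a', b'))"
  using
    respects[OF tensor_rel.L_R_natural[of A B f g]]
    respects[OF tensor_rel.L_beta[of A B f]]
    respects[OF tensor_rel.L_del[of A B f b b']]
    respects[OF tensor_rel.R_alpha[of A B g]]
    respects[OF tensor_rel.R_gam[of A B a a' g]]
    respects[OF tensor_rel.alpha_del[of A B b b']]
    respects[OF tensor_rel.beta_gam[of A B a a']]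
    respects[OF tensor_rel.beta_alpha[of A B]]
    respects[OF tensor_rel.gam_del[of A B a a' b b']]
  by (simp_all add: ten_comp' eval_interchange)

end

section \<open>Exchanging the two factors\<close>

fun swap_tgen :: "('a, 'm, 'b, 'n) tgen \<Rightarrow> ('b, 'n, 'a, 'm) tgen" where
  "swap_tgen (Alpha b) = Beta b"
| "swap_tgen (Beta a) = Alpha a"
| "swap_tgen (Gam a a' b) = Del b a a'"
| "swap_tgen (Del a b b') = Gam b b' a"
| "swap_tgen (LArr f b) = RArr b f"
| "swap_tgen (RArr a g) = LArr g a"

lemma swap_tgen_swap_tgen [simp]: "swap_tgen (swap_tgen x) = x"
  by (cases x) auto

text \<open>
The relations come in pairs exchanged by \<open>swap_tgen\<close>, or are symmetric themselves. The one exception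
is the relation between \<open>\<gamma>\<close> and \<open>\<delta>\<close>, whose mirror image has the interchange on the other side; the two
are equivalent because the interchange is an involution.
\<close>

theorem (in tensor_model) swapped_model:
  "tensor_model B A C (\<lambda>x. \<phi> (prod.swap x)) (\<lambda>x. \<psi> (swap_tgen x))"
proof -
  interpret swapped: smc_pair B A by unfold_locales
  show ?thesis
  proof (rule swapped.tensor_modelI)
    show "symmetric_monoidal_category C" by unfold_locales
    show "\<phi> (prod.swap x) \<in> Obj C" if "x \<in> Obj B \<times> Obj A" for x
      using that by auto
    show "\<psi> (swap_tgen e) \<in> hom C (word_eval C (\<lambda>x. \<phi> (prod.swap x)) (GSrc (tensor_sig B A) e))
        (word_eval C (\<lambda>x. \<phi> (prod.swap x)) (GTgt (tensor_sig B A) e))"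
      if "e \<in> GArr (tensor_sig B A)" for e
      using that by (cases e) (auto intro: homI)
    fix t u assume ev: "evaluation (tensor_sig B A) (tensor_rel B A) C
        (\<lambda>x. \<phi> (prod.swap x)) (\<lambda>x. \<psi> (swap_tgen x))"
      and rel: "tensor_rel B A t u" and wf: "wf_term (tensor_sig B A) t" "wf_term (tensor_sig B A) u"
    interpret ev: evaluation "tensor_sig B A" "tensor_rel B A" C
        "\<lambda>x. \<phi> (prod.swap x)" "\<lambda>x. \<psi> (swap_tgen x)" by (rule ev)
    show "term_eval C (\<lambda>x. \<phi> (prod.swap x)) (\<lambda>x. \<psi> (swap_tgen x)) t
        = term_eval C (\<lambda>x. \<phi> (prod.swap x)) (\<lambda>x. \<psi> (swap_tgen x)) u"
      using rel wf
    proof (cases rule: tensor_rel.cases)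
      case (gam_del b b' a a')
      then have [simp]: "a \<in> Obj A" "a' \<in> Obj A" "b \<in> Obj B" "b' \<in> Obj B"
        using wf by auto
      let ?m = "interchange C (\<phi> (a, b)) (\<phi> (a', b)) (\<phi> (a, b')) (\<phi> (a', b'))"
      have "\<psi> (Del (a \<odot>\<^bsub>A\<^esub> a') b b') \<cdot> (\<psi> (Gam a a' b) \<otimes> \<psi> (Gam a a' b'))
        = (\<psi> (Del (a \<odot>\<^bsub>A\<^esub> a') b b') \<cdot> (\<psi> (Gam a a' b) \<otimes> \<psi> (Gam a a' b'))
           \<cdot> interchange C (\<phi> (a, b)) (\<phi> (a, b')) (\<phi> (a', b)) (\<phi> (a', b'))) \<cdot> ?m"
        by (simp add: assoc interchange_involutive)
      also have "\<dots> = \<psi> (Gam a a' (b \<odot>\<^bsub>B\<^esub> b')) \<cdot> (\<psi> (Del a b b') \<otimes> \<psi> (Del a' b b')) \<cdot> ?m"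
        by (simp add: mixed_equations(9))
      finally show ?thesis
        unfolding gam_del by (simp add: ev.eval_interchange ten_comp')
    qed (use wf in \<open>simp_all add: ten_comp' right_equations left_equations mixed_equations\<close>)
  qed
qed

section \<open>Currying\<close>

text \<open>
The functor \<open>\<phi> (a, -)\<close>. For the generic model this is \<open>eta_at\<close>.
\<close>

definition partial_functor :: "('b, 'n) smcat \<Rightarrow> ('a \<times> 'b \<Rightarrow> 'o) \<Rightarrow> (('a, 'm, 'b, 'n) tgen \<Rightarrow> 'k) \<Rightarrow> 'a
    \<Rightarrow> ('b, 'n, 'o, 'k) smfun" where
  "partial_functor B \<phi> \<psi> a =
    \<lparr> FO = (\<lambda>b\<in>Obj B. \<phi> (a, b)), FA = (\<lambda>g\<in>Arr B. \<psi> (RArr a g)), F0 = \<psi> (Beta a),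
      F2 = (\<lambda>b\<in>Obj B. \<lambda>b'\<in>Obj B. \<psi> (Del a b b')) \<rparr>"

text \<open>
The functor from \<open>A\<close> to the internal hom of \<open>B\<close> and \<open>C\<close> that corresponds to a model. It generalises
\<open>eta\<close>, so that \<open>eta\<close> and its dual are two instances of the same construction.
\<close>

definition curried :: "('a, 'm) smcat \<Rightarrow> ('b, 'n) smcat \<Rightarrow> ('o, 'k) smcat \<Rightarrow> ('a \<times> 'b \<Rightarrow> 'o)
    \<Rightarrow> (('a, 'm, 'b, 'n) tgen \<Rightarrow> 'k)
    \<Rightarrow> ('a, 'm, ('b, 'n, 'o, 'k) smfun, ('b, 'n, 'o, 'k) smtrans) smfun" where
  "curried A B C \<phi> \<psi> =
    \<lparr> FO = (\<lambda>a\<in>Obj A. partial_functor B \<phi> \<psi> a),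
      FA = (\<lambda>f\<in>Arr A. (partial_functor B \<phi> \<psi> (Src A f), partial_functor B \<phi> \<psi> (Tgt A f),
             \<lambda>b\<in>Obj B. \<psi> (LArr f b))),
      F0 = (unit_functor B C, partial_functor B \<phi> \<psi> \<I>\<^bsub>A\<^esub>, \<lambda>b\<in>Obj B. \<psi> (Alpha b)),
      F2 = (\<lambda>a\<in>Obj A. \<lambda>a'\<in>Obj A.
             (box B C (partial_functor B \<phi> \<psi> a) (partial_functor B \<phi> \<psi> a'),
              partial_functor B \<phi> \<psi> (a \<odot>\<^bsub>A\<^esub> a'), \<lambda>b\<in>Obj B. \<psi> (Gam a a' b))) \<rparr>"

lemma partial_functor_simps [simp]:
  "b \<in> Obj B \<Longrightarrow> FO (partial_functor B \<phi> \<psi> a) b = \<phi> (a, b)"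
  "g \<in> Arr B \<Longrightarrow> FA (partial_functor B \<phi> \<psi> a) g = \<psi> (RArr a g)"
  "F0 (partial_functor B \<phi> \<psi> a) = \<psi> (Beta a)"
  "\<lbrakk>b \<in> Obj B; b' \<in> Obj B\<rbrakk> \<Longrightarrow> F2 (partial_functor B \<phi> \<psi> a) b b' = \<psi> (Del a b b')"
  by (simp_all add: partial_functor_def)

lemma eta_curried: "eta A B = curried A B (tensor A B) WGen (tensor_gen A B)"
  by (simp add: eta_def curried_def eta_at_def partial_functor_def)

context tensor_model
begin

lemma partial_functor_SMC:
  assumes [simp]: "a \<in> Obj A"
  shows "partial_functor B \<phi> \<psi> a \<in> SMC B C"
proof -
  let ?F = "partial_functor B \<phi> \<psi> a"
  have "symmetric_monoidal_functor B C ?F"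
  proof unfold_locales
    show "FO ?F \<in> extensional (Obj B)" "FA ?F \<in> extensional (Arr B)" "F2 ?F \<in> extensional (Obj B)"
      "\<And>b. b \<in> Obj B \<Longrightarrow> F2 ?F b \<in> extensional (Obj B)"
      by (simp_all add: partial_functor_def)
  next
    fix f b b' assume f: "f \<in> hom B b b'"
    show "FA ?F f \<in> hom C (FO ?F b) (FO ?F b')"
      using B.homD[OF f] B.hom_obj[OF f] by (intro homI) auto
  next
    fix f g b c d assume f: "f \<in> hom B b c" and g: "g \<in> hom B c d"
    show "FA ?F (g \<cdot>\<^bsub>B\<^esub> f) = FA ?F g \<cdot> FA ?F f"
      using B.homD[OF f] B.homD[OF g] by (simp add: right_equations(2))
  next
    fix f g b b' c c' assume f: "f \<in> hom B b b'" and g: "g \<in> hom B c c'"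
    show "F2 ?F b' c' \<cdot> (FA ?F f \<otimes> FA ?F g) = FA ?F (f \<otimes>\<^bsub>B\<^esub> g) \<cdot> F2 ?F b c"
      using right_equations(3)[of a f g] B.homD[OF f] B.homD[OF g] B.hom_obj[OF f] B.hom_obj[OF g]
      by simp
  qed (auto intro!: homI simp: right_equations)
  then show ?thesis by (simp add: SMC_def)
qed

lemma monoidal_transformationI:
  assumes "F \<in> SMC B C" "G \<in> SMC B C" "\<sigma> \<in> extensional (Obj B)"
    and "\<And>b. b \<in> Obj B \<Longrightarrow> \<sigma> b \<in> Arr C" "\<And>b. b \<in> Obj B \<Longrightarrow> Src C (\<sigma> b) = FO F b"
    "\<And>b. b \<in> Obj B \<Longrightarrow> Tgt C (\<sigma> b) = FO G b"
    and "\<And>g. g \<in> Arr B \<Longrightarrow> \<sigma> (Tgt B g) \<cdot> FA F g = FA G g \<cdot> \<sigma> (Src B g)"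
    and "\<sigma> \<I>\<^bsub>B\<^esub> \<cdot> F0 F = F0 G"
    and "\<And>b b'. \<lbrakk>b \<in> Obj B; b' \<in> Obj B\<rbrakk> \<Longrightarrow> \<sigma> (b \<odot>\<^bsub>B\<^esub> b') \<cdot> F2 F b b' = F2 G b b' \<cdot> (\<sigma> b \<otimes> \<sigma> b')"
  shows "monoidal_transformation B C F G \<sigma>"
  using assms by (auto simp: monoidal_transformation_def hom_def)

lemma curried_arr:
  assumes [simp]: "f \<in> Arr A"
  shows "monoidal_transformation B C (partial_functor B \<phi> \<psi> (Src A f)) (partial_functor B \<phi> \<psi> (Tgt A f))
    (\<lambda>b\<in>Obj B. \<psi> (LArr f b))"
  by (rule monoidal_transformationI) (auto simp: partial_functor_SMC mixed_equations)

text \<open>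
The equations of \<open>mixed_equations\<close> are the axioms of the transformations given by \<open>\<alpha>\<close>, by \<open>\<gamma>\<close> and
by the arrows of \<open>A\<close>; here it is the naturality of \<open>\<alpha>\<close>, its compatibility with \<open>\<delta>\<close>, and
\<open>\<beta> = \<alpha>\<close> at the units.
\<close>

lemma curried_unit:
  "monoidal_transformation B C (unit_functor B C) (partial_functor B \<phi> \<psi> \<I>\<^bsub>A\<^esub>) (\<lambda>b\<in>Obj B. \<psi> (Alpha b))"
proof (rule monoidal_transformationI)
  show "unit_functor B C \<in> SMC B C"
    by (rule unit_functor_SMC) unfold_locales
qed (auto simp: partial_functor_SMC mixed_equations unit_functor_def)

lemma curried_tensor:
  assumes [simp]: "a \<in> Obj A" "a' \<in> Obj A"
  shows "monoidal_transformation B C (box B C (partial_functor B \<phi> \<psi> a) (partial_functor B \<phi> \<psi> a'))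
    (partial_functor B \<phi> \<psi> (a \<odot>\<^bsub>A\<^esub> a')) (\<lambda>b\<in>Obj B. \<psi> (Gam a a' b))"
proof (rule monoidal_transformationI)
  show "box B C (partial_functor B \<phi> \<psi> a) (partial_functor B \<phi> \<psi> a') \<in> SMC B C"
    by (simp add: box_SMC partial_functor_SMC)
  show "(\<lambda>b\<in>Obj B. \<psi> (Gam a a' b)) \<I>\<^bsub>B\<^esub> \<cdot> F0 (box B C (partial_functor B \<phi> \<psi> a) (partial_functor B \<phi> \<psi> a'))
     = F0 (partial_functor B \<phi> \<psi> (a \<odot>\<^bsub>A\<^esub> a'))"
    by (simp add: box_def assoc[symmetric] mixed_equations(7)[symmetric])
      (simp add: assoc inv_simps)
  show "(\<lambda>b\<in>Obj B. \<psi> (Gam a a' b)) (b \<odot>\<^bsub>B\<^esub> b') \<cdot> F2 (box B C (partial_functor B \<phi> \<psi> a) (partial_functor B \<phi> \<psi> a')) b b'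
     = F2 (partial_functor B \<phi> \<psi> (a \<odot>\<^bsub>A\<^esub> a')) b b' \<cdot> ((\<lambda>b\<in>Obj B. \<psi> (Gam a a' b)) b \<otimes> (\<lambda>b\<in>Obj B. \<psi> (Gam a a' b)) b')"
    if [simp]: "b \<in> Obj B" "b' \<in> Obj B" for b b'
    \<comment> \<open>the interchange from the pointwise tensor product cancels the one in the relation between \<open>\<gamma>\<close> and \<open>\<delta>\<close>\<close>
    by (simp add: box_def assoc[symmetric] mixed_equations(9))
      (simp add: assoc interchange_involutive)
qed (auto simp: partial_functor_SMC box_SMC mixed_equations box_def)

lemmas curried_ihom = partial_functor_SMC curried_arr curried_unit curried_tensor

text \<open>
Evaluation is only defined on members of the internal hom. This is why the partial functors and the
transformations between them had to be shown to be symmetric monoidal.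
\<close>

theorem ev_curried:
  assumes [simp]: "b \<in> Obj B"
  shows "smf_comp A C (ev B C b) (curried A B C \<phi> \<psi>)
    = partial_functor A (\<lambda>x. \<phi> (prod.swap x)) (\<lambda>x. \<psi> (swap_tgen x)) b"
  using curried_ihom
  by (auto simp: smf_comp_def curried_def ev_def ihom_def partial_functor_def box_SMC intro!: restrict_ext)

text \<open>
Both dualising and swapping exchange the roles of the two variables, and the data match one by one.
\<close>

theorem dual_curried:
  "dual A B C (curried A B C \<phi> \<psi>) = curried B A C (\<lambda>x. \<phi> (prod.swap x)) (\<lambda>x. \<psi> (swap_tgen x))"
proof -
  have "dual_at A (curried A B C \<phi> \<psi>) b = partial_functor A (\<lambda>x. \<phi> (prod.swap x)) (\<lambda>x. \<psi> (swap_tgen x)) b"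
    if "b \<in> Obj B" for b
    using that by (auto simp: dual_at_def curried_def partial_functor_def intro!: restrict_ext)
  then show ?thesis
    by (auto simp: dual_def curried_def[of B A] curried_def[of A B, THEN arg_cong[of _ _ FO]]
        intro!: restrict_ext)
qed

theorem En_curried: "En A B C (curried A B C \<phi> \<psi>) = strict_extension (tensor A B) C \<phi> \<psi>"
  unfolding En_def tensor_def
proof (rule strict_extension_cong)
  fix e assume "e \<in> GArr (tensor_sig A B)"
  then show "(case e of Alpha b \<Rightarrow> component (F0 (curried A B C \<phi> \<psi>)) b
       | Beta a \<Rightarrow> F0 (FO (curried A B C \<phi> \<psi>) a)
       | Gam a a' b \<Rightarrow> component (F2 (curried A B C \<phi> \<psi>) a a') b
       | Del a b b' \<Rightarrow> F2 (FO (curried A B C \<phi> \<psi>) a) b b'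
       | LArr f b \<Rightarrow> component (FA (curried A B C \<phi> \<psi>) f) b
       | RArr a g \<Rightarrow> FA (FO (curried A B C \<phi> \<psi>) a) g) = \<psi> e"
    by (cases e) (auto simp: curried_def)
qed (auto simp: curried_def)

text \<open>
The strict functor induced by a model sends each generator to its image in the model, hence the
partial functors of the generic model to those of the given model. The second variable is fixed here,
as in the functor \<open>R'\<close>.
\<close>

theorem ext_partial_functor:
  assumes [simp]: "b \<in> Obj B"
  shows "smf_comp A C (strict_extension (tensor A B) C \<phi> \<psi>)
      (partial_functor A (\<lambda>x. WGen (prod.swap x)) (\<lambda>x. tensor_gen A B (swap_tgen x)) b)
    = partial_functor A (\<lambda>x. \<phi> (prod.swap x)) (\<lambda>x. \<psi> (swap_tgen x)) b"
  using ext_simps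
  by (auto simp: smf_comp_def partial_functor_def tensor_def tensor_gen_def intro!: restrict_ext)

end

section \<open>The symmetry after the right unit\<close>

lemma free_smc_smc: "symmetric_monoidal_category free_smc"
  and star_obj: "star \<in> Obj free_smc"
proof -
  interpret presentation "\<lparr>GObj = UNIV, GArr = {}, GSrc = (\<lambda>_. WUnit), GTgt = (\<lambda>_. WUnit)\<rparr>"
      "\<lambda>_ _. False"
    by unfold_locales simp_all
  show "symmetric_monoidal_category free_smc" "star \<in> Obj free_smc"
    using presented_smc by (simp_all add: free_smc_def star_def)
qed

theorem lemma19p1:
  fixes A :: "('o, 'm) smcat"
  assumes "symmetric_monoidal_category A"
  shows "R'_fun A \<in> SMC A (tensor A free_smc)
       \<and> S_fun A free_smc \<in> SMC (tensor A free_smc) (tensor free_smc A)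
       \<and> L'_fun A \<in> SMC A (tensor free_smc A)
       \<and> smf_comp A (tensor free_smc A) (S_fun A free_smc) (R'_fun A) = L'_fun A"
proof -
  interpret AI: smc_pair A free_smc
    using assms free_smc_smc by (simp add: smc_pair_def)
  interpret IA: smc_pair free_smc A
    using assms free_smc_smc by (simp add: smc_pair_def)
  interpret AI: tensor_model A free_smc "tensor A free_smc" WGen "tensor_gen A free_smc"
    by (rule AI.tensor_generic_model)
  interpret IA: tensor_model free_smc A "tensor free_smc A" WGen "tensor_gen free_smc A"
    by (rule IA.tensor_generic_model)
  interpret AI': tensor_model free_smc A "tensor A free_smc"
      "\<lambda>x. WGen (prod.swap x)" "\<lambda>x. tensor_gen A free_smc (swap_tgen x)"
    by (rule AI.swapped_model)
  interpret IA': tensor_model A free_smc "tensor free_smc A"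
      "\<lambda>x. WGen (prod.swap x)" "\<lambda>x. tensor_gen free_smc A (swap_tgen x)"
    by (rule IA.swapped_model)
  have R': "R'_fun A
      = partial_functor A (\<lambda>x. WGen (prod.swap x)) (\<lambda>x. tensor_gen A free_smc (swap_tgen x)) star"
    unfolding R'_fun_def eta_curried by (rule AI.ev_curried[OF star_obj])
  have S: "S_fun A free_smc = strict_extension (tensor A free_smc) (tensor free_smc A)
      (\<lambda>x. WGen (prod.swap x)) (\<lambda>x. tensor_gen free_smc A (swap_tgen x))"
    unfolding S_fun_def eta_curried IA.dual_curried by (rule IA'.En_curried)
  have L': "L'_fun A = partial_functor A WGen (tensor_gen free_smc A) star"
    unfolding L'_fun_def eta_curried IA.dual_curried
    using IA'.ev_curried[OF star_obj] by simp
  have "R'_fun A \<in> SMC A (tensor A free_smc)"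
    unfolding R' by (rule AI'.partial_functor_SMC[OF star_obj])
  moreover have "S_fun A free_smc \<in> SMC (tensor A free_smc) (tensor free_smc A)"
    using IA'.strict_extension_SMC unfolding S tensor_def .
  moreover have "L'_fun A \<in> SMC A (tensor free_smc A)"
    unfolding L' by (rule IA.partial_functor_SMC[OF star_obj])
  moreover have "smf_comp A (tensor free_smc A) (S_fun A free_smc) (R'_fun A) = L'_fun A"
    unfolding S R' L' using IA'.ext_partial_functor[OF star_obj] by simp
  ultimately show ?thesis by blast
qed

end
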